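(* Consider the symmetric facilitated exclusion process on the circle $\mathbb{T}_N$ with $k$ particles, with $\epsilon$-mixing time $T^{N,k}_{\mathrm{cir}}(\epsilon)$, ergodic component $\mathcal{G}_{N,k}$, and log-Sobolev constant $\alpha_{N,k}$ of the process on $\mathcal{G}_{N,k}$. Let $\epsilon\in(0,1)$ be given, and let $k=k(N)>N/2$ be a sequence of integers such that $k(N)/N\rightarrow\rho\in(1/2,1)$ as $N\rightarrow\infty$. (a) There exists a constant $C_\rho>0$, depending only on $\rho$, such that $$ \liminf_{N\to \infty} \frac{T^{N,k}_{\mathrm{cir}}(\epsilon)}{N^2\log N} \geq C_\rho . $$ (b) For $N$ sufficiently large, the log-Sobolev constant satisfies $$ \alpha_{N,k}\geq C'N^{-2}, $$ for some constant $C'>0$ which does not depend on $N$.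
   Context: Symmetric facilitated exclusion process (SFEP) on the circle. Let $\mathbb{T}_N=\mathbb{Z}/N\mathbb{Z}$ and $\Omega^\circ_{N,k}=\{\xi\in\{0,1\}^{\mathbb{T}_N}:\sum_{x\in\mathbb{T}_N}\xi(x)=k\}$; $\xi(x)=1$ means a particle at $x$, $\xi(x)=0$ a hole. The SFEP is the continuous-time Markov chain on $\Omega^\circ_{N,k}$ with generator $$\mathcal{L}^\circ f(\xi)=\sum_{x\in\mathbb{T}_N}\tfrac12\xi(x)\xi(x-1)(1-\xi(x+1))[f(\xi^{x,x+1})-f(\xi)]+\sum_{x\in\mathbb{T}_N}\tfrac12\xi(x)\xi(x+1)(1-\xi(x-1))[f(\xi^{x,x-1})-f(\xi)],$$ where $\xi^{x,y}$ is obtained from $\xi$ by exchanging the values at $x$ and $y$. The ergodic component is $\mathcal{G}_{N,k}=\{\xi\in\Omega^\circ_{N,k}:\xi(x)+\xi(x+1)\ge 1\ \forall x\in\mathbb{T}_N\}$, and the equilibrium distribution $\nu_{N,k}$ is the uniform distribution on $\mathcal{G}_{N,k}$, with respect to which the dynamics restricted to $\mathcal{G}_{N,k}$ is reversible. Mixing time: let $P_t^\xi$ be the law at time $t$ of the SFEP started from $\xi\in\Omega^\circ_{N,k}$, $d^\circ_{N,k}(t)=\max_{\xi\in\Omega^\circ_{N,k}}\|P_t^\xi-\nu_{N,k}\|_{\mathrm{TV}}$, and $T^{N,k}_{\mathrm{cir}}(\epsilon)=\inf\{t\ge0:d^\circ_{N,k}(t)\le\epsilon\}$. Log-Sobolev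 constant: write $\nu(f)$ for the expectation of $f$ under $\nu$. For nonnegative $f$ let $\mathrm{Ent}_{\nu_{N,k}}(f)=\nu_{N,k}(f\log f)-\nu_{N,k}(f)\log\nu_{N,k}(f)$ (with $0\log 0=0$). The Dirichlet form is $$\mathcal{D}(f)=-\nu_{N,k}(f\mathcal{L}^\circ f)=\frac12\sum_{\xi,\xi'\in\mathcal{G}_{N,k}}\nu_{N,k}(\xi)c(\xi,\xi')(f(\xi)-f(\xi'))^2,$$ where $c(\xi,\xi')$ is the jump rate of the SFEP from $\xi$ to $\xi'$. The constant $\alpha_{N,k}$ is the largest constant $\alpha$ such that $\alpha\,\mathrm{Ent}_{\nu_{N,k}}(f^2)\le\mathcal{D}(f)$ for all $f:\Omega^\circ_{N,k}\to\mathbb{R}$. *)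

theory Defs
  imports "HOL-Probability.Probability"
begin

text \<open>
  The circle with \<open>N\<close> sites is \<open>{0..<N}\<close> with addition modulo \<open>N\<close>.  A configuration is an
  extensional function from the sites to \<open>{0, 1}\<close>, so that distinct elements of the state
  space really are distinct configurations.
\<close>

type_synonym config = "int \<Rightarrow> nat"

definition sites :: "nat \<Rightarrow> int set" where
  "sites N = {0..<int N}"

definition right :: "nat \<Rightarrow> int \<Rightarrow> int" where
  "right N x = (x + 1) mod int N"

definition left :: "nat \<Rightarrow> int \<Rightarrow> int" where
  "left N x = (x - 1) mod int N"

definition configs :: "nat \<Rightarrow> nat \<Rightarrow> config set" where
  "configs N k = {\<xi> \<in> sites N \<rightarrow>\<^sub>E {0, 1}. (\<Sum>x\<in>sites N. \<xi> x) = k}"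

definition exchange :: "config \<Rightarrow> int \<Rightarrow> int \<Rightarrow> config" where
  "exchange \<xi> x y = \<xi>(x := \<xi> y, y := \<xi> x)"

definition generator :: "nat \<Rightarrow> (config \<Rightarrow> real) \<Rightarrow> config \<Rightarrow> real" where
  "generator N f \<xi> =
     (\<Sum>x\<in>sites N. 1 / 2 * real (\<xi> x) * real (\<xi> (left N x)) * (1 - real (\<xi> (right N x)))
        * (f (exchange \<xi> x (right N x)) - f \<xi>))
   + (\<Sum>x\<in>sites N. 1 / 2 * real (\<xi> x) * real (\<xi> (right N x)) * (1 - real (\<xi> (left N x)))
        * (f (exchange \<xi> x (left N x)) - f \<xi>))"

text \<open>
  The state space is finite, so the chain with generator \<open>L\<close> has the semigroup \<open>exp (t L)\<close>,
  given by the exponential series (convergent by \<open>summable_semigroup\<close> below).  The law at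
  time \<open>t\<close> of the chain started from \<open>\<xi>\<close> is obtained by applying it to indicators.
\<close>

definition semigroup :: "nat \<Rightarrow> real \<Rightarrow> (config \<Rightarrow> real) \<Rightarrow> config \<Rightarrow> real" where
  "semigroup N t f \<xi> = (\<Sum>n. t ^ n / fact n * (generator N ^^ n) f \<xi>)"

definition law :: "nat \<Rightarrow> real \<Rightarrow> config \<Rightarrow> config \<Rightarrow> real" where
  "law N t \<xi> \<eta> = semigroup N t (indicator {\<eta>}) \<xi>"

definition ergodic_component :: "nat \<Rightarrow> nat \<Rightarrow> config set" where
  "ergodic_component N k = {\<xi> \<in> configs N k. \<forall>x\<in>sites N. \<xi> x + \<xi> (right N x) \<ge> 1}"

definition equilibrium :: "nat \<Rightarrow> nat \<Rightarrow> config pmf" where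
  "equilibrium N k = pmf_of_set (ergodic_component N k)"

text \<open>Total variation distance, as the maximal discrepancy over events.\<close>

definition tv_dist :: "nat \<Rightarrow> nat \<Rightarrow> (config \<Rightarrow> real) \<Rightarrow> config pmf \<Rightarrow> real" where
  "tv_dist N k \<mu> \<nu> =
     (MAX A\<in>Pow (configs N k). \<bar>(\<Sum>\<eta>\<in>A. \<mu> \<eta>) - measure_pmf.prob \<nu> A\<bar>)"

definition worst_dist :: "nat \<Rightarrow> nat \<Rightarrow> real \<Rightarrow> real" where
  "worst_dist N k t = (MAX \<xi>\<in>configs N k. tv_dist N k (law N t \<xi>) (equilibrium N k))"

text \<open>Extended-real valued, so that the infimum of the empty set is \<open>\<infinity>\<close>.\<close>

definition mixing_time :: "nat \<Rightarrow> nat \<Rightarrow> real \<Rightarrow> ereal" where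
  "mixing_time N k \<epsilon> = Inf (ereal ` {t. t \<ge> 0 \<and> worst_dist N k t \<le> \<epsilon>})"

definition Ent :: "config pmf \<Rightarrow> (config \<Rightarrow> real) \<Rightarrow> real" where
  "Ent \<nu> f = measure_pmf.expectation \<nu> (\<lambda>\<xi>. f \<xi> * ln (f \<xi>))
     - measure_pmf.expectation \<nu> f * ln (measure_pmf.expectation \<nu> f)"

definition dirichlet_form :: "nat \<Rightarrow> nat \<Rightarrow> (config \<Rightarrow> real) \<Rightarrow> real" where
  "dirichlet_form N k f = - measure_pmf.expectation (equilibrium N k) (\<lambda>\<xi>. f \<xi> * generator N f \<xi>)"

text \<open>
  The set of admissible constants is closed, so its supremum is its largest element; if it is
  unbounded (which happens when the ergodic component is a singleton) the constant is \<open>\<infinity>\<close>.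
\<close>

definition log_sobolev :: "nat \<Rightarrow> nat \<Rightarrow> ereal" where
  "log_sobolev N k = Sup (ereal ` {\<alpha>. \<forall>f :: config \<Rightarrow> real.
     \<alpha> * Ent (equilibrium N k) (\<lambda>\<xi>. (f \<xi>)\<^sup>2) \<le> dirichlet_form N k f})"

lemma exchange_01:
  assumes "\<forall>x. \<xi> x \<in> {0, 1} \<or> x \<notin> sites N" "x \<in> sites N" "y \<in> sites N"
  shows "\<forall>z. exchange \<xi> x y z \<in> {0, 1} \<or> z \<notin> sites N"
  using assms unfolding exchange_def by auto

lemma generator_bound:
  assumes N: "N \<ge> 1"
    and f: "\<And>\<xi>. \<forall>x. \<xi> x \<in> {0, 1} \<or> x \<notin> sites N \<Longrightarrow> \<bar>f \<xi>\<bar> \<le> B"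
    and \<xi>: "\<forall>x. \<xi> x \<in> {0, 1} \<or> x \<notin> sites N"
  shows "\<bar>generator N f \<xi>\<bar> \<le> 2 * real N * B"
proof -
  have nb: "right N x \<in> sites N" "left N x \<in> sites N" for x
    using N by (auto simp: right_def left_def sites_def)
  have e: "\<bar>1 / 2 * real (\<xi> x) * real (\<xi> y) * (1 - real (\<xi> z)) * (f (exchange \<xi> x z) - f \<xi>)\<bar> \<le> B"
    if "x \<in> sites N" "y \<in> sites N" "z \<in> sites N" for x y z
  proof -
    have "\<bar>f (exchange \<xi> x z)\<bar> \<le> B" "\<bar>f \<xi>\<bar> \<le> B"
      using f exchange_01 \<xi> that by blast+
    moreover have "\<xi> x \<in> {0, 1}" "\<xi> y \<in> {0, 1}" "\<xi> z \<in> {0, 1}"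
      using \<xi> that by blast+
    ultimately show ?thesis by auto
  qed
  have c: "real (card (sites N)) = real N" by (simp add: sites_def)
  have "\<bar>\<Sum>x\<in>sites N. 1 / 2 * real (\<xi> x) * real (\<xi> (left N x)) * (1 - real (\<xi> (right N x)))
        * (f (exchange \<xi> x (right N x)) - f \<xi>)\<bar> \<le> (\<Sum>x\<in>sites N. B)"
    by (rule order_trans[OF sum_abs sum_mono]) (use e nb in blast)
  moreover have "\<bar>\<Sum>x\<in>sites N. 1 / 2 * real (\<xi> x) * real (\<xi> (right N x)) * (1 - real (\<xi> (left N x)))
        * (f (exchange \<xi> x (left N x)) - f \<xi>)\<bar> \<le> (\<Sum>x\<in>sites N. B)"
    by (rule order_trans[OF sum_abs sum_mono]) (use e nb in blast)
  ultimately show ?thesis unfolding generator_def by (simp add: c)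
qed

lemma summable_semigroup:
  assumes N: "N \<ge> 1" and \<xi>: "\<xi> \<in> configs N k" and f: "\<And>\<xi>. \<bar>f \<xi>\<bar> \<le> B"
  shows "summable (\<lambda>n. t ^ n / fact n * (generator N ^^ n) f \<xi>)"
proof -
  have iter: "\<bar>(generator N ^^ n) f \<zeta>\<bar> \<le> (2 * real N) ^ n * B"
    if "\<forall>x. \<zeta> x \<in> {0, 1} \<or> x \<notin> sites N" for n \<zeta>
    using that
  proof (induction n arbitrary: \<zeta>)
    case 0
    then show ?case using f by simp
  next
    case (Suc n)
    show ?case
      using generator_bound[OF N Suc.IH Suc.prems] by (simp add: mult.assoc)
  qed
  have 01: "\<forall>x. \<xi> x \<in> {0, 1} \<or> x \<notin> sites N"
    using \<xi> unfolding configs_def by (blast dest: PiE_mem)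
  show ?thesis
  proof (rule summable_comparison_test')
    show "summable (\<lambda>n. B * ((\<bar>t\<bar> * (2 * real N)) ^ n /\<^sub>R fact n))"
      by (intro summable_mult summable_exp_generic)
    show "norm (t ^ n / fact n * (generator N ^^ n) f \<xi>) \<le> B * ((\<bar>t\<bar> * (2 * real N)) ^ n /\<^sub>R fact n)"
      if "n \<ge> 0" for n
    proof -
      have "norm (t ^ n / fact n * (generator N ^^ n) f \<xi>)
          = \<bar>t\<bar> ^ n / fact n * \<bar>(generator N ^^ n) f \<xi>\<bar>"
        by (simp add: abs_mult power_abs)
      also have "\<dots> \<le> \<bar>t\<bar> ^ n / fact n * ((2 * real N) ^ n * B)"
        by (intro mult_left_mono iter 01) auto
      also have "\<dots> = B * ((\<bar>t\<bar> * (2 * real N)) ^ n /\<^sub>R fact n)"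
        by (simp add: power_mult_distrib field_simps)
      finally show ?thesis .
    qed
  qed
qed

end

theory Submission
  imports Defs "HOL-Real_Asymp.Real_Asymp"
begin

text \<open>
  On the ergodic component, contracting each pair \<open>01\<close> to a single site turns the process into
  the symmetric exclusion process with \<open>N - k\<close> holes on \<open>k\<close> sites, up to the choice of an origin.

  (a) The squared modulus \<open>F\<close> of the first Fourier mode of the holes of the exclusion process does
  not depend on the origin.  With \<open>\<lambda> = 1 - cos (2 \<pi> / k)\<close> one has \<open>L F = - 2 \<lambda> F + \<Gamma>\<close>, where
  \<open>0 \<le> \<Gamma> \<le> \<lambda> N\<close>, and \<open>L (F\<^sup>2) \<le> - 4 \<lambda> F\<^sup>2 + 10 \<lambda> N F + 4 \<lambda>\<^sup>2 N\<close>.  In equilibrium \<open>F\<close> has mean at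
  most \<open>N / 2\<close>.  Started from packed holes, \<open>F\<close> is of order \<open>N\<^sup>2\<close>, and by a second moment argument
  it remains near its mean, which is much larger than \<open>N\<close> up to time \<open>c N\<^sup>2 log N\<close>.

  (b) For the complete graph exclusion process with \<open>h\<close> particles on \<open>n\<close> sites, conditioning on the
  occupation of one site and averaging over the site gives an induction for the entropy that closes
  exactly with the constant \<open>n / (h (n - h))\<close>.  Decomposing transpositions into adjacent ones gives
  the order \<open>N\<^sup>2\<close> for the segment.  The configurations with a particle at \<open>N - 1\<close> are an
  exclusion process on a segment, those with a particle at \<open>0\<close> are their rotations, together they
  are everything, and their intersection has mass \<open>(2 k - N) / N\<close>, so that the two entropies
  control the entropy of the whole.
\<close>

subsection \<open>Entropy on finite sets\<close>

text \<open>The obstacle is the origin: contracting pairs \<open>01\<close> turns the circle into an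
  exclusion process only after it has been cut somewhere, and a jump across the cut shifts every
  label. In (a) a single starting point bounds the maximum over all of them from below, so only the
  semigroup on the ergodic component is studied. As \<open>k > N / 2\<close>, \<open>gap k\<close>
  is at most \<open>8 * pi^2 / N^2\<close>, so up to time \<open>N^2 * ln N / (32 * pi^2)\<close>
  the factor \<open>exp (- 2 * gap k * t)\<close> is at least \<open>1 / sqrt N\<close>. The mean of
  \<open>F\<close> is then still at least of order \<open>N^(3/2)\<close>, while its variance is at
  most of order \<open>N\<close> times the mean. To integrate the bound on the generator of
  \<open>F^2\<close>, the linear term is absorbed by following \<open>F^2 - 5 * N * F\<close>
  instead. In (b) entropies are kept unnormalized, so that conditional entropies add without
  weights. The comparison of two blocks has constant exactly 1, and this makes the induction on
  slices lossless. The proportion of configurations in the overlap of the two cuts tends to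
  \<open>2 * \<rho> - 1\<close>, which is why the density must stay away from 1/2; the factor
  \<open>N - k\<close> in the denominator of the constant keeps it away from 1.\<close>

definition entr :: "'a set \<Rightarrow> ('a \<Rightarrow> real) \<Rightarrow> real" where
  "entr X g = (\<Sum>x\<in>X. g x * ln (g x)) - sum g X * ln (sum g X / real (card X))"

lemma entr_reindex: "inj_on h X \<Longrightarrow> entr (h ` X) g = entr X (\<lambda>x. g (h x))"
  by (simp add: entr_def sum.reindex card_image)

lemma entr_card_1: "card X = 1 \<Longrightarrow> entr X g = 0"
  by (auto simp: entr_def card_1_singleton_iff)

text \<open>With \<open>y = sqrt (x / c)\<close> the difference of the two sides is
  \<open>2 * c * y * (y * ln y - y + 1)\<close>, which is nonnegative because
  \<open>ln (1 / y) \<le> 1 / y - 1\<close>.\<close>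

lemma xlogx_ge: 
  fixes x c :: real assumes "x \<ge> 0" "c > 0"
  shows "x * ln (x / c) - x + c \<ge> (sqrt x - sqrt c)\<^sup>2"
proof (cases "x = 0")
  case False
  then have x: "x > 0" using assms by simp
  define y where "y = sqrt x / sqrt c"
  have y: "y > 0" using x assms by (simp add: y_def)
  have "ln (1 / y) \<le> 1 / y - 1" by (rule ln_le_minus_one) (use y in simp)
  then have "y * ln y - y + 1 \<ge> 0" using y by (simp add: ln_div field_simps)
  then have "2 * (c * y) * (y * ln y - y + 1) \<ge> 0" using y assms by simp
  moreover have "x = c * y\<^sup>2" using x assms by (simp add: y_def power_divide)
  moreover have "sqrt x = sqrt c * y" using assms by (simp add: y_def)
  moreover have "ln (x / c) = 2 * ln y"
    using assms y \<open>x = c * y\<^sup>2\<close> by (simp add: ln_realpow)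
  ultimately show ?thesis
    using assms by (simp add: power2_eq_square algebra_simps)
qed (use assms in simp)

lemma xlogx_nonneg:
  fixes x c :: real assumes "x \<ge> 0" "c > 0"
  shows "x * ln (x / c) - x + c \<ge> 0"
  using xlogx_ge[OF assms] by (meson order_trans zero_le_power2)

text \<open>This is the variational formula for the entropy: every reference value \<open>c\<close>
  overshoots by a nonnegative defect, which vanishes when \<open>c\<close> is the mean. Upper bounds
  come from a convenient \<open>c\<close>, lower bounds from the mean.\<close>

lemma sum_xlogx:
  assumes "finite X" "X \<noteq> {}" "\<And>x. x \<in> X \<Longrightarrow> g x \<ge> 0" "c > 0"
  shows "(\<Sum>x\<in>X. g x * ln (g x / c) - g x + c)
     = entr X g + real (card X) * ((sum g X / card X) * ln ((sum g X / card X) / c) - sum g X / card X + c)"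
proof -
  have n: "real (card X) > 0" using assms by (simp add: card_gt_0_iff)
  have "g x * ln (g x / c) = g x * ln (g x) - g x * ln c" if "x \<in> X" for x
    using assms(3)[OF that] assms(4) by (cases "g x = 0") (auto simp: ln_div algebra_simps)
  then have "(\<Sum>x\<in>X. g x * ln (g x / c) - g x + c)
     = (\<Sum>x\<in>X. g x * ln (g x)) - sum g X * ln c - sum g X + card X * c"
    by (simp add: sum.distrib sum_subtractf sum_distrib_right)
  moreover have "sum g X * ln ((sum g X / card X) / c) = sum g X * ln (sum g X / card X) - sum g X * ln c"
  proof (cases "sum g X = 0")
    case False
    then have "sum g X > 0" using assms(3) by (simp add: order_less_le sum_nonneg)
    then show ?thesis using n assms(4) by (simp add: ln_div ln_mult algebra_simps)
  qed simp
  moreover have "real (card X) * (sum g X / card X * ln ((sum g X / card X) / c) - sum g X / card X + c)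
     = sum g X * ln ((sum g X / card X) / c) - sum g X + card X * c"
    using n by (simp add: algebra_simps)
  ultimately show ?thesis unfolding entr_def by linarith
qed

lemma entr_le:
  assumes "finite X" "X \<noteq> {}" "\<And>x. x \<in> X \<Longrightarrow> g x \<ge> 0" "c > 0"
  shows "entr X g \<le> (\<Sum>x\<in>X. g x * ln (g x / c) - g x + c)"
proof -
  have "0 \<le> real (card X) * ((sum g X / card X) * ln ((sum g X / card X) / c) - sum g X / card X + c)"
    by (intro mult_nonneg_nonneg xlogx_nonneg) (use assms in \<open>auto intro!: sum_nonneg divide_nonneg_nonneg\<close>)
  then show ?thesis using sum_xlogx[where g = g, OF assms] by linarith
qed

text \<open>Taking the mean as reference value in \<open>sum_xlogx\<close> removes the defect, and
  \<open>xlogx_ge\<close> applies termwise.\<close>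

lemma entr_ge:
  assumes "finite X" "X \<noteq> {}" "\<And>x. x \<in> X \<Longrightarrow> g x \<ge> 0"
  shows "entr X g \<ge> (\<Sum>x\<in>X. (sqrt (g x) - sqrt (sum g X / card X))\<^sup>2)"
proof (cases "sum g X = 0")
  case True
  then have "g x = 0" if "x \<in> X" for x using assms that by (simp add: sum_nonneg_eq_0_iff)
  then show ?thesis by (simp add: entr_def)
next
  case False
  then have s: "sum g X > 0" using assms(3) by (simp add: order_less_le sum_nonneg)
  have n: "real (card X) > 0" using assms by (simp add: card_gt_0_iff)
  have c: "sum g X / card X > 0" using s n by simp
  have "(\<Sum>x\<in>X. (sqrt (g x) - sqrt (sum g X / card X))\<^sup>2) 
    \<le> (\<Sum>x\<in>X. g x * ln (g x / (sum g X / card X)) - g x + (sum g X / card X))"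
    by (intro sum_mono xlogx_ge assms c)
  also have "\<dots> = entr X g" 
    using s n by (subst sum_xlogx[OF assms c]) auto
  finally show ?thesis .
qed

lemma entr_nonneg:
  assumes "finite X" "X \<noteq> {}" "\<And>x. x \<in> X \<Longrightarrow> g x \<ge> 0"
  shows "entr X g \<ge> 0"
  by (rule order_trans[OF _ entr_ge[OF assms]]) (auto intro: sum_nonneg)

text \<open>The excess over the two separate entropies is the entropy of a function with only two
  values, the block means \<open>a^2\<close> and \<open>b^2\<close> with weights \<open>p\<close>
  and \<open>q\<close>. The bound \<open>ln y \<le> y - 1\<close> replaces it by a variance divided
  by the mean, and \<open>(a^2 - b^2)^2\<close> factors. The prefactor must be no larger than
  \<open>card (A \<union> C)\<close> for the induction on slices to close.\<close>

lemma entr_split: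
  assumes fin: "finite A" "finite C" and ne: "A \<noteq> {}" "C \<noteq> {}" and dis: "A \<inter> C = {}"
    and g: "\<And>x. x \<in> A \<union> C \<Longrightarrow> g x \<ge> 0"
  shows "entr (A \<union> C) g \<le> entr A g + entr C g
    + real (card (A \<union> C)) * (sqrt (sum g A / card A) - sqrt (sum g C / card C))\<^sup>2"
proof -
  define p q where "p = real (card A)" and "q = real (card C)"
  define a b where "a = sqrt (sum g A / card A)" and "b = sqrt (sum g C / card C)"
  have p: "p > 0" and q: "q > 0" using fin ne by (simp_all add: p_def q_def card_gt_0_iff)
  have card: "real (card (A \<union> C)) = p + q" using fin dis by (simp add: card_Un_disjoint p_def q_def)
  have sA: "sum g A = p * a\<^sup>2" and sC: "sum g C = q * b\<^sup>2"
    using p q g by (auto simp: a_def b_def p_def q_def sum_nonneg)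
  have ab: "a \<ge> 0" "b \<ge> 0" using g by (auto simp: a_def b_def sum_nonneg)
  have sU: "sum g (A \<union> C) = p * a\<^sup>2 + q * b\<^sup>2"
    using fin dis by (simp add: sum.union_disjoint sA sC)
  have lU: "(\<Sum>x\<in>A \<union> C. g x * ln (g x)) = (\<Sum>x\<in>A. g x * ln (g x)) + (\<Sum>x\<in>C. g x * ln (g x))"
    using fin dis by (simp add: sum.union_disjoint)
  define s where "s = p * a\<^sup>2 + q * b\<^sup>2"
  have "p * a\<^sup>2 * ln (a\<^sup>2) + q * b\<^sup>2 * ln (b\<^sup>2) - s * ln (s / (p + q)) \<le> (p + q) * (a - b)\<^sup>2"
  proof (cases "s = 0")
    case True
    moreover have "p * a\<^sup>2 \<ge> 0" "q * b\<^sup>2 \<ge> 0" using p q by auto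
    ultimately have "p * a\<^sup>2 = 0" "q * b\<^sup>2 = 0" unfolding s_def by linarith+
    then show ?thesis using True p q by simp
  next
    case False
    have "p * a\<^sup>2 \<ge> 0" "q * b\<^sup>2 \<ge> 0" using p q by auto
    with False have s: "s > 0" unfolding s_def by linarith
    define m where "m = s / (p + q)"
    have m: "m > 0" using s p q by (simp add: m_def)
    have key: "y * ln y - y * ln m \<le> y * (y / m - 1)" if "y \<ge> 0" for y :: real
    proof (cases "y = 0")
      case False
      with that have y: "y > 0" by simp
      have "ln (y / m) \<le> y / m - 1" by (rule ln_le_minus_one) (use y m in simp)
      then have "y * ln (y / m) \<le> y * (y / m - 1)" using y by simp
      then show ?thesis using y m by (simp add: ln_div algebra_simps)
    qed simp
    have "p * a\<^sup>2 * ln (a\<^sup>2) + q * b\<^sup>2 * ln (b\<^sup>2) - s * ln m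
       = p * (a\<^sup>2 * ln (a\<^sup>2) - a\<^sup>2 * ln m) + q * (b\<^sup>2 * ln (b\<^sup>2) - b\<^sup>2 * ln m)"
      by (simp add: s_def algebra_simps)
    also have "\<dots> \<le> p * (a\<^sup>2 * (a\<^sup>2 / m - 1)) + q * (b\<^sup>2 * (b\<^sup>2 / m - 1))"
      by (intro add_mono mult_left_mono key) (use p q in auto)
    also have "\<dots> = (p * a\<^sup>2 * a\<^sup>2 + q * b\<^sup>2 * b\<^sup>2) / m - s"
      by (simp add: s_def add_divide_distrib algebra_simps)
    also have "\<dots> = (p + q) * (p * a\<^sup>2 * a\<^sup>2 + q * b\<^sup>2 * b\<^sup>2) / s - s"
      by (simp add: m_def mult.commute)
    also have "\<dots> = ((p + q) * (p * a\<^sup>2 * a\<^sup>2 + q * b\<^sup>2 * b\<^sup>2) - s * s) / s"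
      using s by (simp add: diff_divide_distrib)
    also have "(p + q) * (p * a\<^sup>2 * a\<^sup>2 + q * b\<^sup>2 * b\<^sup>2) - s * s = p * q * (a + b)\<^sup>2 * (a - b)\<^sup>2"
      by (simp add: s_def power2_eq_square algebra_simps)
    also have "p * q * (a + b)\<^sup>2 * (a - b)\<^sup>2 / s \<le> ((p + q) * s) * (a - b)\<^sup>2 / s"
    proof (intro divide_right_mono mult_right_mono)
      \<comment> \<open>The two sides of the claim differ by exactly this square.\<close>
      have "(p * a - q * b)\<^sup>2 \<ge> 0" by simp
      then show "p * q * (a + b)\<^sup>2 \<le> (p + q) * s"
        by (simp add: s_def power2_eq_square algebra_simps)
    qed (use s in auto)
    also have "\<dots> = (p + q) * (a - b)\<^sup>2" using s by simp
    finally show ?thesis by (simp add: m_def)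
  qed
  moreover have "sum g A / card A = a\<^sup>2" "sum g C / card C = b\<^sup>2"
    using sA sC p q by (simp_all add: p_def q_def)
  ultimately show ?thesis
    using p q unfolding entr_def card sU lU s_def[symmetric] a_def[symmetric] b_def[symmetric]
    by (simp add: sA sC)
qed

text \<open>Comparing both entropies with the larger of the two root mean squares avoids
  any loss when the masses of the two parts are very different.\<close>

lemma entr_union_wlog:
  assumes fin: "finite A" "finite B" and I: "A \<inter> B \<noteq> {}"
    and g: "\<And>x. x \<in> A \<union> B \<Longrightarrow> g x \<ge> 0"
    and le: "sum g B / card B \<le> sum g A / card A"
  shows "entr (A \<union> B) g \<le> (1 + 8 * card (A \<union> B) / card (A \<inter> B)) * (entr A g + entr B g)"
proof -
  define a b where "a = sqrt (sum g A / card A)" and "b = sqrt (sum g B / card B)"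
  have ne: "A \<noteq> {}" "B \<noteq> {}" using I by auto
  have cB: "real (card B) > 0" and cA: "real (card A) > 0" using ne fin by (auto simp: card_gt_0_iff)
  have cI: "real (card (A \<inter> B)) > 0" using I fin by (auto simp: card_gt_0_iff)
  have ba: "0 \<le> b" "b \<le> a" using le g by (auto simp: a_def b_def intro!: divide_nonneg_nonneg sum_nonneg)
  have a2: "a\<^sup>2 = sum g A / card A" and b2: "b\<^sup>2 = sum g B / card B"
    using g by (auto simp: a_def b_def intro!: divide_nonneg_nonneg sum_nonneg)
  have eA: "entr A g \<ge> 0" and eB: "entr B g \<ge> 0" using fin ne g by (auto intro!: entr_nonneg)
  \<comment> \<open>On the overlap \<open>sqrt g\<close> is close to both root mean squares, in the
    sense controlled by \<open>entr_ge\<close>. Hence \<open>a\<close> and \<open>b\<close> are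
    close to each other, the more so the larger the overlap.\<close>
  have "(\<Sum>x\<in>A \<inter> B. (a - b)\<^sup>2) \<le> (\<Sum>x\<in>A \<inter> B. 2 * (sqrt (g x) - a)\<^sup>2 + 2 * (sqrt (g x) - b)\<^sup>2)"
  proof (rule sum_mono)
    fix x
    show "(a - b)\<^sup>2 \<le> 2 * (sqrt (g x) - a)\<^sup>2 + 2 * (sqrt (g x) - b)\<^sup>2"
      using zero_le_power2[of "2 * sqrt (g x) - a - b"]
      by (simp add: power2_eq_square algebra_simps del: real_sqrt_mult_self)
  qed
  also have "\<dots> = 2 * (\<Sum>x\<in>A \<inter> B. (sqrt (g x) - a)\<^sup>2) + 2 * (\<Sum>x\<in>A \<inter> B. (sqrt (g x) - b)\<^sup>2)"
    by (simp add: sum.distrib sum_distrib_left)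
  also have "(\<Sum>x\<in>A \<inter> B. (sqrt (g x) - a)\<^sup>2) \<le> (\<Sum>x\<in>A. (sqrt (g x) - a)\<^sup>2)"
    by (rule sum_mono2) (use fin in auto)
  also have "\<dots> \<le> entr A g" unfolding a_def by (rule entr_ge) (use fin ne g in auto)
  also have "(\<Sum>x\<in>A \<inter> B. (sqrt (g x) - b)\<^sup>2) \<le> (\<Sum>x\<in>B. (sqrt (g x) - b)\<^sup>2)"
    by (rule sum_mono2) (use fin in auto)
  also have "\<dots> \<le> entr B g" unfolding b_def by (rule entr_ge) (use fin ne g in auto)
  finally have ov: "(a - b)\<^sup>2 \<le> 2 * (entr A g + entr B g) / card (A \<inter> B)"
    using cI by (simp add: field_simps)
  show ?thesis
  proof (cases "a = 0")
    case True
    then have "b = 0" using ba by simp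
    have "sum g A = 0" "sum g B = 0" using a2 b2 True \<open>b = 0\<close> cA cB by auto
    then have "\<forall>x\<in>A. g x = 0" "\<forall>x\<in>B. g x = 0"
      using sum_nonneg_eq_0_iff[of A g] sum_nonneg_eq_0_iff[of B g] fin g by auto
    then have "\<forall>x\<in>A \<union> B. g x = 0" by auto
    then have "entr (A \<union> B) g = 0" by (simp add: entr_def)
    then show ?thesis using eA eB by simp
  next
    case False
    then have a: "a > 0" using ba by simp
    let ?k = "\<lambda>x. g x * ln (g x / a\<^sup>2) - g x + a\<^sup>2"
    have k0: "?k x \<ge> 0" if "x \<in> A \<union> B" for x using xlogx_nonneg[OF g[OF that]] a by simp
    have sA: "sum ?k A = entr A g"
    proof -
      have "sum ?k A = entr A g + real (card A) * (a\<^sup>2 * ln (a\<^sup>2 / a\<^sup>2) - a\<^sup>2 + a\<^sup>2)"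
        unfolding a2 by (rule sum_xlogx) (use fin ne g zero_less_power[OF a, of 2] in \<open>auto simp: a2\<close>)
      then show ?thesis using a by simp
    qed
    have sB: "sum ?k B \<le> entr B g + real (card B) * (4 * (a - b)\<^sup>2)"
    proof -
      have "sum ?k B = entr B g + real (card B) * (b\<^sup>2 * ln (b\<^sup>2 / a\<^sup>2) - b\<^sup>2 + a\<^sup>2)"
        unfolding b2 by (rule sum_xlogx) (use fin ne g a in auto)
      moreover have "b\<^sup>2 * ln (b\<^sup>2 / a\<^sup>2) - b\<^sup>2 + a\<^sup>2 \<le> 4 * (a - b)\<^sup>2"
      proof -
        have "b\<^sup>2 * ln (b\<^sup>2 / a\<^sup>2) \<le> b\<^sup>2 * (b\<^sup>2 / a\<^sup>2 - 1)"
        proof (cases "b = 0")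
          case False
          then show ?thesis using a by (intro mult_left_mono ln_le_minus_one) auto
        qed simp
        then have "b\<^sup>2 * ln (b\<^sup>2 / a\<^sup>2) - b\<^sup>2 + a\<^sup>2 \<le> b\<^sup>2 * (b\<^sup>2 / a\<^sup>2 - 1) - b\<^sup>2 + a\<^sup>2" by simp
        also have "\<dots> = (a + b)\<^sup>2 * (a - b)\<^sup>2 / a\<^sup>2"
          using a by (simp add: field_simps power2_eq_square)
        \<comment> \<open>Here \<open>b \<le> a\<close> enters: it keeps the constant at 4 whatever
          the ratio of \<open>a\<close> to \<open>b\<close>.\<close>
        also have "\<dots> \<le> (a + a)\<^sup>2 * (a - b)\<^sup>2 / a\<^sup>2"
          by (intro divide_right_mono mult_right_mono power_mono) (use ba in auto)
        also have "\<dots> = 4 * (a - b)\<^sup>2" using a by (simp add: power2_eq_square)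
        finally show ?thesis .
      qed
      then have "real (card B) * (b\<^sup>2 * ln (b\<^sup>2 / a\<^sup>2) - b\<^sup>2 + a\<^sup>2) \<le> real (card B) * (4 * (a - b)\<^sup>2)"
        by (rule mult_left_mono) simp
      ultimately show ?thesis by simp
    qed
    have "entr (A \<union> B) g \<le> sum ?k (A \<union> B)"
      by (rule entr_le) (use fin ne g a in auto)
    also have "\<dots> \<le> sum ?k A + sum ?k B"
    proof -
      have "sum ?k (A \<union> B) + sum ?k (A \<inter> B) = sum ?k A + sum ?k B"
        by (rule sum.union_inter) (use fin in auto)
      moreover have "sum ?k (A \<inter> B) \<ge> 0" by (rule sum_nonneg) (use k0 in auto)
      ultimately show ?thesis by simp
    qed
    also have "\<dots> \<le> entr A g + entr B g + real (card B) * (4 * (a - b)\<^sup>2)" using sA sB by simp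
    also have "real (card B) * (4 * (a - b)\<^sup>2)
       \<le> real (card (A \<union> B)) * (4 * (2 * (entr A g + entr B g) / card (A \<inter> B)))"
      by (intro mult_mono ov) (use fin in \<open>auto intro: card_mono\<close>)
    finally show ?thesis by (simp add: algebra_simps add_divide_distrib)
  qed
qed

lemma entr_union:
  assumes "finite A" "finite B" "A \<inter> B \<noteq> {}" "\<And>x. x \<in> A \<union> B \<Longrightarrow> g x \<ge> 0"
  shows "entr (A \<union> B) g \<le> (1 + 8 * card (A \<union> B) / card (A \<inter> B)) * (entr A g + entr B g)"
  using entr_union_wlog[of A B g] entr_union_wlog[of B A g] assms
  by (cases "sum g B / card B \<le> sum g A / card A") (auto simp: Un_commute Int_commute add.commute)

subsection \<open>The logarithmic Sobolev inequality on slices\<close>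

abbreviation exch :: "'a \<Rightarrow> 'a \<Rightarrow> 'a \<Rightarrow> 'a" where
  "exch \<equiv> Transposition.transpose"

definition slice :: "'a set \<Rightarrow> nat \<Rightarrow> 'a set set" where
  "slice S h = {A. A \<subseteq> S \<and> card A = h}"

text \<open>Unnormalized Dirichlet form of the exclusion process on the complete graph over
  \<open>S\<close> (the Bernoulli-Laplace model). Every unordered pair of neighbouring sets is
  counted twice, once from each end.\<close>

definition swap_form :: "'a set \<Rightarrow> nat \<Rightarrow> ('a set \<Rightarrow> real) \<Rightarrow> real" where
  "swap_form S h f = (\<Sum>A\<in>slice S h. \<Sum>i\<in>A. \<Sum>j\<in>S - A. (f (exch i j ` A) - f A)\<^sup>2)"

lemma finite_slice [simp]: "finite S \<Longrightarrow> finite (slice S h)"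
  by (simp add: slice_def)

lemma card_slice: "finite S \<Longrightarrow> card (slice S h) = card S choose h"
  by (simp add: slice_def n_subsets)

lemma slice_finite: "finite S \<Longrightarrow> A \<in> slice S h \<Longrightarrow> finite A"
  by (auto simp: slice_def intro: finite_subset)

lemma transpose_slice:
  assumes "A \<in> slice S h" "i \<in> S" "j \<in> S"
  shows "exch i j ` A \<in> slice S h"
proof -
  have "exch i j ` A \<subseteq> S" using assms by (auto simp: slice_def Transposition.transpose_def)
  then show ?thesis using assms by (simp add: slice_def card_image)
qed

lemma bij_betw_transpose_slice:
  assumes "i \<in> S" "j \<in> S"
  shows "bij_betw ((`) (exch i j)) (slice S h) (slice S h)"
  by (rule bij_betw_byWitness[where f' = "(`) (exch i j)"])
    (auto intro!: transpose_slice assms simp: image_image)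

lemma slice_with:
  assumes "i \<in> S" "finite S" "h > 0"
  shows "{A\<in>slice S h. i \<in> A} = insert i ` slice (S - {i}) (h - 1)"
proof (intro equalityI subsetI)
  fix A assume "A \<in> {A\<in>slice S h. i \<in> A}"
  then have "A - {i} \<in> slice (S - {i}) (h - 1)" "A = insert i (A - {i})"
    using assms by (auto simp: slice_def)
  then show "A \<in> insert i ` slice (S - {i}) (h - 1)" by blast
next
  fix A assume "A \<in> insert i ` slice (S - {i}) (h - 1)"
  then obtain B where B: "B \<subseteq> S - {i}" "card B = h - 1" "A = insert i B" by (auto simp: slice_def)
  then have "finite B" "i \<notin> B" using assms(2) by (auto intro: finite_subset)
  then show "A \<in> {A\<in>slice S h. i \<in> A}" using B assms by (auto simp: slice_def)
qed

lemma slice_without: "{A\<in>slice S h. i \<notin> A} = slice (S - {i}) h"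
  by (auto simp: slice_def)

lemma inj_on_insert_slice: "inj_on (insert i) (slice (S - {i}) h)"
  by (auto simp: inj_on_def slice_def)

lemma transpose_insert_other: "l \<noteq> i \<Longrightarrow> j \<noteq> i \<Longrightarrow> exch l j ` insert i B = insert i (exch l j ` B)"
  by simp

text \<open>The form of the smaller slice is rewritten as a sum over the whole slice, with the
  element \<open>i\<close> frozen. In this shape the sum over \<open>i\<close> can be exchanged with
  the sum over sets.\<close>

lemma swap_form_with:
  assumes S: "i \<in> S" "finite S" and h: "h > 0"
  shows "swap_form (S - {i}) (h - 1) (\<lambda>B. f (insert i B))
    = (\<Sum>A\<in>slice S h. if i \<in> A then \<Sum>l\<in>A - {i}. \<Sum>j\<in>S - A. (f (exch l j ` A) - f A)\<^sup>2 else 0)"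
proof -
  have "(\<Sum>A\<in>slice S h. if i \<in> A then \<Sum>l\<in>A - {i}. \<Sum>j\<in>S - A. (f (exch l j ` A) - f A)\<^sup>2 else 0)
     = (\<Sum>A\<in>{A\<in>slice S h. i \<in> A}. \<Sum>l\<in>A - {i}. \<Sum>j\<in>S - A. (f (exch l j ` A) - f A)\<^sup>2)"
    by (subst sum.inter_filter) (use S in auto)
  also have "\<dots> = (\<Sum>B\<in>slice (S - {i}) (h - 1).
      \<Sum>l\<in>insert i B - {i}. \<Sum>j\<in>S - insert i B. (f (exch l j ` insert i B) - f (insert i B))\<^sup>2)"
    unfolding slice_with[OF S h] by (subst sum.reindex[OF inj_on_insert_slice]) simp
  also have "\<dots> = swap_form (S - {i}) (h - 1) (\<lambda>B. f (insert i B))"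
    unfolding swap_form_def
  proof (intro sum.cong refl)
    fix B l assume "B \<in> slice (S - {i}) (h - 1)"
    then show "insert i B - {i} = B" "S - insert i B = S - {i} - B" by (auto simp: slice_def)
  next
    fix B l j assume "B \<in> slice (S - {i}) (h - 1)" "l \<in> B" "j \<in> S - {i} - B"
    then have "l \<noteq> i" "j \<noteq> i" by (auto simp: slice_def)
    then show "(f (exch l j ` insert i B) - f (insert i B))\<^sup>2 = (f (insert i (exch l j ` B)) - f (insert i B))\<^sup>2"
      by (simp add: transpose_insert_other)
  qed
  finally show ?thesis ..
qed

lemma swap_form_without:
  assumes "finite S"
  shows "swap_form (S - {i}) h f
    = (\<Sum>A\<in>slice S h. if i \<notin> A then \<Sum>l\<in>A. \<Sum>j\<in>S - A - {i}. (f (exch l j ` A) - f A)\<^sup>2 else 0)"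
proof -
  have "(\<Sum>A\<in>slice S h. if i \<notin> A then \<Sum>l\<in>A. \<Sum>j\<in>S - A - {i}. (f (exch l j ` A) - f A)\<^sup>2 else 0)
     = (\<Sum>A\<in>{A\<in>slice S h. i \<notin> A}. \<Sum>l\<in>A. \<Sum>j\<in>S - A - {i}. (f (exch l j ` A) - f A)\<^sup>2)"
    by (subst sum.inter_filter) (use assms in auto)
  also have "\<dots> = swap_form (S - {i}) h f"
    unfolding swap_form_def slice_without
    by (intro sum.cong refl) auto
  finally show ?thesis ..
qed

lemma sum_remove_one:
  fixes \<phi> :: "'a \<Rightarrow> real"
  assumes "finite A"
  shows "(\<Sum>i\<in>A. \<Sum>l\<in>A - {i}. \<phi> l) = real (card A - 1) * (\<Sum>l\<in>A. \<phi> l)"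
proof (cases "A = {}")
  case False
  then have "card A \<ge> 1" using assms by (simp add: Suc_le_eq card_gt_0_iff)
  have "(\<Sum>i\<in>A. \<Sum>l\<in>A - {i}. \<phi> l) = (\<Sum>i\<in>A. sum \<phi> A - \<phi> i)"
    by (intro sum.cong refl) (simp add: sum_diff1 assms)
  also have "\<dots> = real (card A - 1) * (\<Sum>l\<in>A. \<phi> l)"
    using \<open>card A \<ge> 1\<close> by (simp add: sum_subtractf of_nat_diff algebra_simps)
  finally show ?thesis .
qed simp

text \<open>A swap of \<open>l\<close> and \<open>j\<close> in \<open>A\<close> survives the
  freezing of \<open>i\<close> in \<open>A\<close> exactly when \<open>i\<close> is one of the other
  \<open>h - 1\<close> elements of \<open>A\<close>.\<close>

lemma sum_swap_form_with:
  assumes S: "finite S" and h: "h > 0"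
  shows "(\<Sum>i\<in>S. swap_form (S - {i}) (h - 1) (\<lambda>B. f (insert i B))) = real (h - 1) * swap_form S h f"
proof -
  let ?\<phi> = "\<lambda>A l. \<Sum>j\<in>S - A. (f (exch l j ` A) - f A)\<^sup>2"
  have "(\<Sum>i\<in>S. swap_form (S - {i}) (h - 1) (\<lambda>B. f (insert i B)))
     = (\<Sum>i\<in>S. \<Sum>A\<in>slice S h. if i \<in> A then \<Sum>l\<in>A - {i}. ?\<phi> A l else 0)"
    by (intro sum.cong refl swap_form_with S h)
  also have "\<dots> = (\<Sum>A\<in>slice S h. \<Sum>i\<in>S. if i \<in> A then \<Sum>l\<in>A - {i}. ?\<phi> A l else 0)"
    by (rule sum.swap)
  also have "\<dots> = (\<Sum>A\<in>slice S h. \<Sum>i\<in>A. \<Sum>l\<in>A - {i}. ?\<phi> A l)"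
  proof (rule sum.cong[OF refl])
    fix A assume "A \<in> slice S h"
    then have "{i\<in>S. i \<in> A} = A" by (auto simp: slice_def)
    then show "(\<Sum>i\<in>S. if i \<in> A then \<Sum>l\<in>A - {i}. ?\<phi> A l else 0) = (\<Sum>i\<in>A. \<Sum>l\<in>A - {i}. ?\<phi> A l)"
      by (subst sum.inter_filter[symmetric]) (use S in auto)
  qed
  also have "\<dots> = (\<Sum>A\<in>slice S h. real (h - 1) * (\<Sum>l\<in>A. ?\<phi> A l))"
  proof (rule sum.cong[OF refl])
    fix A assume A: "A \<in> slice S h"
    then have "card A = h" by (simp add: slice_def)
    with sum_remove_one[OF slice_finite[OF S A], of "?\<phi> A"]
    show "(\<Sum>i\<in>A. \<Sum>l\<in>A - {i}. ?\<phi> A l) = real (h - 1) * (\<Sum>l\<in>A. ?\<phi> A l)" by simp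
  qed
  also have "\<dots> = real (h - 1) * swap_form S h f" by (simp add: swap_form_def sum_distrib_left)
  finally show ?thesis .
qed

text \<open>Dual count: the swap survives the exclusion of \<open>i\<close> exactly when
  \<open>i\<close> is one of the free places other than \<open>j\<close>.\<close>

lemma sum_swap_form_without:
  assumes S: "finite S"
  shows "(\<Sum>i\<in>S. swap_form (S - {i}) h f) = real (card S - h - 1) * swap_form S h f"
proof -
  let ?\<phi> = "\<lambda>A l j. (f (exch l j ` A) - f A)\<^sup>2"
  have "(\<Sum>i\<in>S. swap_form (S - {i}) h f)
     = (\<Sum>i\<in>S. \<Sum>A\<in>slice S h. if i \<notin> A then \<Sum>l\<in>A. \<Sum>j\<in>S - A - {i}. ?\<phi> A l j else 0)"
    by (intro sum.cong refl swap_form_without S)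
  also have "\<dots> = (\<Sum>A\<in>slice S h. \<Sum>i\<in>S. if i \<notin> A then \<Sum>l\<in>A. \<Sum>j\<in>S - A - {i}. ?\<phi> A l j else 0)"
    by (rule sum.swap)
  also have "\<dots> = (\<Sum>A\<in>slice S h. \<Sum>i\<in>S - A. \<Sum>j\<in>S - A - {i}. \<Sum>l\<in>A. ?\<phi> A l j)"
  proof (rule sum.cong[OF refl])
    fix A assume "A \<in> slice S h"
    then have "{i\<in>S. i \<notin> A} = S - A" by (auto simp: slice_def)
    then have "(\<Sum>i\<in>S. if i \<notin> A then \<Sum>l\<in>A. \<Sum>j\<in>S - A - {i}. ?\<phi> A l j else 0)
       = (\<Sum>i\<in>S - A. \<Sum>l\<in>A. \<Sum>j\<in>S - A - {i}. ?\<phi> A l j)"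
      by (subst sum.inter_filter[symmetric]) (use S in auto)
    also have "\<dots> = (\<Sum>i\<in>S - A. \<Sum>j\<in>S - A - {i}. \<Sum>l\<in>A. ?\<phi> A l j)"
      by (intro sum.cong refl sum.swap)
    finally show "(\<Sum>i\<in>S. if i \<notin> A then \<Sum>l\<in>A. \<Sum>j\<in>S - A - {i}. ?\<phi> A l j else 0) = \<dots>" .
  qed
  also have "\<dots> = (\<Sum>A\<in>slice S h. real (card S - h - 1) * (\<Sum>l\<in>A. \<Sum>j\<in>S - A. ?\<phi> A l j))"
  proof (rule sum.cong[OF refl])
    fix A assume A: "A \<in> slice S h"
    then have "card (S - A) = card S - h" using slice_finite[OF S A]
      by (simp add: slice_def card_Diff_subset)
    moreover have "finite (S - A)" using S by simp
    ultimately have "(\<Sum>i\<in>S - A. \<Sum>j\<in>S - A - {i}. \<Sum>l\<in>A. ?\<phi> A l j)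
      = real (card S - h - 1) * (\<Sum>j\<in>S - A. \<Sum>l\<in>A. ?\<phi> A l j)"
      using sum_remove_one[of "S - A" "\<lambda>j. \<Sum>l\<in>A. ?\<phi> A l j"] by simp
    then show "(\<Sum>i\<in>S - A. \<Sum>j\<in>S - A - {i}. \<Sum>l\<in>A. ?\<phi> A l j)
      = real (card S - h - 1) * (\<Sum>l\<in>A. \<Sum>j\<in>S - A. ?\<phi> A l j)"
      by (simp only: sum.swap[of _ A "S - A"])
  qed
  also have "\<dots> = real (card S - h - 1) * swap_form S h f" by (simp add: swap_form_def sum_distrib_left)
  finally show ?thesis .
qed

lemma L2_set_triangle_diff: "\<bar>L2_set f A - L2_set g A\<bar> \<le> L2_set (\<lambda>x. f x - g x) A"
proof -
  have "L2_set f A \<le> L2_set (\<lambda>x. f x - g x) A + L2_set g A"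
    using L2_set_triangle_ineq[of "\<lambda>x. f x - g x" g A] by simp
  moreover have "L2_set g A \<le> L2_set (\<lambda>x. g x - f x) A + L2_set f A"
    using L2_set_triangle_ineq[of "\<lambda>x. g x - f x" f A] by simp
  moreover have "L2_set (\<lambda>x. g x - f x) A = L2_set (\<lambda>x. f x - g x) A"
    by (simp add: L2_set_def power2_commute)
  ultimately show ?thesis by linarith
qed

text \<open>Moving the element \<open>i\<close> to a uniformly chosen free place couples the two conditional
  measures, and the triangle inequality in \<open>L\<^sup>2\<close> applies to the coupled values.\<close>

lemma slice_coupling:
  fixes f :: "'a set \<Rightarrow> real"
  assumes S: "finite S" "i \<in> S" and h: "0 < h" "h < card S"
  defines "X \<equiv> {A\<in>slice S h. i \<in> A}" and "Y \<equiv> {A\<in>slice S h. i \<notin> A}"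
  shows "real (card (slice S h)) * (sqrt ((\<Sum>A\<in>X. (f A)\<^sup>2) / card X) - sqrt ((\<Sum>A\<in>Y. (f A)\<^sup>2) / card Y))\<^sup>2
     \<le> real (card S) / (real h * real (card S - h)) * (\<Sum>A\<in>X. \<Sum>j\<in>S - A. (f (exch i j ` A) - f A)\<^sup>2)"
proof -
  define n where "n = card S"
  have fin: "finite X" "finite Y" using S by (auto simp: X_def Y_def)
  have cX: "card X = (n - 1) choose (h - 1)"
    using S h by (simp add: X_def slice_with card_image inj_on_insert_slice card_slice n_def)
  have cY: "card Y = (n - 1) choose h"
    using S h by (simp add: Y_def slice_without card_slice n_def)
  have cXn: "h * card (slice S h) = n * card X"
    using binomial_absorption[of "h - 1" n] h S by (simp add: card_slice cX n_def)
  have cXY: "(n - h) * card X = h * card Y"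
  proof -
    have "(n - h) * card X + h * card X = n * card X" 
      using h by (simp add: n_def flip: add_mult_distrib)
    also have "\<dots> = h * card (slice S h)" by (simp add: cXn)
    also have "card (slice S h) = card X + card Y"
      using choose_reduce_nat[of n h] h S by (simp add: card_slice cX cY n_def)
    finally show ?thesis by (simp add: algebra_simps)
  qed
  have pos: "real (card X) > 0" "real (card Y) > 0"
    using h by (auto simp: cX cY n_def zero_less_binomial_iff)
  \<comment> \<open>\<open>P\<close> pairs a set containing \<open>i\<close> with one of its
    \<open>n - h\<close> free places, \<open>Q\<close> a set avoiding \<open>i\<close> with one of
    its \<open>h\<close> elements. All fibres have the same size, so the uniform measure on
    \<open>P\<close> projects to the uniform measure on \<open>X\<close>, and through the bijection
    \<open>\<theta>\<close> also to the one on \<open>Y\<close>.\<close>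
  define P where "P = (SIGMA A:X. S - A)"
  define Q where "Q = (SIGMA A:Y. A)"
  define \<theta> where "\<theta> = (\<lambda>(A, j). (exch i j ` A, j))"
  have mem: "card (S - A) = n - h" "finite A" "i \<in> A" if "A \<in> X" for A
    using that S slice_finite[of S A h] by (auto simp: X_def slice_def n_def card_Diff_subset)
  have memY: "card A = h" "finite A" if "A \<in> Y" for A
    using that S slice_finite[of S A h] by (auto simp: Y_def slice_def)
  have \<theta>: "bij_betw \<theta> P Q"
  proof (rule bij_betw_byWitness[where f' = \<theta>])
    show "\<forall>a\<in>P. \<theta> (\<theta> a) = a" "\<forall>a\<in>Q. \<theta> (\<theta> a) = a" by (auto simp: \<theta>_def image_image)
    show "\<theta> ` P \<subseteq> Q"
    proof
      fix p assume "p \<in> \<theta> ` P"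
      then obtain A j where A: "A \<in> slice S h" "i \<in> A" "j \<in> S" "j \<notin> A" "p = (exch i j ` A, j)"
        by (auto simp: \<theta>_def P_def X_def)
      then show "p \<in> Q" using transpose_slice[of A S h i j] S
        by (auto simp: Q_def Y_def in_transpose_image_iff)
    qed
    show "\<theta> ` Q \<subseteq> P"
    proof
      fix p assume "p \<in> \<theta> ` Q"
      then obtain A j where A: "A \<in> slice S h" "i \<notin> A" "j \<in> A" "p = (exch i j ` A, j)"
        by (auto simp: \<theta>_def Q_def Y_def)
      moreover have "j \<in> S" using A by (auto simp: slice_def)
      ultimately show "p \<in> P" using transpose_slice[of A S h i j] S
        by (auto simp: P_def X_def in_transpose_image_iff)
    qed
  qed
  define u v where "u = (\<lambda>p::'a set \<times> 'a. f (fst p))" and "v = (\<lambda>p. f (fst (\<theta> p)))"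
  have "(\<Sum>p\<in>P. (u p)\<^sup>2) = (\<Sum>A\<in>X. \<Sum>j\<in>S - A. (f A)\<^sup>2)"
    unfolding P_def u_def by (subst sum.Sigma) (use fin S in \<open>auto simp: case_prod_unfold\<close>)
  also have "\<dots> = real (n - h) * (\<Sum>A\<in>X. (f A)\<^sup>2)"
    by (simp add: mem sum_distrib_left)
  finally have su: "(\<Sum>p\<in>P. (u p)\<^sup>2) = real (n - h) * (\<Sum>A\<in>X. (f A)\<^sup>2)" .
  have "(\<Sum>p\<in>P. (v p)\<^sup>2) = (\<Sum>p\<in>Q. (f (fst p))\<^sup>2)"
    unfolding v_def by (rule sum.reindex_bij_betw[OF \<theta>])
  also have "\<dots> = (\<Sum>A\<in>Y. \<Sum>j\<in>A. (f A)\<^sup>2)"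
    unfolding Q_def by (subst sum.Sigma) (use fin S memY in \<open>auto simp: case_prod_unfold\<close>)
  also have "\<dots> = real h * (\<Sum>A\<in>Y. (f A)\<^sup>2)"
    by (simp add: memY sum_distrib_left)
  finally have sv: "(\<Sum>p\<in>P. (v p)\<^sup>2) = real h * (\<Sum>A\<in>Y. (f A)\<^sup>2)" .
  have suv: "(\<Sum>p\<in>P. (v p - u p)\<^sup>2) = (\<Sum>A\<in>X. \<Sum>j\<in>S - A. (f (exch i j ` A) - f A)\<^sup>2)"
    unfolding P_def u_def v_def \<theta>_def by (subst sum.Sigma) (use fin S in \<open>auto intro!: sum.cong\<close>)
  define a b where "a = sqrt ((\<Sum>A\<in>X. (f A)\<^sup>2) / card X)" and "b = sqrt ((\<Sum>A\<in>Y. (f A)\<^sup>2) / card Y)"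
  define w where "w = real (n - h) * real (card X)"
  have w: "w = real h * real (card Y)" using arg_cong[OF cXY, of real] by (simp add: w_def)
  have w0: "w > 0" using pos h by (simp add: w)
  have "L2_set u P = sqrt w * a"
    using pos by (simp add: L2_set_def su w_def a_def real_sqrt_mult[symmetric])
  moreover have "L2_set v P = sqrt w * b"
    using pos by (simp add: L2_set_def sv w b_def real_sqrt_mult[symmetric])
  ultimately have "\<bar>sqrt w * b - sqrt w * a\<bar> \<le> L2_set (\<lambda>p. v p - u p) P"
    using L2_set_triangle_diff[of v P u] by simp
  then have "\<bar>sqrt w * b - sqrt w * a\<bar>\<^sup>2 \<le> (L2_set (\<lambda>p. v p - u p) P)\<^sup>2"
    by (rule power_mono) simp
  also have "\<bar>sqrt w * b - sqrt w * a\<bar>\<^sup>2 = w * (a - b)\<^sup>2"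
    using w0 by (simp add: power2_eq_square algebra_simps)
  also have "(L2_set (\<lambda>p. v p - u p) P)\<^sup>2 = (\<Sum>p\<in>P. (v p - u p)\<^sup>2)"
    by (simp add: L2_set_def sum_nonneg)
  finally have main: "w * (a - b)\<^sup>2 \<le> (\<Sum>A\<in>X. \<Sum>j\<in>S - A. (f (exch i j ` A) - f A)\<^sup>2)"
    by (simp only: suv)
  have "real h * real (card (slice S h)) = real n * real (card X)"
    using arg_cong[OF cXn, of real] by simp
  then have cs: "real (card (slice S h)) = real n / (real h * real (n - h)) * w"
    using h by (simp add: w_def field_simps n_def)
  have "real (card (slice S h)) * (a - b)\<^sup>2 = real n / (real h * real (n - h)) * (w * (a - b)\<^sup>2)"
    by (simp add: cs)
  also have "\<dots> \<le> real n / (real h * real (n - h)) * (\<Sum>A\<in>X. \<Sum>j\<in>S - A. (f (exch i j ` A) - f A)\<^sup>2)"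
    by (rule mult_left_mono[OF main]) simp
  finally show ?thesis by (simp add: a_def b_def n_def)
qed

lemma swap_form_nonneg: "swap_form S h f \<ge> 0"
  unfolding swap_form_def by (intro sum_nonneg) auto

text \<open>Conditioning on the occupation of \<open>i\<close>: the two conditional entropies live
  on slices of \<open>S - {i}\<close>, and the difference of the block means is paid for by the
  swaps that move \<open>i\<close>.\<close>

lemma entr_slice_split:
  fixes f :: "'a set \<Rightarrow> real"
  assumes S: "finite S" "i \<in> S" and h: "0 < h" "h < card S"
  shows "entr (slice S h) (\<lambda>A. (f A)\<^sup>2)
    \<le> entr (slice (S - {i}) (h - 1)) (\<lambda>B. (f (insert i B))\<^sup>2) + entr (slice (S - {i}) h) (\<lambda>B. (f B)\<^sup>2)
      + real (card S) / (real h * real (card S - h))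
        * (\<Sum>A\<in>slice S h. if i \<in> A then \<Sum>j\<in>S - A. (f (exch i j ` A) - f A)\<^sup>2 else 0)"
proof -
  let ?X = "{A\<in>slice S h. i \<in> A}" and ?Y = "{A\<in>slice S h. i \<notin> A}"
  have XY: "slice S h = ?X \<union> ?Y" "?X \<inter> ?Y = {}" by auto
  have "card ?X = (card S - 1) choose (h - 1)"
    using S h by (simp add: slice_with card_image inj_on_insert_slice card_slice)
  moreover have "card ?Y = (card S - 1) choose h"
    using S h by (simp add: slice_without card_slice)
  ultimately have "card ?X > 0" "card ?Y > 0" using h by (auto simp: zero_less_binomial_iff)
  then have ne: "?X \<noteq> {}" "?Y \<noteq> {}" by (metis card.empty less_irrefl)+
  have "entr (slice S h) (\<lambda>A. (f A)\<^sup>2) \<le> entr ?X (\<lambda>A. (f A)\<^sup>2) + entr ?Y (\<lambda>A. (f A)\<^sup>2) 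
     + real (card (slice S h)) * (sqrt ((\<Sum>A\<in>?X. (f A)\<^sup>2) / card ?X) - sqrt ((\<Sum>A\<in>?Y. (f A)\<^sup>2) / card ?Y))\<^sup>2"
    using entr_split[of ?X ?Y "\<lambda>A. (f A)\<^sup>2"] XY ne S by simp
  also have "entr ?X (\<lambda>A. (f A)\<^sup>2) = entr (slice (S - {i}) (h - 1)) (\<lambda>B. (f (insert i B))\<^sup>2)"
    using S h by (simp add: slice_with entr_reindex inj_on_insert_slice)
  also have "entr ?Y (\<lambda>A. (f A)\<^sup>2) = entr (slice (S - {i}) h) (\<lambda>B. (f B)\<^sup>2)"
    by (simp only: slice_without)
  finally have 1: "entr (slice S h) (\<lambda>A. (f A)\<^sup>2)
     \<le> entr (slice (S - {i}) (h - 1)) (\<lambda>B. (f (insert i B))\<^sup>2) + entr (slice (S - {i}) h) (\<lambda>B. (f B)\<^sup>2)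
     + real (card (slice S h)) * (sqrt ((\<Sum>A\<in>?X. (f A)\<^sup>2) / card ?X) - sqrt ((\<Sum>A\<in>?Y. (f A)\<^sup>2) / card ?Y))\<^sup>2" .
  have 2: "(\<Sum>A\<in>slice S h. if i \<in> A then \<Sum>j\<in>S - A. (f (exch i j ` A) - f A)\<^sup>2 else 0)
     = (\<Sum>A\<in>?X. \<Sum>j\<in>S - A. (f (exch i j ` A) - f A)\<^sup>2)"
    by (subst sum.inter_filter) (use S in auto)
  show ?thesis
    unfolding 2 by (rule order_trans[OF 1 add_left_mono[OF slice_coupling[OF S h]]])
qed

lemma slice_recursion:
  fixes x y :: real
  assumes "x > 0" "y > 0"
  shows "(x + y - 1) / y + (x + y - 1) / x + (x + y) / (x * y) = (x + y) * ((x + y) / (x * y))"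
  using assms by (simp add: field_simps)

lemma log_sobolev_slice:
  fixes f :: "'a set \<Rightarrow> real"
  assumes "finite S" "h \<le> card S"
  shows "entr (slice S h) (\<lambda>A. (f A)\<^sup>2) \<le> real (card S) / (real h * real (card S - h)) * swap_form S h f"
  using assms
proof (induction "card S" arbitrary: S h f)
  case 0
  then have "card (slice S h) = 1" by (simp add: card_slice)
  then show ?case using 0 by (simp add: entr_card_1)
next
  case (Suc m)
  note S = \<open>finite S\<close>
  define n where "n = card S"
  have n: "n = Suc m" using Suc by (simp add: n_def)
  show ?case
  proof (cases "0 < h \<and> h < n")
    case False
    \<comment> \<open>At the two ends the slice has one element and its entropy is 0; the constant
      is 0 as well, by division by zero.\<close>
    then have "h = 0 \<or> h = card S" using Suc.prems by (auto simp: n_def)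
    then have "card (slice S h) = 1" by (auto simp: card_slice S)
    then show ?thesis using \<open>h = 0 \<or> h = card S\<close> by (auto simp: entr_card_1)
  next
    case True
    then have h: "0 < h" "h < card S" by (auto simp: n_def)
    let ?H = "entr (slice S h) (\<lambda>A. (f A)\<^sup>2)" and ?D = "swap_form S h f"
    define c where "c = real n / (real h * real (n - h))"
    have "real n * ?H = (\<Sum>i\<in>S. ?H)" by (simp add: n_def)
    also have "\<dots> \<le> (\<Sum>i\<in>S. 
         real m / (real (h - 1) * real (n - h)) * swap_form (S - {i}) (h - 1) (\<lambda>B. f (insert i B))
       + real m / (real h * real (n - h - 1)) * swap_form (S - {i}) h f
       + c * (\<Sum>A\<in>slice S h. if i \<in> A then \<Sum>j\<in>S - A. (f (exch i j ` A) - f A)\<^sup>2 else 0))"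
    proof (rule sum_mono)
      fix i assume i: "i \<in> S"
      have c: "card (S - {i}) = m" using Suc.hyps(2) i S by simp
      have "entr (slice (S - {i}) (h - 1)) (\<lambda>B. (f (insert i B))\<^sup>2)
        \<le> real m / (real (h - 1) * real (m - (h - 1))) * swap_form (S - {i}) (h - 1) (\<lambda>B. f (insert i B))"
        using Suc.hyps(1)[of "S - {i}" "h - 1" "\<lambda>B. f (insert i B)"] c S h n by (simp add: n_def)
      moreover have "entr (slice (S - {i}) h) (\<lambda>B. (f B)\<^sup>2)
        \<le> real m / (real h * real (m - h)) * swap_form (S - {i}) h f"
        using Suc.hyps(1)[of "S - {i}" h f] c S h n by (simp add: n_def)
      moreover have "m - (h - 1) = n - h" "m - h = n - h - 1" using h n by auto
      ultimately show "?H \<le> real m / (real (h - 1) * real (n - h)) * swap_form (S - {i}) (h - 1) (\<lambda>B. f (insert i B))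
       + real m / (real h * real (n - h - 1)) * swap_form (S - {i}) h f
       + c * (\<Sum>A\<in>slice S h. if i \<in> A then \<Sum>j\<in>S - A. (f (exch i j ` A) - f A)\<^sup>2 else 0)"
        using entr_slice_split[OF S i h, of f] by (simp add: c_def n_def)
    qed
    also have "\<dots> = real m / (real (h - 1) * real (n - h)) * (real (h - 1) * ?D)
       + real m / (real h * real (n - h - 1)) * (real (n - h - 1) * ?D)
       + c * (\<Sum>i\<in>S. \<Sum>A\<in>slice S h. if i \<in> A then \<Sum>j\<in>S - A. (f (exch i j ` A) - f A)\<^sup>2 else 0)"
      by (simp only: sum.distrib sum_distrib_left[symmetric] sum_swap_form_with[OF S h(1)]
          sum_swap_form_without[OF S] n_def)
    also have "(\<Sum>i\<in>S. \<Sum>A\<in>slice S h. if i \<in> A then \<Sum>j\<in>S - A. (f (exch i j ` A) - f A)\<^sup>2 else 0) = ?D"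
      unfolding swap_form_def
    proof (subst sum.swap, rule sum.cong[OF refl])
      fix A assume "A \<in> slice S h"
      then have "{i\<in>S. i \<in> A} = A" by (auto simp: slice_def)
      then show "(\<Sum>i\<in>S. if i \<in> A then \<Sum>j\<in>S - A. (f (exch i j ` A) - f A)\<^sup>2 else 0)
        = (\<Sum>i\<in>A. \<Sum>j\<in>S - A. (f (exch i j ` A) - f A)\<^sup>2)"
        by (subst sum.inter_filter[symmetric]) (use S in auto)
    qed
    also have "real m / (real (h - 1) * real (n - h)) * (real (h - 1) * ?D)
       + real m / (real h * real (n - h - 1)) * (real (n - h - 1) * ?D) + c * ?D
      \<le> real m / real (n - h) * ?D + real m / real h * ?D + c * ?D"
    \<comment> \<open>Only an inequality holds: for \<open>h = 1\<close> or \<open>n - h = 1\<close>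
      division by zero makes the left side 0, while otherwise the factor cancels.\<close>
    proof (intro add_mono order_refl)
      show "real m / (real (h - 1) * real (n - h)) * (real (h - 1) * ?D) \<le> real m / real (n - h) * ?D"
        by (cases "h = 1") (auto simp: swap_form_nonneg)
      show "real m / (real h * real (n - h - 1)) * (real (n - h - 1) * ?D) \<le> real m / real h * ?D"
        by (cases "n - h = 1") (auto simp: swap_form_nonneg)
    qed
    also have "real m / real (n - h) * ?D + real m / real h * ?D + c * ?D = real n * (c * ?D)"
    proof -
      have "real m = real h + real (n - h) - 1" "real n = real h + real (n - h)"
        using h n by (auto simp: n_def of_nat_diff)
      moreover have "real h > 0" "real (n - h) > 0" using h by (auto simp: n_def)
      ultimately have "real m / real (n - h) + real m / real h + c = real n * c"
        unfolding c_def by (simp only: slice_recursion)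
      then have "(real m / real (n - h) + real m / real h + c) * ?D = real n * c * ?D" by (simp only:)
      then show ?thesis by (simp add: distrib_right)
    qed
    finally have "real n * ?H \<le> real n * (c * ?D)" by simp
    then have "?H \<le> c * ?D" by (rule mult_left_le_imp_le) (use n in simp)
    then show ?thesis by (simp add: c_def n_def)
  qed
qed

subsection \<open>Comparison with adjacent transpositions\<close>

text \<open>The L2 norm of the gradient along one transposition. Transpositions permute the slice,
  so these norms can be added along a product of transpositions by the triangle inequality.\<close>

definition swap_norm :: "'a set \<Rightarrow> nat \<Rightarrow> ('a set \<Rightarrow> real) \<Rightarrow> 'a \<Rightarrow> 'a \<Rightarrow> real" where
  "swap_norm S h f i j = L2_set (\<lambda>A. f (exch i j ` A) - f A) (slice S h)"

lemma swap_norm_commute: "swap_norm S h f i j = swap_norm S h f j i"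
  by (simp add: swap_norm_def transpose_commute)

lemma L2_set_bij_betw: "bij_betw \<theta> X X \<Longrightarrow> L2_set (\<lambda>x. g (\<theta> x)) X = L2_set g X"
  unfolding L2_set_def by (subst sum.reindex_bij_betw[of \<theta> X X "\<lambda>x. (g x)\<^sup>2"]) auto

text \<open>The transposition of \<open>i\<close> and \<open>l\<close> is the one of
  \<open>i\<close> and \<open>j\<close> conjugated by the one of \<open>j\<close> and
  \<open>l\<close>. Both outer factors cost the same, because composing with a permutation of the
  slice preserves the norm.\<close>

lemma swap_norm_step:
  assumes S: "i \<in> S" "j \<in> S" "l \<in> S" and ne: "i \<noteq> j" "i \<noteq> l"
  shows "swap_norm S h f i l \<le> swap_norm S h f i j + 2 * swap_norm S h f j l"
proof -
  let ?\<tau> = "(`) (exch j l) :: 'a set \<Rightarrow> 'a set" and ?\<sigma> = "(`) (exch i j) :: 'a set \<Rightarrow> 'a set"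
  have eq: "exch i l ` A = ?\<tau> (?\<sigma> (?\<tau> A))" for A
  proof -
    have "exch l j (exch j i (exch l j x)) = exch l i x" for x
      by (rule transpose_triple) (use ne in auto)
    then show ?thesis by (simp add: image_image transpose_commute)
  qed
  have b1: "bij_betw ?\<tau> (slice S h) (slice S h)" and b2: "bij_betw ?\<sigma> (slice S h) (slice S h)"
    using S by (auto intro: bij_betw_transpose_slice)
  have "swap_norm S h f i l = L2_set (\<lambda>A. (f (?\<tau> (?\<sigma> (?\<tau> A))) - f (?\<sigma> (?\<tau> A)))
      + ((f (?\<sigma> (?\<tau> A)) - f (?\<tau> A)) + (f (?\<tau> A) - f A))) (slice S h)"
    unfolding swap_norm_def eq by simp
  also have "\<dots> \<le> L2_set (\<lambda>A. f (?\<tau> (?\<sigma> (?\<tau> A))) - f (?\<sigma> (?\<tau> A))) (slice S h)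
      + (L2_set (\<lambda>A. f (?\<sigma> (?\<tau> A)) - f (?\<tau> A)) (slice S h) + L2_set (\<lambda>A. f (?\<tau> A) - f A) (slice S h))"
    by (intro order_trans[OF L2_set_triangle_ineq] add_left_mono L2_set_triangle_ineq)
  also have "L2_set (\<lambda>A. f (?\<tau> (?\<sigma> (?\<tau> A))) - f (?\<sigma> (?\<tau> A))) (slice S h) = swap_norm S h f j l"
    unfolding swap_norm_def
    using L2_set_bij_betw[OF bij_betw_trans[OF b1 b2], of "\<lambda>A. f (?\<tau> A) - f A"] by (simp add: o_def)
  also have "L2_set (\<lambda>A. f (?\<sigma> (?\<tau> A)) - f (?\<tau> A)) (slice S h) = swap_norm S h f i j"
    unfolding swap_norm_def using L2_set_bij_betw[OF b1, of "\<lambda>A. f (?\<sigma> A) - f A"] by simp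
  finally show ?thesis by (simp add: swap_norm_def)
qed

lemma swap_norm_le_adjacent:
  assumes "i < j" "j < n"
  shows "swap_norm {..<n} h f i j \<le> 2 * (\<Sum>b\<in>{i..<j}. swap_norm {..<n} h f b (Suc b))"
  using assms
proof (induction j)
  case (Suc j)
  have nn: "swap_norm {..<n} h f j (Suc j) \<ge> 0" by (simp add: swap_norm_def)
  show ?case
  proof (cases "i = j")
    case True
    then show ?thesis using nn by simp
  next
    case False
    then have "i < j" using Suc.prems by simp
    then have "swap_norm {..<n} h f i (Suc j) \<le> swap_norm {..<n} h f i j + 2 * swap_norm {..<n} h f j (Suc j)"
      using Suc.prems by (intro swap_norm_step) auto
    with Suc.IH \<open>i < j\<close> Suc.prems show ?thesis by simp
  qed
qed simp

text \<open>A bond whose ends are both in \<open>A\<close> or both outside contributes 0, so all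
  bonds may be summed without a condition.\<close>

definition adj_form :: "nat \<Rightarrow> nat \<Rightarrow> (nat set \<Rightarrow> real) \<Rightarrow> real" where
  "adj_form n h f = (\<Sum>A\<in>slice {..<n} h. \<Sum>b<n - 1. (f (exch b (Suc b) ` A) - f A)\<^sup>2)"

lemma swap_norm_sq: "(swap_norm S h f i j)\<^sup>2 = (\<Sum>A\<in>slice S h. (f (exch i j ` A) - f A)\<^sup>2)"
  by (simp add: swap_norm_def L2_set_def sum_nonneg)

text \<open>Cauchy-Schwarz over the at most \<open>n - 1\<close> adjacent bonds between
  \<open>i\<close> and \<open>j\<close>; the factor 4 is the square of the 2 in
  \<open>swap_norm_le_adjacent\<close>.\<close>

lemma swap_norm_sq_le:
  assumes "i < n" "j < n"
  shows "(swap_norm {..<n} h f i j)\<^sup>2 \<le> 4 * real n * adj_form n h f"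
proof -
  have adj: "adj_form n h f = (\<Sum>b<n - 1. (swap_norm {..<n} h f b (Suc b))\<^sup>2)"
    unfolding adj_form_def swap_norm_sq by (rule sum.swap)
  have nn: "swap_norm {..<n} h f a b \<ge> 0" for a b by (simp add: swap_norm_def)
  have lt: "(swap_norm {..<n} h f i j)\<^sup>2 \<le> 4 * real n * adj_form n h f" if "i < j" "j < n" for i j
  proof -
    let ?s = "\<lambda>b. swap_norm {..<n} h f b (Suc b)"
    have "swap_norm {..<n} h f i j \<le> 2 * (\<Sum>b\<in>{i..<j}. ?s b)" by (rule swap_norm_le_adjacent[OF that])
    also have "\<dots> \<le> 2 * (\<Sum>b<n - 1. ?s b)"
      using that nn by (intro mult_left_mono sum_mono2) auto
    finally have "(swap_norm {..<n} h f i j)\<^sup>2 \<le> (2 * (\<Sum>b<n - 1. ?s b))\<^sup>2"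
      by (rule power_mono) (rule nn)
    also have "\<dots> \<le> 4 * (real (n - 1) * (\<Sum>b<n - 1. (?s b)\<^sup>2))"
      using sum_squared_le_sum_of_squares[of "?s" "{..<n - 1}"]
      by (simp add: power_mult_distrib mult.commute)
    also have "\<dots> \<le> 4 * (real n * adj_form n h f)"
      unfolding adj by (intro mult_left_mono mult_right_mono sum_nonneg) auto
    finally show ?thesis by simp
  qed
  have "adj_form n h f \<ge> 0" by (simp add: adj sum_nonneg)
  then have "(swap_norm {..<n} h f i i)\<^sup>2 \<le> 4 * real n * adj_form n h f" by (simp add: swap_norm_def L2_set_def)
  then show ?thesis
    using lt[of i j] lt[of j i] assms swap_norm_commute[of "{..<n}" h f i j] by (cases i j rule: linorder_cases) auto
qed

text \<open>There are \<open>n^2\<close> pairs, each costing at most \<open>4 * n\<close> times the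
  adjacent form. Multiplied by \<open>n / (h * (n - h))\<close> this is of order \<open>n^2\<close>
  when both \<open>h\<close> and \<open>n - h\<close> are proportional to \<open>n\<close>.\<close>

lemma swap_form_le_adj_form:
  "swap_form {..<n} h f \<le> 4 * real n ^ 3 * adj_form n h f"
proof -
  let ?\<phi> = "\<lambda>A i j. (f (exch i j ` A) - f A)\<^sup>2"
  have "swap_form {..<n} h f \<le> (\<Sum>A\<in>slice {..<n} h. \<Sum>i<n. \<Sum>j<n. ?\<phi> A i j)"
    unfolding swap_form_def
  proof (rule sum_mono)
    fix A assume "A \<in> slice {..<n} h"
    then have "A \<subseteq> {..<n}" by (simp add: slice_def)
    have "(\<Sum>i\<in>A. \<Sum>j\<in>{..<n} - A. ?\<phi> A i j) \<le> (\<Sum>i\<in>A. \<Sum>j<n. ?\<phi> A i j)"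
      by (intro sum_mono sum_mono2) auto
    also have "\<dots> \<le> (\<Sum>i<n. \<Sum>j<n. ?\<phi> A i j)"
      by (rule sum_mono2) (use \<open>A \<subseteq> {..<n}\<close> in \<open>auto intro: sum_nonneg\<close>)
    finally show "(\<Sum>i\<in>A. \<Sum>j\<in>{..<n} - A. ?\<phi> A i j) \<le> (\<Sum>i<n. \<Sum>j<n. ?\<phi> A i j)" .
  qed
  also have "\<dots> = (\<Sum>i<n. \<Sum>A\<in>slice {..<n} h. \<Sum>j<n. ?\<phi> A i j)" by (rule sum.swap)
  also have "\<dots> = (\<Sum>i<n. \<Sum>j<n. (swap_norm {..<n} h f i j)\<^sup>2)"
    unfolding swap_norm_sq by (intro sum.cong refl sum.swap)
  also have "\<dots> \<le> (\<Sum>i<n. \<Sum>j<n. 4 * real n * adj_form n h f)"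
    by (intro sum_mono swap_norm_sq_le) auto
  also have "\<dots> = 4 * real n ^ 3 * adj_form n h f" by (simp add: power3_eq_cube)
  finally show ?thesis .
qed

lemma log_sobolev_segment:
  assumes "h \<le> n"
  shows "entr (slice {..<n} h) (\<lambda>A. (f A)\<^sup>2) \<le> 4 * real n ^ 4 / (real h * real (n - h)) * adj_form n h f"
proof -
  have "entr (slice {..<n} h) (\<lambda>A. (f A)\<^sup>2) \<le> real n / (real h * real (n - h)) * swap_form {..<n} h f"
    using log_sobolev_slice[of "{..<n}" h f] assms by simp
  also have "\<dots> \<le> real n / (real h * real (n - h)) * (4 * real n ^ 3 * adj_form n h f)"
    by (intro mult_left_mono swap_form_le_adj_form) simp
  finally show ?thesis by (simp add: power4_eq_xxxx power3_eq_cube mult_ac)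
qed

subsection \<open>The process on the ergodic component\<close>

lemma finite_sites [simp]: "finite (sites N)" and card_sites [simp]: "card (sites N) = N"
  by (simp_all add: sites_def)

lemma right_eq: "x \<in> sites N \<Longrightarrow> right N x = (if x = int N - 1 then 0 else x + 1)"
  by (auto simp: right_def sites_def)

lemma left_eq: "x \<in> sites N \<Longrightarrow> left N x = (if x = 0 then int N - 1 else x - 1)"
  by (auto simp: left_def sites_def zmod_minus1)

lemma right_sites [simp]: "x \<in> sites N \<Longrightarrow> right N x \<in> sites N"
  and left_sites [simp]: "x \<in> sites N \<Longrightarrow> left N x \<in> sites N"
  by (auto simp: right_def left_def sites_def intro!: pos_mod_bound)

lemma left_right [simp]: "x \<in> sites N \<Longrightarrow> left N (right N x) = x"
  and right_left [simp]: "x \<in> sites N \<Longrightarrow> right N (left N x) = x"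
  by (auto simp: right_def left_def sites_def mod_simps)

lemma bij_betw_right: "bij_betw (right N) (sites N) (sites N)"
  and bij_betw_left: "bij_betw (left N) (sites N) (sites N)"
  by (rule bij_betw_byWitness[where f' = "left N"]; auto)
    (rule bij_betw_byWitness[where f' = "right N"]; auto)

lemma sum_right: "(\<Sum>x\<in>sites N. g (right N x)) = (\<Sum>x\<in>sites N. g x)"
  by (rule sum.reindex_bij_betw[OF bij_betw_right])

lemma sum_left: "(\<Sum>x\<in>sites N. g (left N x)) = (\<Sum>x\<in>sites N. g x)"
  by (rule sum.reindex_bij_betw[OF bij_betw_left])

lemma right_eq_iff [simp]: "x \<in> sites N \<Longrightarrow> y \<in> sites N \<Longrightarrow> right N x = right N y \<longleftrightarrow> x = y"
  by (metis left_right)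

lemma left_eq_iff [simp]: "x \<in> sites N \<Longrightarrow> y \<in> sites N \<Longrightarrow> left N x = y \<longleftrightarrow> x = right N y"
  by (metis left_right right_left)

text \<open>A jump across the bond from \<open>x\<close> to \<open>right N x\<close> depends on the
  four consecutive sites from \<open>left N x\<close> to \<open>right N (right N x)\<close>. They
  are distinct as soon as \<open>4 \<le> N\<close>, which is the origin of this assumption
  everywhere below.\<close>

lemma sites_distinct:
  assumes "4 \<le> N" "x \<in> sites N"
  shows "right N x \<noteq> x" "x \<noteq> right N x" "right N (right N x) \<noteq> x" "x \<noteq> right N (right N x)"
    "right N (right N (right N x)) \<noteq> x" "x \<noteq> right N (right N (right N x))"
proof -
  have "(x + d) mod int N \<noteq> x" if "0 < d" "d < 4" for d
  proof
    assume *: "(x + d) mod int N = x"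
    have "(x + d) mod int N = x mod int N" using assms * by (simp add: sites_def)
    then have "int N dvd d" by (metis add_diff_cancel_left' mod_eq_dvd_iff)
    then show False using that assms zdvd_imp_le[of "int N" d] by simp
  qed
  from this[of 1] this[of 2] this[of 3]
  have "right N x \<noteq> x" "right N (right N x) \<noteq> x" "right N (right N (right N x)) \<noteq> x"
    by (simp_all add: right_def mod_simps add.assoc)
  then show "right N x \<noteq> x" "x \<noteq> right N x" "right N (right N x) \<noteq> x" "x \<noteq> right N (right N x)"
    "right N (right N (right N x)) \<noteq> x" "x \<noteq> right N (right N (right N x))"
    by auto
qed

section \<open>Jumps organized by bonds, and reversibility\<close>

definition rate :: "nat \<Rightarrow> config \<Rightarrow> int \<Rightarrow> real" where
  "rate N \<xi> x = 1 / 2 * (real (\<xi> x) * real (\<xi> (left N x)) * (1 - real (\<xi> (right N x)))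
     + real (\<xi> (right N x)) * real (\<xi> (right N (right N x))) * (1 - real (\<xi> x)))"

definition move :: "nat \<Rightarrow> config \<Rightarrow> int \<Rightarrow> config" where
  "move N \<xi> x = exchange \<xi> x (right N x)"

lemma exchange_commute: "exchange \<xi> x y = exchange \<xi> y x"
  by (auto simp: exchange_def)

text \<open>A particle jumping left from \<open>right N x\<close> and one jumping right from
  \<open>x\<close> produce the same exchange. Shifting the second sum of the generator by one site
  collects both on the same bond.\<close>

lemma generator_bonds:
  "generator N f \<xi> = (\<Sum>x\<in>sites N. rate N \<xi> x * (f (move N \<xi> x) - f \<xi>))"
proof -
  have "(\<Sum>x\<in>sites N. 1 / 2 * real (\<xi> x) * real (\<xi> (right N x)) * (1 - real (\<xi> (left N x)))
        * (f (exchange \<xi> x (left N x)) - f \<xi>))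
    = (\<Sum>x\<in>sites N. 1 / 2 * real (\<xi> (right N x)) * real (\<xi> (right N (right N x)))
        * (1 - real (\<xi> x)) * (f (move N \<xi> x) - f \<xi>))"
    by (subst sum_right[symmetric]) (simp add: move_def exchange_commute)
  then show ?thesis
    unfolding generator_def
    by (simp add: sum.distrib[symmetric] rate_def move_def distrib_left distrib_right mult.assoc)
qed

lemma finite_configs [simp]: "finite (configs N k)"
  unfolding configs_def by (intro finite_subset[OF _ finite_PiE[of "sites N" "\<lambda>_. {0, 1}"]]) auto

lemma ergodic_subset: "ergodic_component N k \<subseteq> configs N k"
  by (auto simp: ergodic_component_def)

lemma finite_ergodic [simp]: "finite (ergodic_component N k)"
  using finite_subset[OF ergodic_subset finite_configs] .

lemma config_01: "\<xi> \<in> configs N k \<Longrightarrow> x \<in> sites N \<Longrightarrow> \<xi> x = 0 \<or> \<xi> x = 1"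
  by (auto simp: configs_def dest!: PiE_mem)

lemma ergodic_01: "\<xi> \<in> ergodic_component N k \<Longrightarrow> x \<in> sites N \<Longrightarrow> \<xi> x = 0 \<or> \<xi> x = 1"
  using config_01 ergodic_subset by blast

lemma ergodic_right:
  "\<xi> \<in> ergodic_component N k \<Longrightarrow> x \<in> sites N \<Longrightarrow> \<xi> x = 0 \<Longrightarrow> \<xi> (right N x) = 1"
  using ergodic_01[of \<xi> N k "right N x"] by (auto simp: ergodic_component_def)

lemma ergodic_left:
  "\<xi> \<in> ergodic_component N k \<Longrightarrow> x \<in> sites N \<Longrightarrow> \<xi> x = 0 \<Longrightarrow> \<xi> (left N x) = 1"
  using ergodic_right[of \<xi> N k "left N x"] ergodic_01[of \<xi> N k "left N x"] by auto

text \<open>On the ergodic component the site beyond the hole is automatically occupied, so the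
  facilitation rule becomes symmetric in the two directions of the jump. The exchange is therefore
  an involution of \<open>free N k x\<close>, which is the source of reversibility.\<close>

definition free :: "nat \<Rightarrow> nat \<Rightarrow> int \<Rightarrow> config set" where
  "free N k x = {\<xi> \<in> ergodic_component N k.
     \<xi> x \<noteq> \<xi> (right N x) \<and> \<xi> (left N x) = 1 \<and> \<xi> (right N (right N x)) = 1}"

lemma free_subset: "free N k x \<subseteq> ergodic_component N k"
  by (auto simp: free_def)

lemma finite_free [simp]: "finite (free N k x)"
  using finite_subset[OF free_subset finite_ergodic] .

lemma rate_ergodic:
  assumes "\<xi> \<in> ergodic_component N k" "x \<in> sites N"
  shows "rate N \<xi> x = (if \<xi> \<in> free N k x then 1 / 2 else 0)"
  using ergodic_01[OF assms] ergodic_01[OF assms(1) right_sites[OF assms(2)]]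
    ergodic_01[OF assms(1) left_sites[OF assms(2)]] ergodic_01[OF assms(1) right_sites[OF right_sites[OF assms(2)]]]
    ergodic_right[OF assms(1) right_sites[OF assms(2)]] ergodic_left[OF assms] assms
  unfolding rate_def free_def by (elim disjE) simp_all

lemma exchange_configs:
  assumes "\<xi> \<in> configs N k" "x \<in> sites N" "y \<in> sites N"
  shows "exchange \<xi> x y \<in> configs N k"
proof -
  have \<xi>: "\<xi> \<in> sites N \<rightarrow>\<^sub>E {0, 1}" "(\<Sum>z\<in>sites N. \<xi> z) = k" using assms(1) by (auto simp: configs_def)
  have ex: "exchange \<xi> x y = (\<lambda>z. \<xi> (Transposition.transpose x y z))"
    by (auto simp: exchange_def Transposition.transpose_def)
  have "(\<Sum>z\<in>sites N. exchange \<xi> x y z) = (\<Sum>z\<in>sites N. \<xi> z)"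
    unfolding ex by (rule sum.reindex_bij_betw) (use assms in simp)
  moreover have "exchange \<xi> x y \<in> sites N \<rightarrow>\<^sub>E {0, 1}"
    using \<xi>(1) assms(2,3) by (auto simp: exchange_def PiE_def extensional_def Pi_def)
  ultimately show ?thesis using \<xi>(2) by (simp add: configs_def)
qed

lemma move_apply:
  assumes "4 \<le> N" "x \<in> sites N"
  shows "move N \<xi> x z = (if z = x then \<xi> (right N x) else if z = right N x then \<xi> x else \<xi> z)"
  using sites_distinct[OF assms] by (simp add: move_def exchange_def)

lemma move_move:
  assumes "4 \<le> N" "x \<in> sites N"
  shows "move N (move N \<xi> x) x = \<xi>"
  using sites_distinct[OF assms] by (auto simp: move_apply[OF assms])

lemma move_free:
  assumes N: "4 \<le> N" "x \<in> sites N" and \<xi>: "\<xi> \<in> free N k x"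
  shows "move N \<xi> x \<in> free N k x"
proof -
  note d = sites_distinct[OF N]
  have G: "\<xi> \<in> ergodic_component N k" and ne: "\<xi> x \<noteq> \<xi> (right N x)" "\<xi> (left N x) = 1" "\<xi> (right N (right N x)) = 1"
    using \<xi> by (auto simp: free_def)
  have "1 \<le> move N \<xi> x z + move N \<xi> x (right N z)" if z: "z \<in> sites N" for z
  proof -
    have s: "\<xi> z + \<xi> (right N z) \<ge> 1" using G z by (auto simp: ergodic_component_def)
    consider "z = x" | "z = right N x" | "z = left N x" | "z \<noteq> x" "z \<noteq> right N x" "z \<noteq> left N x" by blast
    then show ?thesis
    proof cases
      case 4
      then have "right N z \<noteq> x" "right N z \<noteq> right N x" using z N by auto
      then show ?thesis using 4 s by (simp add: move_apply[OF N])
    qed (use s d ne N in \<open>auto simp: move_apply[OF N]\<close>)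
  qed
  moreover have "move N \<xi> x \<in> configs N k"
    unfolding move_def using G ergodic_subset N by (intro exchange_configs) auto
  ultimately have "move N \<xi> x \<in> ergodic_component N k" by (simp add: ergodic_component_def)
  then show ?thesis using d ne N by (auto simp: free_def move_apply[OF N])
qed

lemma bij_betw_move_free:
  assumes "4 \<le> N" "x \<in> sites N"
  shows "bij_betw (\<lambda>\<xi>. move N \<xi> x) (free N k x) (free N k x)"
  by (rule bij_betw_byWitness[where f' = "\<lambda>\<xi>. move N \<xi> x"])
    (auto simp: move_move[OF assms] move_free[OF assms])

lemma generator_ergodic:
  assumes "\<xi> \<in> ergodic_component N k"
  shows "generator N f \<xi> = (\<Sum>x\<in>sites N. if \<xi> \<in> free N k x then 1 / 2 * (f (move N \<xi> x) - f \<xi>) else 0)"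
  unfolding generator_bonds by (intro sum.cong refl) (simp add: rate_ergodic[OF assms])

lemma sum_ergodic_free:
  "(\<Sum>\<xi>\<in>ergodic_component N k. if \<xi> \<in> free N k x then g \<xi> else (0::real)) = (\<Sum>\<xi>\<in>free N k x. g \<xi>)"
  by (subst sum.inter_filter[symmetric]) (auto simp: free_def intro!: sum.cong)

lemma sum_free_move:
  assumes "4 \<le> N" "x \<in> sites N"
  shows "(\<Sum>\<xi>\<in>free N k x. g (move N \<xi> x)) = (\<Sum>\<xi>\<in>free N k x. g \<xi>)"
  by (rule sum.reindex_bij_betw[OF bij_betw_move_free[OF assms]])

lemma sum_generator_weighted:
  assumes "4 \<le> N"
  shows "(\<Sum>\<xi>\<in>ergodic_component N k. g \<xi> * generator N f \<xi>)
    = (\<Sum>x\<in>sites N. \<Sum>\<xi>\<in>free N k x. 1 / 2 * (g \<xi> * (f (move N \<xi> x) - f \<xi>)))"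
proof -
  have "(\<Sum>\<xi>\<in>ergodic_component N k. g \<xi> * generator N f \<xi>)
    = (\<Sum>\<xi>\<in>ergodic_component N k. \<Sum>x\<in>sites N. if \<xi> \<in> free N k x then 1 / 2 * (g \<xi> * (f (move N \<xi> x) - f \<xi>)) else 0)"
    by (intro sum.cong refl) (auto simp: generator_ergodic sum_distrib_left intro!: sum.cong)
  also have "\<dots> = (\<Sum>x\<in>sites N. \<Sum>\<xi>\<in>free N k x. 1 / 2 * (g \<xi> * (f (move N \<xi> x) - f \<xi>)))"
    by (subst sum.swap) (simp only: sum_ergodic_free)
  finally show ?thesis .
qed

text \<open>Invariance of the uniform distribution: for each bond the exchange permutes the
  configurations in which the bond is free.\<close>

lemma sum_generator:
  assumes "4 \<le> N"
  shows "(\<Sum>\<xi>\<in>ergodic_component N k. generator N f \<xi>) = 0"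
proof -
  have "(\<Sum>\<xi>\<in>free N k x. 1 / 2 * (1 * (f (move N \<xi> x) - f \<xi>))) = 0" if "x \<in> sites N" for x
    using sum_free_move[OF assms that, of f] by (simp add: sum_subtractf flip: sum_divide_distrib)
  then show ?thesis using sum_generator_weighted[OF assms, where g = "\<lambda>_. 1"] by simp
qed

definition energy :: "nat \<Rightarrow> nat \<Rightarrow> (config \<Rightarrow> real) \<Rightarrow> real" where
  "energy N k f = (\<Sum>x\<in>sites N. \<Sum>\<xi>\<in>free N k x. (f (move N \<xi> x) - f \<xi>)\<^sup>2)"

text \<open>Expanding the square, the sums of \<open>(f (move N \<xi> x))^2\<close> and
  \<open>(f \<xi>)^2\<close> agree by the involution. One factor 1/2 is the jump rate, the other
  comes from symmetrization.\<close>

lemma energy_eq: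
  assumes "4 \<le> N"
  shows "- (\<Sum>\<xi>\<in>ergodic_component N k. f \<xi> * generator N f \<xi>) = energy N k f / 4"
proof -
  have "(\<Sum>\<xi>\<in>free N k x. (f (move N \<xi> x) - f \<xi>)\<^sup>2)
     = - 4 * (\<Sum>\<xi>\<in>free N k x. 1 / 2 * (f \<xi> * (f (move N \<xi> x) - f \<xi>)))" if x: "x \<in> sites N" for x
  proof -
    have "(\<Sum>\<xi>\<in>free N k x. (f (move N \<xi> x) - f \<xi>)\<^sup>2)
       = (\<Sum>\<xi>\<in>free N k x. (f (move N \<xi> x))\<^sup>2) - (\<Sum>\<xi>\<in>free N k x. (f \<xi>)\<^sup>2)
         - 4 * (\<Sum>\<xi>\<in>free N k x. 1 / 2 * (f \<xi> * (f (move N \<xi> x) - f \<xi>)))"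
      by (simp add: sum_subtractf[symmetric] sum_distrib_left power2_eq_square algebra_simps)
    then show ?thesis using sum_free_move[OF assms x, of "\<lambda>\<xi>. (f \<xi>)\<^sup>2"] by simp
  qed
  then show ?thesis
    by (simp add: energy_def sum_generator_weighted[OF assms] sum_distrib_left sum_negf sum_divide_distrib)
qed

section \<open>Rotation invariance of the ergodic component and its Dirichlet form\<close>

definition rot :: "nat \<Rightarrow> config \<Rightarrow> config" where
  "rot N \<xi> = restrict (\<lambda>x. \<xi> (left N x)) (sites N)"

definition unrot :: "nat \<Rightarrow> config \<Rightarrow> config" where
  "unrot N \<xi> = restrict (\<lambda>x. \<xi> (right N x)) (sites N)"

lemma rot_apply [simp]: "x \<in> sites N \<Longrightarrow> rot N \<xi> x = \<xi> (left N x)"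
  and unrot_apply [simp]: "x \<in> sites N \<Longrightarrow> unrot N \<xi> x = \<xi> (right N x)"
  by (simp_all add: rot_def unrot_def)

lemma config_extensional: "\<xi> \<in> configs N k \<Longrightarrow> \<xi> \<in> extensional (sites N)"
  by (auto simp: configs_def PiE_def)

lemma rot_ergodic: "\<xi> \<in> ergodic_component N k \<Longrightarrow> rot N \<xi> \<in> ergodic_component N k"
proof -
  assume \<xi>: "\<xi> \<in> ergodic_component N k"
  have "(\<Sum>x\<in>sites N. rot N \<xi> x) = k"
    using \<xi> sum_left[of \<xi> N] by (simp add: ergodic_component_def configs_def)
  moreover have "rot N \<xi> \<in> sites N \<rightarrow>\<^sub>E {0, 1}" using ergodic_01[OF \<xi>] by (auto simp: rot_def)
  moreover have "1 \<le> rot N \<xi> x + rot N \<xi> (right N x)" if "x \<in> sites N" for x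
    using \<xi> that left_sites[OF that] unfolding ergodic_component_def by (force simp del: left_sites)
  ultimately show ?thesis by (simp add: ergodic_component_def configs_def)
qed

lemma unrot_ergodic: "\<xi> \<in> ergodic_component N k \<Longrightarrow> unrot N \<xi> \<in> ergodic_component N k"
proof -
  assume \<xi>: "\<xi> \<in> ergodic_component N k"
  have "(\<Sum>x\<in>sites N. unrot N \<xi> x) = k"
    using \<xi> sum_right[of \<xi> N] by (simp add: ergodic_component_def configs_def)
  moreover have "unrot N \<xi> \<in> sites N \<rightarrow>\<^sub>E {0, 1}" using ergodic_01[OF \<xi>] by (auto simp: unrot_def)
  moreover have "1 \<le> unrot N \<xi> x + unrot N \<xi> (right N x)" if "x \<in> sites N" for x
    using \<xi> that unfolding ergodic_component_def by simp
  ultimately show ?thesis by (simp add: ergodic_component_def configs_def)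
qed

lemma rot_unrot: "\<xi> \<in> configs N k \<Longrightarrow> rot N (unrot N \<xi>) = \<xi>"
  by (rule extensionalityI[of _ "sites N"]) (auto simp: config_extensional, simp add: rot_def)

lemma unrot_rot: "\<xi> \<in> configs N k \<Longrightarrow> unrot N (rot N \<xi>) = \<xi>"
  by (rule extensionalityI[of _ "sites N"]) (auto simp: config_extensional, simp add: unrot_def)

lemma bij_betw_rot_filter:
  assumes "\<And>\<xi>. \<xi> \<in> ergodic_component N k \<Longrightarrow> Q (rot N \<xi>) \<longleftrightarrow> P \<xi>"
  shows "bij_betw (rot N) {\<xi>\<in>ergodic_component N k. P \<xi>} {\<xi>\<in>ergodic_component N k. Q \<xi>}"
proof (rule bij_betw_byWitness[where f' = "unrot N"])
  have E: "\<xi> \<in> configs N k" if "\<xi> \<in> ergodic_component N k" for \<xi> using that ergodic_subset by blast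
  show "\<forall>\<xi>\<in>{\<xi>\<in>ergodic_component N k. P \<xi>}. unrot N (rot N \<xi>) = \<xi>"
    "\<forall>\<xi>\<in>{\<xi>\<in>ergodic_component N k. Q \<xi>}. rot N (unrot N \<xi>) = \<xi>"
    using rot_unrot[OF E] unrot_rot[OF E] by auto
  show "rot N ` {\<xi>\<in>ergodic_component N k. P \<xi>} \<subseteq> {\<xi>\<in>ergodic_component N k. Q \<xi>}"
    using rot_ergodic assms by auto
  show "unrot N ` {\<xi>\<in>ergodic_component N k. Q \<xi>} \<subseteq> {\<xi>\<in>ergodic_component N k. P \<xi>}"
    using unrot_ergodic assms rot_unrot[OF E] by (metis (no_types, lifting) image_subsetI mem_Collect_eq)
qed

lemma bij_betw_rot_free:
  assumes "x \<in> sites N"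
  shows "bij_betw (rot N) (free N k x) (free N k (right N x))"
  unfolding free_def by (rule bij_betw_rot_filter) (use assms in auto)

lemma rot_move:
  assumes "4 \<le> N" "x \<in> sites N"
  shows "rot N (move N \<xi> x) = move N (rot N \<xi>) (right N x)"
proof
  fix z
  show "rot N (move N \<xi> x) z = move N (rot N \<xi>) (right N x) z"
    using assms by (cases "z \<in> sites N") (auto simp: move_apply rot_def)
qed

lemma energy_rot:
  assumes "4 \<le> N"
  shows "energy N k (\<lambda>\<xi>. f (rot N \<xi>)) = energy N k f"
proof -
  have "energy N k (\<lambda>\<xi>. f (rot N \<xi>))
     = (\<Sum>x\<in>sites N. \<Sum>\<xi>\<in>free N k (right N x). (f (move N \<xi> (right N x)) - f \<xi>)\<^sup>2)"
    unfolding energy_def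
  proof (rule sum.cong[OF refl])
    fix x assume x: "x \<in> sites N"
    show "(\<Sum>\<xi>\<in>free N k x. (f (rot N (move N \<xi> x)) - f (rot N \<xi>))\<^sup>2)
      = (\<Sum>\<xi>\<in>free N k (right N x). (f (move N \<xi> (right N x)) - f \<xi>)\<^sup>2)"
      using sum.reindex_bij_betw[OF bij_betw_rot_free[OF x], where g = "\<lambda>\<xi>. (f (move N \<xi> (right N x)) - f \<xi>)\<^sup>2"]
      by (simp add: rot_move[OF assms x])
  qed
  also have "\<dots> = energy N k f"
    unfolding energy_def by (rule sum_right[of "\<lambda>x. \<Sum>\<xi>\<in>free N k x. (f (move N \<xi> x) - f \<xi>)\<^sup>2"])
  finally show ?thesis .
qed

lemma card_filter: "finite A \<Longrightarrow> card {x\<in>A. P x} = (\<Sum>x\<in>A. if P x then 1 else 0)"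
  by (subst sum.inter_filter[symmetric]) auto

lemma card_holes:
  assumes "\<xi> \<in> configs N k"
  shows "card {x\<in>sites N. \<xi> x = 0} = N - k" "k \<le> N"
proof -
  have "k = (\<Sum>x\<in>sites N. \<xi> x)" using assms by (simp add: configs_def)
  also have "\<dots> = (\<Sum>x\<in>sites N. if \<xi> x \<noteq> 0 then 1 else 0)"
    using config_01[OF assms] by (intro sum.cong refl) fastforce
  also have "\<dots> = card {x\<in>sites N. \<xi> x \<noteq> 0}" by (simp only: card_filter finite_sites)
  finally have k: "k = card {x\<in>sites N. \<xi> x \<noteq> 0}" .
  have "{x\<in>sites N. \<xi> x = 0} \<union> {x\<in>sites N. \<xi> x \<noteq> 0} = sites N" by auto
  then have "card {x\<in>sites N. \<xi> x = 0} + card {x\<in>sites N. \<xi> x \<noteq> 0} = card (sites N)"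
    by (subst card_Un_disjoint[symmetric]) auto
  then show "card {x\<in>sites N. \<xi> x = 0} = N - k" "k \<le> N" using k by auto
qed

text \<open>By rotation the count is the same at every site, and summing it over the sites counts
  \<open>N - k\<close> holes for each configuration.\<close>

lemma card_hole_at:
  assumes "x \<in> sites N"
  shows "N * card {\<xi>\<in>ergodic_component N k. \<xi> x = 0} = (N - k) * card (ergodic_component N k)"
proof -
  let ?c = "\<lambda>x. card {\<xi>\<in>ergodic_component N k. \<xi> x = 0}"
  have step: "?c (right N x) = ?c x" if "x \<in> sites N" for x
  proof -
    have "bij_betw (rot N) {\<xi>\<in>ergodic_component N k. \<xi> x = 0} {\<xi>\<in>ergodic_component N k. \<xi> (right N x) = 0}"
      by (rule bij_betw_rot_filter) (use that in simp)
    then show ?thesis by (simp add: bij_betw_same_card)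
  qed
  have "int n \<in> sites N \<longrightarrow> ?c (int n) = ?c 0" for n
  proof (induction n)
    case (Suc n)
    show ?case
    proof
      assume "int (Suc n) \<in> sites N"
      then have "int n \<in> sites N" "right N (int n) = int (Suc n)" by (auto simp: sites_def right_def)
      then show "?c (int (Suc n)) = ?c 0" using step[of "int n"] Suc by simp
    qed
  qed simp
  then have const: "?c y = ?c 0" if "y \<in> sites N" for y
    using that \<open>\<And>n. int n \<in> sites N \<longrightarrow> ?c (int n) = ?c 0\<close>[of "nat y"] by (simp add: sites_def)
  have "N * ?c x = (\<Sum>y\<in>sites N. ?c y)" using const assms by simp
  also have "\<dots> = (\<Sum>y\<in>sites N. \<Sum>\<xi>\<in>ergodic_component N k. if \<xi> y = 0 then 1 else 0)"
    by (simp only: card_filter finite_ergodic finite_sites)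
  also have "\<dots> = (\<Sum>\<xi>\<in>ergodic_component N k. \<Sum>y\<in>sites N. if \<xi> y = 0 then 1 else 0)" by (rule sum.swap)
  also have "\<dots> = (\<Sum>\<xi>\<in>ergodic_component N k. card {y\<in>sites N. \<xi> y = 0})"
    by (simp only: card_filter finite_ergodic finite_sites)
  also have "\<dots> = (\<Sum>\<xi>\<in>ergodic_component N k. N - k)"
    by (intro sum.cong refl card_holes) (use ergodic_subset in auto)
  finally show ?thesis by simp
qed

subsection \<open>Unfolding the exclusion process on a segment\<close>

text \<open>The letter \<open>True\<close> stands for a hole together with the particle after it,
  \<open>False\<close> for a particle that is not preceded by a hole.\<close>

fun expand :: "bool list \<Rightarrow> nat list" where
  "expand [] = []"
| "expand (True # w) = 0 # 1 # expand w"
| "expand (False # w) = 1 # expand w"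

lemma expand_append: "expand (v @ w) = expand v @ expand w"
  by (induction v rule: expand.induct) auto

lemma expand_inject: "expand v = expand w \<Longrightarrow> v = w"
proof (induction v arbitrary: w rule: expand.induct)
  case 1
  then show ?case by (cases w rule: expand.cases) auto
next
  case (2 v)
  then show ?case by (cases w rule: expand.cases) auto
next
  case (3 v)
  then show ?case by (cases w rule: expand.cases) auto
qed

lemma length_expand: "length (expand w) = length w + length (filter id w)"
  by (induction w rule: expand.induct) auto

lemma sum_list_expand: "sum_list (expand w) = length w"
  by (induction w rule: expand.induct) auto

lemma set_expand: "set (expand w) \<subseteq> {0, 1}"
  by (induction w rule: expand.induct) auto

lemma expand_eq_Nil [simp]: "expand w = [] \<longleftrightarrow> w = []"
  by (cases w rule: expand.cases) auto

lemma last_expand: "w \<noteq> [] \<Longrightarrow> last (expand w) = 1"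
  by (induction w rule: expand.induct) auto

lemma expand_adjacent: "Suc i < length (expand w) \<Longrightarrow> 1 \<le> expand w ! i + expand w ! Suc i"
proof (induction w arbitrary: i rule: expand.induct)
  case (2 w)
  show ?case
  proof (cases i)
    case (Suc j)
    then show ?thesis using 2 by (cases j) auto
  qed simp
next
  case (3 w)
  then show ?case by (cases i) auto
qed simp

text \<open>The list is parsed from the left: a 0 takes the 1 that must follow it, and the condition
  on the last letter excludes an unmatched 0 at the end.\<close>

lemma expand_surj:
  assumes "set l \<subseteq> {0, 1}" "\<And>i. Suc i < length l \<Longrightarrow> 1 \<le> l ! i + l ! Suc i" "l \<noteq> [] \<Longrightarrow> last l = 1"
  shows "\<exists>w. expand w = l"
  using assms
proof (induction "length l" arbitrary: l rule: less_induct)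
  case less
  show ?case
  proof (cases l)
    case Nil
    then show ?thesis by (intro exI[of _ "[]"]) simp
  next
    case (Cons a l')
    have adj: "1 \<le> l' ! i + l' ! Suc i" if "Suc i < length l'" for i
      using less.prems(2)[of "Suc i"] that Cons by simp
    show ?thesis
    proof (cases "a = 1")
      case True
      have "\<exists>w. expand w = l'"
        by (rule less.hyps) (use Cons less.prems adj in \<open>auto split: if_splits\<close>)
      then obtain w where "expand w = l'" by blast
      then show ?thesis using True Cons by (intro exI[of _ "False # w"]) simp
    next
      case False
      then have a: "a = 0" using less.prems(1) Cons by auto
      show ?thesis
      proof (cases l')
        case Nil
        then show ?thesis using less.prems(3) Cons a by simp
      next
        case (Cons b m)
        have b: "b = 1" using less.prems(2)[of 0] less.prems(1) \<open>l = a # l'\<close> Cons a by auto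
        have adj': "1 \<le> m ! i + m ! Suc i" if "Suc i < length m" for i
          using adj[of "Suc i"] that Cons by simp
        have "\<exists>w. expand w = m"
          by (rule less.hyps) (use Cons \<open>l = a # l'\<close> less.prems adj' in \<open>auto split: if_splits\<close>)
        then obtain w where "expand w = m" by blast
        then show ?thesis using a b Cons \<open>l = a # l'\<close> by (intro exI[of _ "True # w"]) simp
      qed
    qed
  qed
qed

section \<open>From words to configurations on the circle\<close>

definition config_of :: "nat list \<Rightarrow> config" where
  "config_of l = restrict (\<lambda>x. l ! nat x) (sites (length l))"

definition word :: "nat \<Rightarrow> nat set \<Rightarrow> bool list" where
  "word k A = map (\<lambda>i. i \<in> A) [0..<k]"

text \<open>In the ergodic component every hole is followed by a particle.  Merging the two maps a
  configuration to the usual exclusion process on \<open>k\<close> sites, with \<open>A\<close> the set of its holes.\<close>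

definition unfold :: "nat \<Rightarrow> nat set \<Rightarrow> config" where
  "unfold k A = config_of (expand (word k A))"

lemma length_word [simp]: "length (word k A) = k"
  by (simp add: word_def)

lemma length_expand_word:
  "length (expand (word k A)) = k + card (A \<inter> {..<k})"
proof -
  have "length (filter id (word k A)) = card {i. i < k \<and> i \<in> A}"
    by (auto simp: length_filter_conv_card word_def id_def intro!: arg_cong[where f = card])
  also have "{i. i < k \<and> i \<in> A} = A \<inter> {..<k}" by auto
  finally show ?thesis by (simp add: length_expand id_def)
qed

lemma length_expand_slice:
  "A \<in> slice {..<k} h \<Longrightarrow> length (expand (word k A)) = k + h"
  by (auto simp: length_expand_word slice_def Int_absorb2)

lemma sum_sites: "(\<Sum>x\<in>sites N. g (nat x)) = (\<Sum>i<N. g i)"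
  by (rule sum.reindex_bij_betw, rule bij_betw_byWitness[where f' = int]) (auto simp: sites_def)

lemma unfold_apply:
  assumes "A \<in> slice {..<k} h" "x \<in> sites (k + h)"
  shows "unfold k A x = expand (word k A) ! nat x"
  using assms by (simp add: unfold_def config_of_def length_expand_slice)

lemma unfold_ergodic:
  assumes A: "A \<in> slice {..<k} h" and k: "0 < k"
  shows "unfold k A \<in> ergodic_component (k + h) k" "unfold k A (int (k + h) - 1) = 1"
proof -
  let ?l = "expand (word k A)" and ?N = "k + h"
  have len: "length ?l = ?N" by (rule length_expand_slice[OF A])
  have w: "word k A \<noteq> []" using k by (metis length_word length_greater_0_conv)
  have "last ?l = ?l ! (?N - 1)" using w by (subst last_conv_nth) (auto simp: len)
  then have l1: "?l ! (?N - 1) = 1" using last_expand[OF w] by simp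
  then show last: "unfold k A (int ?N - 1) = 1"
    using k nat_int[of "?N - 1"]
    by (subst unfold_apply[OF A]) (auto simp: sites_def of_nat_diff simp del: nat_int)
  have "unfold k A \<in> sites ?N \<rightarrow>\<^sub>E {0, 1}"
  proof (rule PiE_I)
    fix x assume x: "x \<in> sites ?N"
    then have "?l ! nat x \<in> set ?l" by (intro nth_mem) (simp add: len sites_def nat_less_iff)
    then show "unfold k A x \<in> {0, 1}" using set_expand unfold_apply[OF A x] by auto
  qed (simp add: unfold_def config_of_def len)
  moreover have "(\<Sum>x\<in>sites ?N. unfold k A x) = k"
  proof -
    have "(\<Sum>x\<in>sites ?N. unfold k A x) = (\<Sum>x\<in>sites ?N. ?l ! nat x)"
      by (intro sum.cong refl unfold_apply[OF A])
    also have "\<dots> = sum_list ?l" by (simp add: sum_sites sum_list_sum_nth len atLeast0LessThan)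
    finally show ?thesis by (simp add: sum_list_expand)
  qed
  moreover have "1 \<le> unfold k A x + unfold k A (right ?N x)" if x: "x \<in> sites ?N" for x
  proof (cases "x = int ?N - 1")
    case False
    then have "right ?N x = x + 1" "x + 1 \<in> sites ?N" "Suc (nat x) < length ?l" "nat (x + 1) = Suc (nat x)"
      using x by (auto simp: right_eq sites_def len)
    then show ?thesis using expand_adjacent[of "nat x" "word k A"] x by (simp add: unfold_apply[OF A])
  qed (use last in simp)
  ultimately show "unfold k A \<in> ergodic_component ?N k"
    by (simp add: ergodic_component_def configs_def)
qed

lemma word_inject:
  assumes "A \<subseteq> {..<k}" "B \<subseteq> {..<k}" "word k A = word k B"
  shows "A = B"
proof -
  have "i \<in> A \<longleftrightarrow> i \<in> B" if "i < k" for i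
    using arg_cong[OF assms(3), of "\<lambda>w. w ! i"] that by (simp add: word_def)
  then show ?thesis using assms(1,2) by blast
qed

lemma inj_on_unfold: "inj_on (unfold k) (slice {..<k} h)"
proof (rule inj_onI)
  fix A B assume A: "A \<in> slice {..<k} h" and B: "B \<in> slice {..<k} h" and eq: "unfold k A = unfold k B"
  have "expand (word k A) = expand (word k B)"
  proof (rule nth_equalityI)
    show "length (expand (word k A)) = length (expand (word k B))"
      by (simp add: length_expand_slice[OF A] length_expand_slice[OF B])
    fix i assume "i < length (expand (word k A))"
    then have "int i \<in> sites (k + h)" by (simp add: length_expand_slice[OF A] sites_def)
    then show "expand (word k A) ! i = expand (word k B) ! i"
      using fun_cong[OF eq, of "int i"] by (simp add: unfold_apply[OF A] unfold_apply[OF B])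
  qed
  then have "word k A = word k B" by (rule expand_inject)
  then show "A = B" using A B word_inject by (auto simp: slice_def)
qed

text \<open>A particle at the last site means that no pair \<open>01\<close> straddles the cut
  between \<open>N - 1\<close> and \<open>0\<close>; this is the only obstruction to reading the
  circle as a word.\<close>

lemma unfold_image:
  assumes k: "0 < k"
  shows "unfold k ` slice {..<k} h = {\<xi>\<in>ergodic_component (k + h) k. \<xi> (int (k + h) - 1) = 1}"
proof (intro equalityI subsetI)
  fix \<xi> assume "\<xi> \<in> {\<xi>\<in>ergodic_component (k + h) k. \<xi> (int (k + h) - 1) = 1}"
  then have \<xi>: "\<xi> \<in> ergodic_component (k + h) k" "\<xi> (int (k + h) - 1) = 1" by auto
  then have c: "\<xi> \<in> configs (k + h) k" using ergodic_subset by blast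
  define l where "l = map (\<lambda>i. \<xi> (int i)) [0..<k + h]"
  have len: "length l = k + h" by (simp add: l_def)
  have "\<exists>w. expand w = l"
  proof (rule expand_surj)
    show "set l \<subseteq> {0, 1}"
    proof
      fix v assume "v \<in> set l"
      then obtain i where "i < k + h" "v = \<xi> (int i)" by (auto simp: l_def)
      then show "v \<in> {0, 1}" using config_01[OF c, of "int i"] by (simp add: sites_def)
    qed
    show "1 \<le> l ! i + l ! Suc i" if "Suc i < length l" for i
    proof -
      have i: "int i \<in> sites (k + h)" "right (k + h) (int i) = int (Suc i)"
        using that by (auto simp: len right_def sites_def)
      then have "1 \<le> \<xi> (int i) + \<xi> (int (Suc i))" using \<xi>(1) by (force simp: ergodic_component_def)
      then show ?thesis using that by (simp add: l_def del: upt_Suc of_nat_Suc)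
    qed
    show "last l = 1" if "l \<noteq> []"
      using \<xi>(2) k by (subst last_conv_nth[OF that]) (simp add: l_def nth_append of_nat_diff del: upt_Suc)
  qed
  then obtain w where w: "expand w = l" by blast
  have "sum_list l = (\<Sum>i<k + h. \<xi> (int i))"
    by (simp add: sum_list_sum_nth len atLeast0LessThan) (simp add: l_def)
  also have "\<dots> = (\<Sum>x\<in>sites (k + h). \<xi> x)"
    unfolding sum_sites[symmetric] by (intro sum.cong refl) (simp add: sites_def)
  also have "\<dots> = k" using c by (simp add: configs_def)
  finally have lw: "length w = k" using sum_list_expand[of w] w by simp
  define A where "A = {i. i < k \<and> w ! i}"
  have wA: "word k A = w" by (rule nth_equalityI) (auto simp: lw word_def A_def)
  have "k + card (A \<inter> {..<k}) = k + h" using length_expand_word[of k A] by (simp add: wA w len)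
  moreover have "A \<inter> {..<k} = A" by (auto simp: A_def)
  ultimately have A: "A \<in> slice {..<k} h" by (auto simp: slice_def A_def)
  have "unfold k A = \<xi>"
  proof (rule extensionalityI[of _ "sites (k + h)"])
    show "unfold k A \<in> extensional (sites (k + h))" by (simp add: unfold_def config_of_def wA w len)
    show "\<xi> \<in> extensional (sites (k + h))" by (rule config_extensional[OF c])
    fix x assume x: "x \<in> sites (k + h)"
    then have "nat x < k + h" by (auto simp: sites_def)
    then show "unfold k A x = \<xi> x"
      using x by (simp add: unfold_apply[OF A x] wA w l_def sites_def del: upt_Suc)
  qed
  then show "\<xi> \<in> unfold k ` slice {..<k} h" using A by blast
qed (use unfold_ergodic k in auto)

lemma word_split:
  assumes "Suc b < k"
  shows "word k A = word b A @ [b \<in> A, Suc b \<in> A] @ map (\<lambda>i. i \<in> A) [Suc (Suc b)..<k]"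
proof -
  have "[0..<k] = [0..<b] @ b # Suc b # [Suc (Suc b)..<k]"
    using assms upt_add_eq_append[of 0 b "k - b"] by (simp add: upt_conv_Cons)
  then show ?thesis by (simp add: word_def)
qed

text \<open>The letters \<open>True, False\<close> expand to \<open>0 1 1\<close> and
  \<open>False, True\<close> to \<open>1 0 1\<close>, so swapping them exchanges the first two sites
  of this block. The third site is occupied in both cases. The position \<open>x\<close> is the
  length of the expanded prefix.\<close>

lemma unfold_swap:
  assumes A: "A \<in> slice {..<k} h" and b: "Suc b < k" "(b \<in> A) \<noteq> (Suc b \<in> A)" and N: "4 \<le> k + h"
  defines "x \<equiv> int (length (expand (word b A)))"
  shows "x \<in> sites (k + h)" "unfold k A \<in> free (k + h) k x"
    "unfold k (exch b (Suc b) ` A) = move (k + h) (unfold k A) x"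
proof -
  let ?N = "k + h" and ?B = "exch b (Suc b) ` A"
  have B: "?B \<in> slice {..<k} h" using A b by (intro transpose_slice) auto
  define U V where "U = expand (word b A)" and "V = expand (map (\<lambda>i. i \<in> A) [Suc (Suc b)..<k])"
  have wb: "word b ?B = word b A"
    by (simp add: word_def in_transpose_image_iff)
  have rest: "map (\<lambda>i. i \<in> ?B) [Suc (Suc b)..<k] = map (\<lambda>i. i \<in> A) [Suc (Suc b)..<k]"
    by (simp add: in_transpose_image_iff)
  define P Q where "P = (if b \<in> A then [0, 1, 1] else [1, 0, 1 :: nat])"
    and "Q = (if b \<in> A then [1, 0, 1] else [0, 1, 1 :: nat])"
  have lA: "expand (word k A) = U @ P @ V"
    unfolding word_split[OF b(1)] expand_append using b(2)
    by (cases "b \<in> A") (auto simp: U_def V_def P_def)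
  have lB: "expand (word k ?B) = U @ Q @ V"
    unfolding word_split[OF b(1), of ?B] expand_append wb rest using b(2)
    by (cases "b \<in> A") (auto simp: U_def V_def Q_def in_transpose_image_iff)
  have lenN: "length U + 3 + length V = ?N"
    using length_expand_slice[OF A] by (simp add: lA P_def split: if_splits)
  have x: "x = int (length U)" by (simp add: x_def U_def)
  show xs: "x \<in> sites ?N" using lenN by (simp add: x sites_def)
  have rx: "right ?N x = x + 1" "right ?N (x + 1) = x + 2" "x + 1 \<in> sites ?N" "x + 2 \<in> sites ?N"
    using lenN by (auto simp: x sites_def right_def)
  have n: "nat x = length U" "nat (x + 1) = Suc (length U)" "nat (x + 2) = Suc (Suc (length U))" by (auto simp: x)
  have v: "unfold k A x = P ! 0" "unfold k A (x + 1) = P ! 1" "unfold k A (x + 2) = 1"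
    using xs rx by (simp_all add: unfold_apply[OF A] n lA nth_append P_def)
  have G: "unfold k A \<in> ergodic_component ?N k" and last: "unfold k A (int ?N - 1) = 1"
    using unfold_ergodic[OF A] b by auto
  \<comment> \<open>For an empty prefix the left neighbour is the last site of the circle; otherwise
    it is the last letter of an expanded word. Both are particles.\<close>
  have "unfold k A (left ?N x) = 1"
  proof (cases "U = []")
    case True
    then have "x = 0" by (simp add: x)
    then show ?thesis using last left_eq[OF xs] by simp
  next
    case False
    then have "word b A \<noteq> []" by (auto simp: U_def)
    then have "last U = 1" by (simp add: U_def last_expand)
    then have "U ! (length U - 1) = 1" using False by (simp add: last_conv_nth)
    moreover have l: "left ?N x = x - 1" and nl: "nat (x - 1) = length U - 1"
      using False left_eq[OF xs] by (auto simp: x nat_diff_distrib)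
    moreover have "x - 1 \<in> sites ?N" using left_sites[OF xs] unfolding l .
    ultimately have "unfold k A (x - 1) = 1" using False
      by (simp add: unfold_apply[OF A] lA nth_append)
    then show ?thesis unfolding l .
  qed
  then show "unfold k A \<in> free ?N k x"
    using G v by (simp add: free_def rx P_def)
  show "unfold k ?B = move ?N (unfold k A) x"
  proof (rule extensionalityI[of _ "sites ?N"])
    show "unfold k ?B \<in> extensional (sites ?N)"
      using unfold_ergodic(1)[OF B] b ergodic_subset config_extensional by blast
    show "move ?N (unfold k A) x \<in> extensional (sites ?N)"
      unfolding move_def using G ergodic_subset xs
      by (intro config_extensional[where k = k] exchange_configs) auto
    fix z assume z: "z \<in> sites ?N"
    consider "nat z < length U" | "z = x" | "z = x + 1" | "z = x + 2" | "nat z \<ge> length U + 3"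
      using z by (force simp: x sites_def)
    then show "unfold k ?B z = move ?N (unfold k A) x z"
    proof cases
      case 1
      then have "z \<noteq> x" "z \<noteq> x + 1" using z by (auto simp: x sites_def)
      then show ?thesis using 1 z
        by (simp add: move_apply[OF N xs] rx unfold_apply[OF A] unfold_apply[OF B] lA lB nth_append)
    next
      case 5
      then have "z \<noteq> x" "z \<noteq> x + 1" by (auto simp: x)
      moreover have "(U @ Q @ V) ! nat z = (U @ P @ V) ! nat z"
        using 5 by (simp add: nth_append P_def Q_def)
      ultimately show ?thesis using z
        by (simp add: move_apply[OF N xs] rx unfold_apply[OF A] unfold_apply[OF B] lA lB)
    qed (use rx xs v in \<open>simp_all add: move_apply[OF N xs] unfold_apply[OF B] lB n nth_append P_def Q_def\<close>)
  qed
qed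

lemma length_expand_word_less:
  "b < c \<Longrightarrow> length (expand (word b A)) < length (expand (word c A))"
  unfolding length_expand_word by (intro add_less_le_mono card_mono) auto

text \<open>Swaps of unequal letters inject into the pairs of a bond and a configuration: the
  configuration recovers the set, and the expanded prefix length is strictly increasing in
  \<open>b\<close>. The other bonds and configurations only add nonnegative terms to the
  energy.\<close>

lemma adj_form_le_energy:
  assumes "4 \<le> k + h"
  shows "adj_form k h (\<lambda>A. f (unfold k A)) \<le> energy (k + h) k f"
proof -
  let ?N = "k + h"
  let ?t = "\<lambda>(A, b). (f (unfold k (exch b (Suc b) ` A)) - f (unfold k A))\<^sup>2"
  let ?e = "\<lambda>(x, \<xi>). (f (move ?N \<xi> x) - f \<xi>)\<^sup>2"
  define X where "X = slice {..<k} h \<times> {..<k - 1}"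
  define P where "P = {(A, b)\<in>X. (b \<in> A) \<noteq> (Suc b \<in> A)}"
  define \<theta> where "\<theta> = (\<lambda>(A, b). (int (length (expand (word b A))), unfold k A))"
  have "adj_form k h (\<lambda>A. f (unfold k A)) = sum ?t X"
    unfolding adj_form_def X_def by (simp add: sum.cartesian_product)
  also have "\<dots> = sum ?t P"
  proof (rule sum.mono_neutral_right)
    show "\<forall>p\<in>X - P. ?t p = 0"
    proof
      fix p assume "p \<in> X - P"
      then obtain A b where "p = (A, b)" "b \<in> A \<longleftrightarrow> Suc b \<in> A" by (auto simp: X_def P_def)
      then show "?t p = 0" by (simp add: transpose_image_eq)
    qed
  qed (auto simp: X_def P_def)
  also have "\<dots> = (\<Sum>p\<in>P. ?e (\<theta> p))"
  proof (rule sum.cong[OF refl])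
    fix p assume "p \<in> P"
    then obtain A b where p: "p = (A, b)" "A \<in> slice {..<k} h" "Suc b < k" "(b \<in> A) \<noteq> (Suc b \<in> A)"
      by (auto simp: P_def X_def less_diff_conv)
    show "?t p = ?e (\<theta> p)" using unfold_swap(3)[OF p(2-4) assms] by (simp add: p(1) \<theta>_def)
  qed
  also have "\<dots> = sum ?e (\<theta> ` P)"
  proof (rule sum.reindex[symmetric, unfolded o_def], rule inj_onI)
    fix p q assume p: "p \<in> P" and q: "q \<in> P" and eq: "\<theta> p = \<theta> q"
    obtain A b where A: "p = (A, b)" "A \<in> slice {..<k} h" using p by (auto simp: P_def X_def)
    obtain B c where B: "q = (B, c)" "B \<in> slice {..<k} h" using q by (auto simp: P_def X_def)
    have "A = B" using eq A B inj_on_unfold[of k h] by (auto simp: \<theta>_def inj_on_def)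
    moreover from this have "b = c" using eq A B length_expand_word_less[of b c A] length_expand_word_less[of c b A]
      by (cases b c rule: linorder_cases) (auto simp: \<theta>_def)
    ultimately show "p = q" using A B by simp
  qed
  also have "\<dots> \<le> sum ?e (SIGMA x:sites ?N. free ?N k x)"
  proof (rule sum_mono2)
    show "\<theta> ` P \<subseteq> (SIGMA x:sites ?N. free ?N k x)"
      using unfold_swap(1,2) assms by (fastforce simp: \<theta>_def P_def X_def)
  qed auto
  also have "\<dots> = energy ?N k f" unfolding energy_def by (subst sum.Sigma) auto
  finally show ?thesis .
qed

text \<open>In \<open>72 = 9 * 2 * 4\<close> the 9 comes from joining the two pieces, the 2 from
  their number and the 4 from the segment. One factor \<open>2 * k - N\<close> in the denominator is
  the number of particles minus holes on the segment of \<open>k\<close> sites, the other is due to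
  the size of the overlap.\<close>

lemma log_sobolev_ergodic:
  assumes N: "4 \<le> N" and k: "k < N" "N < 2 * k"
  shows "entr (ergodic_component N k) (\<lambda>\<xi>. (f \<xi>)\<^sup>2)
    \<le> 72 * real N ^ 5 / (real (2 * k - N) ^ 2 * real (N - k)) * energy N k f"
proof -
  define h where "h = N - k"
  have Nkh: "N = k + h" and h0: "0 < h" and hk: "h < k" using k by (auto simp: h_def)
  let ?G = "ergodic_component N k"
  define A where "A = {\<xi>\<in>?G. \<xi> (int N - 1) = 1}"
  define B where "B = {\<xi>\<in>?G. \<xi> 0 = 1}"
  have rB: "bij_betw (rot N) A B"
    unfolding A_def B_def by (rule bij_betw_rot_filter) (use N in \<open>simp add: left_eq sites_def\<close>)
  define c where "c = 4 * real k ^ 4 / (real h * real (k - h))"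
  have c0: "c \<ge> 0" by (simp add: c_def)
  have eA: "entr A (\<lambda>\<xi>. (f \<xi>)\<^sup>2) \<le> c * energy N k f" for f
  proof -
    have A: "A = unfold k ` slice {..<k} h" unfolding A_def Nkh using hk by (subst unfold_image) auto
    have "entr A (\<lambda>\<xi>. (f \<xi>)\<^sup>2) = entr (slice {..<k} h) (\<lambda>X. (f (unfold k X))\<^sup>2)"
      unfolding A by (rule entr_reindex[OF inj_on_unfold])
    also have "\<dots> \<le> c * adj_form k h (\<lambda>X. f (unfold k X))"
      unfolding c_def by (rule log_sobolev_segment) (use hk in simp)
    also have "\<dots> \<le> c * energy N k f"
      using adj_form_le_energy[of k h f] N c0 by (intro mult_left_mono) (auto simp: Nkh)
    finally show ?thesis .
  qed
  have eB: "entr B (\<lambda>\<xi>. (f \<xi>)\<^sup>2) \<le> c * energy N k f"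
  proof -
    have "B = rot N ` A" "inj_on (rot N) A" using rB by (auto simp: bij_betw_def)
    then have "entr B (\<lambda>\<xi>. (f \<xi>)\<^sup>2) = entr A (\<lambda>\<xi>. (f (rot N \<xi>))\<^sup>2)"
      using entr_reindex by blast
    also have "\<dots> \<le> c * energy N k (\<lambda>\<xi>. f (rot N \<xi>))" by (rule eA)
    finally show ?thesis by (simp add: energy_rot[OF N])
  qed
  have s: "0 \<in> sites N" "int N - 1 \<in> sites N" using N by (auto simp: sites_def)
  have r: "right N (int N - 1) = 0" using s by (simp add: right_eq)
  have disj: "\<not> (\<xi> 0 = 0 \<and> \<xi> (int N - 1) = 0)" if "\<xi> \<in> ?G" for \<xi>
    using ergodic_right[OF that s(2)] r by auto
  have v: "\<xi> 0 = 0 \<or> \<xi> 0 = 1" "\<xi> (int N - 1) = 0 \<or> \<xi> (int N - 1) = 1" if "\<xi> \<in> ?G" for \<xi>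
    using ergodic_01[OF that] s by blast+
  have AB: "A \<union> B = ?G" unfolding A_def B_def using disj v by blast
  have fin: "finite A" "finite B" by (simp_all add: A_def B_def)
  \<comment> \<open>Outside the overlap there is a hole at \<open>0\<close> or at
    \<open>N - 1\<close>, and never at both since these sites are neighbours. By
    \<open>card_hole_at\<close> each case has proportion \<open>(N - k) / N\<close>.\<close>
  have part: "card ?G = card (A \<inter> B) + (card {\<xi>\<in>?G. \<xi> 0 = 0} + card {\<xi>\<in>?G. \<xi> (int N - 1) = 0})"
  proof -
    have "?G = (A \<inter> B) \<union> ({\<xi>\<in>?G. \<xi> 0 = 0} \<union> {\<xi>\<in>?G. \<xi> (int N - 1) = 0})"
      unfolding A_def B_def using v by blast
    then have "card ?G = card ((A \<inter> B) \<union> ({\<xi>\<in>?G. \<xi> 0 = 0} \<union> {\<xi>\<in>?G. \<xi> (int N - 1) = 0}))"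
      by (rule arg_cong)
    also have "\<dots> = card (A \<inter> B) + card ({\<xi>\<in>?G. \<xi> 0 = 0} \<union> {\<xi>\<in>?G. \<xi> (int N - 1) = 0})"
      by (rule card_Un_disjoint) (auto simp: A_def B_def)
    also have "card ({\<xi>\<in>?G. \<xi> 0 = 0} \<union> {\<xi>\<in>?G. \<xi> (int N - 1) = 0})
      = card {\<xi>\<in>?G. \<xi> 0 = 0} + card {\<xi>\<in>?G. \<xi> (int N - 1) = 0}"
    proof (rule card_Un_disjoint)
      show "{\<xi>\<in>?G. \<xi> 0 = 0} \<inter> {\<xi>\<in>?G. \<xi> (int N - 1) = 0} = {}" using disj by blast
    qed auto
    finally show ?thesis .
  qed
  have G0: "card ?G > 0"
  proof -
    have "card (slice {..<k} h) > 0" using hk by (simp add: card_slice zero_less_binomial_iff)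
    then obtain X where "X \<in> slice {..<k} h" by (metis all_not_in_conv card.empty less_irrefl)
    then have "?G \<noteq> {}" using unfold_ergodic(1)[of X k h] hk unfolding Nkh by auto
    then show ?thesis by (simp add: card_gt_0_iff)
  qed
  have "N * card ?G = N * (card (A \<inter> B) + (card {\<xi>\<in>?G. \<xi> 0 = 0} + card {\<xi>\<in>?G. \<xi> (int N - 1) = 0}))"
    by (rule arg_cong[OF part])
  also have "\<dots> = N * card (A \<inter> B) + (h * card ?G + h * card ?G)"
    by (simp only: distrib_left card_hole_at[OF s(1)] card_hole_at[OF s(2)] h_def)
  finally have "N * card ?G = N * card (A \<inter> B) + (h * card ?G + h * card ?G)" .
  then have "real (N * card ?G) = real (N * card (A \<inter> B) + (h * card ?G + h * card ?G))" by (rule arg_cong)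
  moreover have "real N = real k + real h" "real (k - h) = real k - real h"
    using hk by (simp_all add: Nkh of_nat_diff)
  ultimately have I: "real N * real (card (A \<inter> B)) = real (k - h) * real (card ?G)"
    by (simp only: of_nat_mult of_nat_add) (simp add: algebra_simps)
  moreover have "real (k - h) * real (card ?G) > 0" using G0 hk by simp
  ultimately have "real N * real (card (A \<inter> B)) > 0" by (simp only:)
  then have "real (card (A \<inter> B)) > 0" by (simp add: zero_less_mult_iff)
  moreover from this I have ratio: "real (card ?G) / real (card (A \<inter> B)) = real N / real (k - h)"
    using hk by (simp add: field_simps)
  ultimately have "A \<inter> B \<noteq> {}" by (metis card.empty less_irrefl of_nat_0)
  have E0: "energy N k f \<ge> 0" unfolding energy_def by (intro sum_nonneg) auto
  have "entr ?G (\<lambda>\<xi>. (f \<xi>)\<^sup>2)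
     \<le> (1 + 8 * (card ?G / card (A \<inter> B))) * (entr A (\<lambda>\<xi>. (f \<xi>)\<^sup>2) + entr B (\<lambda>\<xi>. (f \<xi>)\<^sup>2))"
    using entr_union[OF fin \<open>A \<inter> B \<noteq> {}\<close>, of "\<lambda>\<xi>. (f \<xi>)\<^sup>2"] by (simp add: AB)
  also have "\<dots> \<le> (9 * (real N / real (k - h))) * (c * energy N k f + c * energy N k f)"
  proof (intro mult_mono add_mono eA eB)
    show "1 + 8 * (card ?G / card (A \<inter> B)) \<le> 9 * (real N / real (k - h))"
    proof -
      have "1 \<le> real N / real (k - h)" using hk by (simp add: Nkh le_divide_eq)
      moreover have "1 \<le> r \<Longrightarrow> 1 + 8 * r \<le> 9 * r" for r :: real by simp
      ultimately show ?thesis unfolding ratio by blast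
    qed
    show "0 \<le> entr A (\<lambda>\<xi>. (f \<xi>)\<^sup>2) + entr B (\<lambda>\<xi>. (f \<xi>)\<^sup>2)"
      using fin \<open>A \<inter> B \<noteq> {}\<close> by (intro add_nonneg_nonneg entr_nonneg) auto
  qed simp
  also have "\<dots> = 72 * (real N * real k ^ 4) / (real (k - h) ^ 2 * real h) * energy N k f"
    by (simp add: c_def power2_eq_square mult_ac)
  also have "\<dots> \<le> 72 * (real N * real N ^ 4) / (real (k - h) ^ 2 * real h) * energy N k f"
    using k by (intro mult_right_mono divide_right_mono mult_left_mono power_mono E0) auto
  also have "k - h = 2 * k - N" using hk by (simp add: Nkh)
  also have "real N * real N ^ 4 = real N ^ 5" by (simp add: eval_nat_numeral)
  finally show ?thesis by (simp add: h_def)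
qed

subsection \<open>The semigroup on the ergodic component\<close>

lemma generator_bound_ergodic:
  assumes N: "4 \<le> N" and f: "\<And>\<xi>. \<xi> \<in> ergodic_component N k \<Longrightarrow> \<bar>f \<xi>\<bar> \<le> B"
    and \<xi>: "\<xi> \<in> ergodic_component N k"
  shows "\<bar>generator N f \<xi>\<bar> \<le> real N * B"
proof -
  have B: "B \<ge> 0" using f[OF \<xi>] by linarith
  have "\<bar>generator N f \<xi>\<bar> \<le> (\<Sum>x\<in>sites N. \<bar>if \<xi> \<in> free N k x then 1 / 2 * (f (move N \<xi> x) - f \<xi>) else 0\<bar>)"
    unfolding generator_ergodic[OF \<xi>] by (rule sum_abs)
  also have "\<dots> \<le> (\<Sum>x\<in>sites N. B)"
  proof (rule sum_mono)
    fix x assume x: "x \<in> sites N"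
    show "\<bar>if \<xi> \<in> free N k x then 1 / 2 * (f (move N \<xi> x) - f \<xi>) else 0\<bar> \<le> B"
    proof (cases "\<xi> \<in> free N k x")
      case True
      then have "move N \<xi> x \<in> ergodic_component N k"
        using move_free[OF N x] free_subset by blast
      then show ?thesis using f[of "move N \<xi> x"] f[OF \<xi>] True by simp
    qed (use B in simp)
  qed
  finally show ?thesis by simp
qed

lemma generator_pow_bound:
  assumes N: "4 \<le> N" and f: "\<And>\<xi>. \<xi> \<in> ergodic_component N k \<Longrightarrow> \<bar>f \<xi>\<bar> \<le> B"
    and "\<xi> \<in> ergodic_component N k"
  shows "\<bar>(generator N ^^ n) f \<xi>\<bar> \<le> real N ^ n * B"
  using assms(3)
proof (induction n arbitrary: \<xi>)
  case (Suc n)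
  then show ?case using generator_bound_ergodic[OF N, of k "(generator N ^^ n) f"] by (simp add: mult.assoc)
qed (use f in simp)

lemma bounded_ergodic:
  fixes f :: "config \<Rightarrow> real"
  obtains B where "B \<ge> 0" "\<And>\<xi>. \<xi> \<in> ergodic_component N k \<Longrightarrow> \<bar>f \<xi>\<bar> \<le> B"
proof
  show "0 \<le> (\<Sum>\<xi>\<in>ergodic_component N k. \<bar>f \<xi>\<bar>)" by (intro sum_nonneg) auto
  show "\<bar>f \<xi>\<bar> \<le> (\<Sum>\<xi>\<in>ergodic_component N k. \<bar>f \<xi>\<bar>)" if "\<xi> \<in> ergodic_component N k" for \<xi>
    using that by (intro member_le_sum) auto
qed

lemma summable_norm_semigroup:
  assumes N: "4 \<le> N" and \<xi>: "\<xi> \<in> ergodic_component N k"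
  shows "summable (\<lambda>n. norm (t ^ n / fact n * (generator N ^^ n) f \<xi>))"
proof -
  obtain B where B: "\<And>\<xi>. \<xi> \<in> ergodic_component N k \<Longrightarrow> \<bar>f \<xi>\<bar> \<le> B" using bounded_ergodic[of N k f] by metis
  show ?thesis
  proof (rule summable_comparison_test')
    show "summable (\<lambda>n. B * ((\<bar>t\<bar> * real N) ^ n /\<^sub>R fact n))"
      by (intro summable_mult summable_exp_generic)
    fix n :: nat
    have "\<bar>t\<bar> ^ n / fact n * \<bar>(generator N ^^ n) f \<xi>\<bar> \<le> \<bar>t\<bar> ^ n / fact n * (real N ^ n * B)"
      by (intro mult_left_mono generator_pow_bound[OF N B \<xi>]) auto
    then show "norm (norm (t ^ n / fact n * (generator N ^^ n) f \<xi>)) \<le> B * ((\<bar>t\<bar> * real N) ^ n /\<^sub>R fact n)"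
      by (simp add: abs_mult power_abs power_mult_distrib field_simps)
  qed
qed

lemma semigroup_sums:
  assumes "4 \<le> N" "\<xi> \<in> ergodic_component N k"
  shows "(\<lambda>n. t ^ n / fact n * (generator N ^^ n) f \<xi>) sums semigroup N t f \<xi>"
  unfolding semigroup_def by (intro summable_sums summable_norm_cancel[OF summable_norm_semigroup[OF assms]])

lemma generator_add: "generator N (\<lambda>\<xi>. f \<xi> + g \<xi>) \<xi> = generator N f \<xi> + generator N g \<xi>"
  by (simp add: generator_bonds sum.distrib[symmetric] algebra_simps)

lemma generator_cmult: "generator N (\<lambda>\<xi>. c * f \<xi>) \<xi> = c * generator N f \<xi>"
  by (simp add: generator_bonds sum_distrib_left algebra_simps)

lemma generator_const: "generator N (\<lambda>_. c) \<xi> = 0"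
  by (simp add: generator_bonds)

lemma generator_pow_add: "(generator N ^^ n) (\<lambda>\<xi>. f \<xi> + g \<xi>) = (\<lambda>\<xi>. (generator N ^^ n) f \<xi> + (generator N ^^ n) g \<xi>)"
  by (induction n) (auto simp: generator_add)

lemma generator_pow_cmult: "(generator N ^^ n) (\<lambda>\<xi>. c * f \<xi>) = (\<lambda>\<xi>. c * (generator N ^^ n) f \<xi>)"
  by (induction n) (auto simp: generator_cmult)

lemma generator_pow_const: "n > 0 \<Longrightarrow> (generator N ^^ n) (\<lambda>_. c) = (\<lambda>_. 0)"
proof -
  have "(generator N ^^ m) (\<lambda>_. 0) = (\<lambda>_. 0)" for m
    by (induction m) (auto simp: generator_const)
  moreover have "generator N (\<lambda>_. c) = (\<lambda>_. 0)" by (simp add: fun_eq_iff generator_const)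
  ultimately show "n > 0 \<Longrightarrow> (generator N ^^ n) (\<lambda>_. c) = (\<lambda>_. 0)"
    by (cases n) (simp_all add: funpow_Suc_right del: funpow.simps)
qed

text \<open>The matrix \<open>L + N I\<close> has nonnegative entries and commutes with \<open>L\<close>, so
  \<open>exp (N t) exp (t L) = exp (t (L + N I))\<close> has nonnegative entries for \<open>t \<ge> 0\<close>.\<close>

definition shifted :: "nat \<Rightarrow> (config \<Rightarrow> real) \<Rightarrow> config \<Rightarrow> real" where
  "shifted N f \<zeta> = generator N f \<zeta> + real N * f \<zeta>"

text \<open>The binomial theorem for the generator and the scalar \<open>N\<close>, which commute;
  the induction step is Pascal's rule.\<close>

lemma shifted_pow:
  "(shifted N ^^ n) f \<zeta> = (\<Sum>i\<le>n. real (n choose i) * (generator N ^^ i) f \<zeta> * real N ^ (n - i))"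
proof (induction n arbitrary: \<zeta>)
  case (Suc n)
  define g where "g = (\<lambda>i. (generator N ^^ i) f)"
  have lin: "generator N (\<lambda>\<zeta>. \<Sum>i\<in>I. a i * g i \<zeta>) \<zeta> = (\<Sum>i\<in>I. a i * g (Suc i) \<zeta>)" if "finite I" for I :: "nat set" and a
    using that by (induction I rule: finite_induct) (auto simp: generator_const generator_add generator_cmult g_def)
  have IH: "(shifted N ^^ n) f = (\<lambda>\<zeta>. \<Sum>i\<le>n. real (n choose i) * real N ^ (n - i) * g i \<zeta>)"
    by (rule ext, subst Suc.IH) (simp add: g_def mult.assoc mult.commute mult.left_commute)
  have "(shifted N ^^ Suc n) f \<zeta> = (\<Sum>i\<le>n. real (n choose i) * real N ^ (n - i) * g (Suc i) \<zeta>)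
     + real N * (\<Sum>i\<le>n. real (n choose i) * real N ^ (n - i) * g i \<zeta>)"
    by (simp add: IH shifted_def lin)
  also have "(\<Sum>i\<le>n. real (n choose i) * real N ^ (n - i) * g (Suc i) \<zeta>)
     = (\<Sum>i\<in>{1..Suc n}. real (n choose (i - 1)) * real N ^ (Suc n - i) * g i \<zeta>)"
    by (rule sum.reindex_bij_witness[of _ "\<lambda>i. i - 1" Suc]) auto
  also have "\<dots> = (\<Sum>i\<le>Suc n. (if i = 0 then 0 else real (n choose (i - 1))) * real N ^ (Suc n - i) * g i \<zeta>)"
    by (rule sum.mono_neutral_cong_left) auto
  also have "real N * (\<Sum>i\<le>n. real (n choose i) * real N ^ (n - i) * g i \<zeta>)
     = (\<Sum>i\<le>n. real (n choose i) * real N ^ (Suc n - i) * g i \<zeta>)"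
    unfolding sum_distrib_left by (intro sum.cong refl) (simp add: Suc_diff_le)
  also have "\<dots> = (\<Sum>i\<le>Suc n. real (n choose i) * real N ^ (Suc n - i) * g i \<zeta>)" by simp
  finally have "(shifted N ^^ Suc n) f \<zeta> = (\<Sum>i\<le>Suc n. (if i = 0 then 0 else real (n choose (i - 1))) * real N ^ (Suc n - i) * g i \<zeta>)
     + (\<Sum>i\<le>Suc n. real (n choose i) * real N ^ (Suc n - i) * g i \<zeta>)" .
  moreover have "(if i = 0 then 0 else real (n choose (i - 1))) * real N ^ (Suc n - i) * g i \<zeta>
       + real (n choose i) * real N ^ (Suc n - i) * g i \<zeta> = real (Suc n choose i) * g i \<zeta> * real N ^ (Suc n - i)" for i
    by (cases i) (simp_all add: algebra_simps)
  ultimately show ?case by (simp only: sum.distrib[symmetric]) (simp only: g_def)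
qed simp

text \<open>Each of the \<open>N\<close> bonds removes at most one multiple of the value at
  \<open>\<zeta>\<close> itself, and the shift by \<open>N\<close> restores all of it.\<close>

lemma shifted_nonneg:
  assumes N: "4 \<le> N" and f: "\<And>\<zeta>. \<zeta> \<in> ergodic_component N k \<Longrightarrow> f \<zeta> \<ge> 0" and "\<zeta> \<in> ergodic_component N k"
  shows "(shifted N ^^ n) f \<zeta> \<ge> 0"
  using assms(3)
proof (induction n arbitrary: \<zeta>)
  case (Suc n)
  let ?g = "(shifted N ^^ n) f"
  have "generator N ?g \<zeta> \<ge> (\<Sum>x\<in>sites N. - ?g \<zeta>)"
    unfolding generator_ergodic[OF Suc.prems]
  proof (rule sum_mono)
    fix x assume x: "x \<in> sites N"
    show "- ?g \<zeta> \<le> (if \<zeta> \<in> free N k x then 1 / 2 * (?g (move N \<zeta> x) - ?g \<zeta>) else 0)"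
    proof (cases "\<zeta> \<in> free N k x")
      case True
      then have "?g (move N \<zeta> x) \<ge> 0" using Suc.IH move_free[OF N x] free_subset by blast
      then show ?thesis using True Suc.IH[OF Suc.prems] by (simp add: field_simps)
    qed (use Suc.IH[OF Suc.prems] in simp)
  qed
  then show ?case by (simp add: shifted_def[of N ?g])
qed (use f in simp)

context
  fixes N k :: nat and \<xi> :: config
  assumes N: "4 \<le> N" and \<xi>: "\<xi> \<in> ergodic_component N k"
begin

lemma semigroup_add: "semigroup N t (\<lambda>\<xi>. f \<xi> + g \<xi>) \<xi> = semigroup N t f \<xi> + semigroup N t g \<xi>"
  using sums_add[OF semigroup_sums[OF N \<xi>] semigroup_sums[OF N \<xi>], of t f t g]
    semigroup_sums[OF N \<xi>, of t "\<lambda>\<xi>. f \<xi> + g \<xi>"]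
  by (simp add: generator_pow_add distrib_left sums_unique2)

lemma semigroup_cmult: "semigroup N t (\<lambda>\<xi>. c * f \<xi>) \<xi> = c * semigroup N t f \<xi>"
  using sums_mult[OF semigroup_sums[OF N \<xi>], of c t f] semigroup_sums[OF N \<xi>, of t "\<lambda>\<xi>. c * f \<xi>"]
  by (simp add: generator_pow_cmult mult.left_commute sums_unique2)

lemma semigroup_const: "semigroup N t (\<lambda>_. c) \<xi> = c"
proof -
  have "(\<lambda>n. t ^ n / fact n * (generator N ^^ n) (\<lambda>_. c) \<xi>) sums (\<Sum>n\<in>{0}. t ^ n / fact n * (generator N ^^ n) (\<lambda>_. c) \<xi>)"
    by (rule sums_finite) (auto simp: generator_pow_const)
  then show ?thesis using semigroup_sums[OF N \<xi>, of t "\<lambda>_. c"] by (simp add: sums_unique2)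
qed

lemma semigroup_sum:
  "finite A \<Longrightarrow> semigroup N t (\<lambda>\<xi>. \<Sum>a\<in>A. f a \<xi>) \<xi> = (\<Sum>a\<in>A. semigroup N t (f a) \<xi>)"
  by (induction A rule: finite_induct) (auto simp: semigroup_const semigroup_add)

text \<open>Power series are differentiated termwise. The generator is placed inside the semigroup,
  so that pointwise bounds on \<open>generator N f\<close> can be inserted by
  \<open>semigroup_mono\<close>.\<close>

lemma DERIV_semigroup:
  "((\<lambda>t. semigroup N t f \<xi>) has_real_derivative semigroup N t (generator N f) \<xi>) (at t)"
proof -
  define c where "c = (\<lambda>n. (generator N ^^ n) f \<xi> / fact n)"
  have "summable (\<lambda>n. c n * y ^ n)" for y
    using sums_summable[OF semigroup_sums[OF N \<xi>, of y f]] by (simp add: c_def field_simps)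
  then have "DERIV (\<lambda>x. \<Sum>n. c n * x ^ n) t :> (\<Sum>n. diffs c n * t ^ n)"
    by (rule termdiffs_strong_converges_everywhere)
  moreover have "(\<lambda>x. \<Sum>n. c n * x ^ n) = (\<lambda>t. semigroup N t f \<xi>)"
    by (simp add: semigroup_def c_def field_simps)
  moreover have d: "diffs c n = (generator N ^^ n) (generator N f) \<xi> / fact n" for n
  proof -
    have "(generator N ^^ Suc n) f = (generator N ^^ n) (generator N f)" by (simp add: funpow_swap1)
    then have "diffs c n = real (Suc n) * ((generator N ^^ n) (generator N f) \<xi> / fact (Suc n))"
      by (simp only: diffs_def c_def)
    also have "\<dots> = (generator N ^^ n) (generator N f) \<xi> / fact n" by simp
    finally show ?thesis .
  qed
  have "(\<Sum>n. diffs c n * t ^ n) = semigroup N t (generator N f) \<xi>"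
    unfolding semigroup_def by (rule suminf_cong) (simp add: d)
  ultimately show ?thesis by simp
qed

lemma semigroup_nonneg:
  assumes t: "t \<ge> 0" and f: "\<And>\<zeta>. \<zeta> \<in> ergodic_component N k \<Longrightarrow> f \<zeta> \<ge> 0"
  shows "semigroup N t f \<xi> \<ge> 0"
proof -
  let ?a = "\<lambda>n. t ^ n / fact n * (generator N ^^ n) f \<xi>" and ?b = "\<lambda>n. (t * real N) ^ n /\<^sub>R fact n"
  have "(\<lambda>n. \<Sum>i\<le>n. ?a i * ?b (n - i)) sums ((\<Sum>n. ?a n) * (\<Sum>n. ?b n))"
    by (rule Cauchy_product_sums[OF summable_norm_semigroup[OF N \<xi>] summable_norm_exp])
  moreover have "(\<Sum>i\<le>n. ?a i * ?b (n - i)) \<ge> 0" for n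
  proof -
    have "?a i * ?b (n - i) = t ^ n / fact n * (real (n choose i) * (generator N ^^ i) f \<xi> * real N ^ (n - i))" if "i \<le> n" for i
    proof -
      have "t ^ n = t ^ i * t ^ (n - i)" using that by (simp flip: power_add)
      then show ?thesis
        by (simp add: binomial_fact[OF that] power_mult_distrib divide_inverse mult_ac)
    qed
    then have "(\<Sum>i\<le>n. ?a i * ?b (n - i)) = t ^ n / fact n * (shifted N ^^ n) f \<xi>"
      unfolding shifted_pow sum_distrib_left by (intro sum.cong refl) auto
    then show ?thesis using shifted_nonneg[OF N f \<xi>] t by simp
  qed
  ultimately have "0 \<le> (\<Sum>n. ?a n) * (\<Sum>n. ?b n)"
    using suminf_nonneg[of "\<lambda>n. \<Sum>i\<le>n. ?a i * ?b (n - i)"] by (simp add: sums_iff)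
  moreover have "(\<Sum>n. ?b n) = exp (t * real N)" by (simp add: exp_def)
  ultimately show ?thesis by (simp add: semigroup_def zero_le_mult_iff)
qed

lemma semigroup_mono:
  assumes "t \<ge> 0" "\<And>\<zeta>. \<zeta> \<in> ergodic_component N k \<Longrightarrow> f \<zeta> \<le> g \<zeta>"
  shows "semigroup N t f \<xi> \<le> semigroup N t g \<xi>"
proof -
  have "0 \<le> semigroup N t (\<lambda>\<zeta>. g \<zeta> + (-1) * f \<zeta>) \<xi>"
    by (rule semigroup_nonneg) (use assms in auto)
  then show ?thesis by (simp only: semigroup_add semigroup_cmult)
qed

text \<open>The function \<open>exp (a * t) * (semigroup N t Q \<xi> - b / a)\<close> is
  nonincreasing in \<open>t\<close>, because positivity carries the pointwise drift inequality over
  to the semigroup.\<close>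

lemma semigroup_gronwall:
  assumes t: "t \<ge> 0" and a: "a > 0"
    and Q: "\<And>\<zeta>. \<zeta> \<in> ergodic_component N k \<Longrightarrow> generator N Q \<zeta> \<le> - a * Q \<zeta> + b"
  shows "semigroup N t Q \<xi> \<le> exp (- a * t) * (Q \<xi> - b / a) + b / a"
proof -
  define v where "v = (\<lambda>t. exp (a * t) * (semigroup N t Q \<xi> - b / a))"
  have "v t \<le> v 0"
  proof (rule DERIV_nonpos_imp_nonincreasing[OF t])
    fix s :: real assume s: "0 \<le> s"
    have "(v has_real_derivative (exp (a * s) * a * (semigroup N s Q \<xi> - b / a)
        + exp (a * s) * semigroup N s (generator N Q) \<xi>)) (at s)"
      unfolding v_def by (auto intro!: derivative_eq_intros DERIV_semigroup)
    moreover have "semigroup N s (generator N Q) \<xi> \<le> - a * semigroup N s Q \<xi> + b"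
    proof -
      have "semigroup N s (generator N Q) \<xi> \<le> semigroup N s (\<lambda>\<zeta>. - a * Q \<zeta> + b) \<xi>"
        by (rule semigroup_mono[OF s Q])
      then show ?thesis by (simp only: semigroup_add semigroup_cmult semigroup_const)
    qed
    moreover have "exp (a * s) * a * (semigroup N s Q \<xi> - b / a) + exp (a * s) * semigroup N s (generator N Q) \<xi>
      = exp (a * s) * (semigroup N s (generator N Q) \<xi> + a * semigroup N s Q \<xi> - b)"
      using a by (simp add: algebra_simps)
    ultimately show "\<exists>y. (v has_real_derivative y) (at s) \<and> y \<le> 0"
      by (auto simp: mult_le_0_iff intro!: exI)
  qed
  moreover have "semigroup N 0 Q \<xi> = Q \<xi>"
    unfolding semigroup_def by (subst suminf_finite[of "{0}"]) auto
  ultimately have "exp (a * t) * (semigroup N t Q \<xi> - b / a) \<le> Q \<xi> - b / a" by (simp add: v_def)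
  then have "exp (- a * t) * (exp (a * t) * (semigroup N t Q \<xi> - b / a)) \<le> exp (- a * t) * (Q \<xi> - b / a)"
    by (rule mult_left_mono) simp
  then show ?thesis by (simp add: mult.assoc[symmetric] exp_add[symmetric])
qed

lemma semigroup_indicator:
  assumes "finite A"
  shows "(\<Sum>\<eta>\<in>A. law N t \<xi> \<eta>) = semigroup N t (indicator A) \<xi>"
proof -
  have "indicator A = (\<lambda>\<zeta>. \<Sum>\<eta>\<in>A. indicator {\<eta>} \<zeta> :: real)"
  proof
    fix \<zeta>
    have "(\<Sum>\<eta>\<in>A. indicator {\<eta>} \<zeta> :: real) = (\<Sum>\<eta>\<in>A. if \<eta> = \<zeta> then 1 else 0)"
      by (intro sum.cong refl) (auto simp: indicator_def simp del: fun_eq_iff)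
    then show "indicator A \<zeta> = (\<Sum>\<eta>\<in>A. indicator {\<eta>} \<zeta> :: real)"
      using assms by (simp add: indicator_def)
  qed
  then show ?thesis by (simp only: law_def semigroup_sum[OF assms])
qed

end

subsection \<open>The Wilson function\<close>

definition root1 :: "nat \<Rightarrow> complex" where
  "root1 k = cis (2 * pi / real k)"

text \<open>Decay rate of the first Fourier mode for the random walk on a cycle of \<open>k\<close>
  sites that jumps at rate 1/2 in each direction.\<close>

definition gap :: "nat \<Rightarrow> real" where
  "gap k = 1 - cos (2 * pi / real k)"

text \<open>Up to a phase there is only one \<open>e\<close> with this property.  The freedom of choosing the phase makes
  all bonds of the circle look alike, including the one from \<open>N - 1\<close> to \<open>0\<close>.\<close>

definition height :: "nat \<Rightarrow> nat \<Rightarrow> config \<Rightarrow> (int \<Rightarrow> complex) \<Rightarrow> bool" where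
  "height N k \<xi> e \<longleftrightarrow> (\<forall>x\<in>sites N. cmod (e x) = 1 \<and> e (right N x) = e x * root1 k ^ \<xi> (right N x))"

definition mode :: "nat \<Rightarrow> config \<Rightarrow> (int \<Rightarrow> complex) \<Rightarrow> complex" where
  "mode N \<xi> e = (\<Sum>x\<in>sites N. (1 - of_nat (\<xi> x)) * e x)"

text \<open>Contracting every pair \<open>01\<close> to one site puts the hole at \<open>x\<close> at the place given by
  the number of particles in \<open>[0, x]\<close>, modulo \<open>k\<close>.  A jump across the origin rotates
  all these places, so only the modulus of the Fourier mode is well behaved.\<close>

definition wilson :: "nat \<Rightarrow> nat \<Rightarrow> config \<Rightarrow> real" where
  "wilson N k \<xi> = (cmod (mode N \<xi> (\<lambda>x. root1 k ^ (\<Sum>y\<in>{0..x}. \<xi> y))))\<^sup>2"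

lemma cmod_root1 [simp]: "cmod (root1 k) = 1"
  by (simp add: root1_def)

lemma root1_power: "0 < k \<Longrightarrow> root1 k ^ k = 1"
  unfolding root1_def Complex.DeMoivre by simp

lemma root1_inverse: "cnj (root1 k) * root1 k = 1"
  by (simp add: root1_def cis_cnj cis_mult)

lemma root1_add_cnj: "root1 k + cnj (root1 k) = of_real (2 - 2 * gap k)"
  by (simp add: complex_eq_iff root1_def gap_def)

lemma cmod_cis_minus_1: "(cmod (cis a - 1))\<^sup>2 = 2 - 2 * cos a"
proof -
  have "(cmod (cis a - 1))\<^sup>2 = ((cos a)\<^sup>2 + (sin a)\<^sup>2) + 1 - 2 * cos a"
    unfolding cmod_power2 by (simp add: power2_eq_square algebra_simps)
  then show ?thesis by simp
qed

lemma cmod_root1_minus_1: "(cmod (root1 k - 1))\<^sup>2 = 2 * gap k"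
  by (simp add: root1_def cmod_cis_minus_1 gap_def)

lemma gap_bounds: "0 \<le> gap k" "gap k \<le> 2"
  using cos_le_one[of "2 * pi / k"] cos_ge_minus_one[of "2 * pi / k"] by (auto simp: gap_def)

text \<open>Going once around the circle multiplies the phase by \<open>root1 k ^ k = 1\<close>, so
  the relation also holds across the origin.\<close>

lemma height_canonical:
  assumes \<xi>: "\<xi> \<in> configs N k" and k: "0 < k"
  shows "height N k \<xi> (\<lambda>x. root1 k ^ (\<Sum>y\<in>{0..x}. \<xi> y))"
  unfolding height_def
proof (intro ballI conjI)
  fix x assume x: "x \<in> sites N"
  show "cmod (root1 k ^ (\<Sum>y\<in>{0..x}. \<xi> y)) = 1" by (simp add: norm_power)
  show "root1 k ^ (\<Sum>y\<in>{0..right N x}. \<xi> y) = root1 k ^ (\<Sum>y\<in>{0..x}. \<xi> y) * root1 k ^ \<xi> (right N x)"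
  proof (cases "x = int N - 1")
    case True
    then have "{0..x} = sites N" by (auto simp: sites_def)
    then have "(\<Sum>y\<in>{0..x}. \<xi> y) = k" using \<xi> by (simp add: configs_def)
    then show ?thesis using True x k by (simp add: right_eq root1_power)
  next
    case False
    then have "right N x = x + 1" "{0..x + 1} = insert (x + 1) {0..x}"
      using x by (auto simp: right_eq sites_def)
    then show ?thesis by (simp add: power_add)
  qed
qed

lemma height_unique:
  assumes e: "height N k \<xi> e" and e': "height N k \<xi> e'" and N: "0 < N"
  obtains c where "cmod c = 1" "\<And>x. x \<in> sites N \<Longrightarrow> e' x = c * e x"
proof -
  define c where "c = e' 0 / e 0"
  have 0: "0 \<in> sites N" using N by (simp add: sites_def)
  have n0: "cmod (e 0) = 1" "cmod (e' 0) = 1" using e e' 0 by (auto simp: height_def)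
  then have "e 0 \<noteq> 0" by auto
  have "int n \<in> sites N \<longrightarrow> e' (int n) = c * e (int n)" for n
  proof (induction n)
    case 0
    then show ?case using \<open>e 0 \<noteq> 0\<close> by (simp add: c_def)
  next
    case (Suc n)
    show ?case
    proof
      assume "int (Suc n) \<in> sites N"
      then have x: "int n \<in> sites N" and r: "right N (int n) = int (Suc n)" by (auto simp: sites_def right_def)
      have "e (int (Suc n)) = e (int n) * root1 k ^ \<xi> (int (Suc n))"
        "e' (int (Suc n)) = e' (int n) * root1 k ^ \<xi> (int (Suc n))"
        using e e' x r by (metis height_def)+
      then show "e' (int (Suc n)) = c * e (int (Suc n))" using Suc x by simp
    qed
  qed
  note * = this
  show ?thesis
  proof (rule that)
    show "cmod c = 1" by (simp add: c_def norm_divide n0)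
    show "e' x = c * e x" if "x \<in> sites N" for x
      using *[of "nat x"] that by (simp add: sites_def)
  qed
qed

text \<open>Two heights differ by a factor of modulus 1, which the squared modulus ignores. After a
  jump the function may thus be computed with whichever height is easiest to update.\<close>

lemma wilson_eq:
  assumes "\<xi> \<in> configs N k" "0 < k" "0 < N" "height N k \<xi> e"
  shows "wilson N k \<xi> = (cmod (mode N \<xi> e))\<^sup>2"
proof -
  obtain c where c: "cmod c = 1" "\<And>x. x \<in> sites N \<Longrightarrow> root1 k ^ (\<Sum>y\<in>{0..x}. \<xi> y) = c * e x"
    using height_unique[OF assms(4) height_canonical[OF assms(1,2)] assms(3)] by metis
  have "mode N \<xi> (\<lambda>x. root1 k ^ (\<Sum>y\<in>{0..x}. \<xi> y)) = c * mode N \<xi> e"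
    unfolding mode_def sum_distrib_left by (intro sum.cong refl) (simp add: c)
  then show ?thesis by (simp add: wilson_def norm_mult c)
qed

text \<open>The change of the mode when a free bond is exchanged. In the first branch the hole at
  \<open>right N x\<close> moves to \<open>x\<close>, where its new phase equals
  \<open>e (left N x)\<close>; in the second the hole moves from \<open>x\<close> to
  \<open>right N x\<close>, whose phase is unchanged.\<close>

definition step :: "nat \<Rightarrow> nat \<Rightarrow> config \<Rightarrow> (int \<Rightarrow> complex) \<Rightarrow> int \<Rightarrow> complex" where
  "step N k \<xi> e x = (if \<xi> x = 1 then e (left N x) - e (right N x) else e (right N x) - e x)"

text \<open>An exchange alters the number of particles passed only at \<open>x\<close>, so only the
  phase at \<open>x\<close> has to be updated. This is uniform in \<open>x\<close>, including the
  bond across the origin.\<close>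

lemma mode_move:
  assumes N: "4 \<le> N" "x \<in> sites N" and \<xi>: "\<xi> \<in> free N k x" and e: "height N k \<xi> e"
  defines "e' \<equiv> e(x := e (left N x) * root1 k ^ \<xi> (right N x))"
  shows "height N k (move N \<xi> x) e'" "mode N (move N \<xi> x) e' = mode N \<xi> e + step N k \<xi> e x"
proof -
  note d = sites_distinct[OF N]
  have G: "\<xi> \<in> ergodic_component N k" using \<xi> free_subset by blast
  have ex: "e x = e (left N x) * root1 k ^ \<xi> x" using e N by (metis height_def left_sites right_left)
  have er: "e (right N x) = e x * root1 k ^ \<xi> (right N x)" using e N by (simp add: height_def)
  have nl: "cmod (e z) = 1" if "z \<in> sites N" for z using e that by (simp add: height_def)
  have lx: "left N x \<noteq> x" using d N by (metis right_left)
  show "height N k (move N \<xi> x) e'"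
    unfolding height_def
  proof (intro ballI conjI)
    fix z assume z: "z \<in> sites N"
    show "cmod (e' z) = 1" using nl N z by (simp add: e'_def norm_mult norm_power)
    consider "z = x" | "z = left N x" | "z \<noteq> x" "z \<noteq> left N x" by blast
    then show "e' (right N z) = e' z * root1 k ^ move N \<xi> x (right N z)"
    proof cases
      case 1
      then show ?thesis using d er ex by (simp add: e'_def move_apply[OF N])
    next
      case 2
      then show ?thesis using lx N by (simp add: e'_def move_apply[OF N])
    next
      case 3
      then have "right N z \<noteq> x" "right N z \<noteq> right N x" using z N by auto
      then show ?thesis using 3 e z by (simp add: e'_def move_apply[OF N] height_def)
    qed
  qed
  let ?r = "right N x" and ?S = "sites N - {x, right N x}"
  have split: "(\<Sum>z\<in>sites N. g z) = g x + (g ?r + sum g ?S)" for g :: "int \<Rightarrow> complex"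
  proof -
    have "sites N = insert x (insert ?r ?S)" using N by auto
    then have "(\<Sum>z\<in>sites N. g z) = sum g (insert x (insert ?r ?S))" by (rule arg_cong)
    then show ?thesis using d by simp
  qed
  have rest: "(\<Sum>z\<in>?S. (1 - of_nat (move N \<xi> x z)) * e' z) = (\<Sum>z\<in>?S. (1 - of_nat (\<xi> z)) * e z)"
    by (intro sum.cong refl) (auto simp: move_apply[OF N] e'_def)
  have "mode N (move N \<xi> x) e' - mode N \<xi> e = (1 - of_nat (\<xi> ?r)) * (e (left N x) * root1 k ^ \<xi> ?r)
     + (1 - of_nat (\<xi> x)) * e ?r - (1 - of_nat (\<xi> x)) * e x - (1 - of_nat (\<xi> ?r)) * e ?r"
    unfolding mode_def split rest using d by (simp add: move_apply[OF N] e'_def)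
  also have "\<dots> = step N k \<xi> e x"
  proof -
    have "\<xi> x \<noteq> \<xi> ?r" using \<xi> by (simp add: free_def)
    with ergodic_01[OF G N(2)] ergodic_01[OF G right_sites[OF N(2)]]
    have "\<xi> x = 1 \<and> \<xi> ?r = 0 \<or> \<xi> x = 0 \<and> \<xi> ?r = 1" by auto
    then show ?thesis by (auto simp: step_def)
  qed
  finally show "mode N (move N \<xi> x) e' = mode N \<xi> e + step N k \<xi> e x" by (simp add: algebra_simps)
qed

text \<open>In both branches the old and new phases of the hole differ by exactly one factor
  \<open>root1 k\<close>, up to its direction.\<close>

lemma cmod_step:
  assumes N: "x \<in> sites N" and \<xi>: "\<xi> \<in> free N k x" and e: "height N k \<xi> e"
  shows "(cmod (step N k \<xi> e x))\<^sup>2 = 2 * gap k"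
proof -
  have G: "\<xi> \<in> ergodic_component N k" using \<xi> free_subset by blast
  have ex: "e x = e (left N x) * root1 k ^ \<xi> x" using e N by (metis height_def left_sites right_left)
  have er: "e (right N x) = e x * root1 k ^ \<xi> (right N x)" using e N by (simp add: height_def)
  have n: "cmod (e (left N x)) = 1" "cmod (e x) = 1" using e N by (simp_all add: height_def)
  have "\<xi> x \<noteq> \<xi> (right N x)" using \<xi> by (simp add: free_def)
  with ergodic_01[OF G N] ergodic_01[OF G right_sites[OF N]]
  consider "\<xi> x = 1" "\<xi> (right N x) = 0" | "\<xi> x = 0" "\<xi> (right N x) = 1" by auto
  then show ?thesis
  proof cases
    case 1
    then have "step N k \<xi> e x = - (e (left N x) * (root1 k - 1))" by (simp add: step_def er ex algebra_simps)
    then show ?thesis by (simp add: norm_mult n cmod_root1_minus_1 power_mult_distrib)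
  next
    case 2
    then have "step N k \<xi> e x = e x * (root1 k - 1)" by (simp add: step_def er algebra_simps)
    then show ?thesis by (simp add: norm_mult n cmod_root1_minus_1 power_mult_distrib)
  qed
qed

text \<open>The jumps that the exclusion rule blocks cancel in pairs: two holes at distance two block
  one another, and their forbidden jumps would change the mode by opposite amounts.\<close>

lemma sum_step:
  assumes N: "4 \<le> N" and \<xi>: "\<xi> \<in> ergodic_component N k" and e: "height N k \<xi> e"
  shows "(\<Sum>x\<in>sites N. if \<xi> \<in> free N k x then step N k \<xi> e x else 0) = - of_real (2 * gap k) * mode N \<xi> e"
proof -
  define h where "h = (\<lambda>x. 1 - of_nat (\<xi> x) :: complex)"
  have mode: "mode N \<xi> e = (\<Sum>x\<in>sites N. h x * e x)" by (simp add: mode_def h_def)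
  let ?l = "left N" and ?r = "right N" and ?w = "root1 k"
  have er: "e (?r x) = e x * ?w ^ \<xi> (?r x)" if "x \<in> sites N" for x using e that by (simp add: height_def)
  have el: "e x = e (?l x) * ?w ^ \<xi> x" if "x \<in> sites N" for x using er[of "?l x"] that by simp
  \<comment> \<open>The first term is a leftward jump of a hole at \<open>right N x\<close>, the
    second a rightward jump of a hole at \<open>x\<close>. The factor \<open>1 - h\<close> at
    distance two is the exclusion rule.\<close>
  have 1: "(if \<xi> \<in> free N k x then step N k \<xi> e x else 0)
     = h (?r x) * (1 - h (?l x)) * (e (?l x) - e (?r x)) + h x * (1 - h (?r (?r x))) * (e (?r x) - e x)"
    if x: "x \<in> sites N" for x
    using ergodic_01[OF \<xi> x] ergodic_01[OF \<xi> right_sites[OF x]] ergodic_01[OF \<xi> left_sites[OF x]]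
      ergodic_01[OF \<xi> right_sites[OF right_sites[OF x]]] \<xi>
      ergodic_right[OF \<xi> x] ergodic_right[OF \<xi> right_sites[OF x]] ergodic_left[OF \<xi> x]
    unfolding free_def step_def h_def by (elim disjE) simp_all
  have 2: "h y * (1 - h (?l (?l y))) * (e (?l (?l y)) - e y)
     = h y * (cnj ?w - 1) * e y - h y * h (?l (?l y)) * (e (?l (?l y)) - e y)" if y: "y \<in> sites N" for y
  proof (cases "\<xi> y = 0")
    case True
    then have "\<xi> (?l y) = 1" by (rule ergodic_left[OF \<xi> y])
    then have "e y = e (?l (?l y)) * ?w" using el[OF y] el[OF left_sites[OF y]] True by simp
    then have "cnj ?w * e y = e (?l (?l y)) * (cnj ?w * ?w)" by (simp add: mult_ac)
    then have "e (?l (?l y)) = cnj ?w * e y" by (simp add: root1_inverse)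
    then show ?thesis by (simp add: algebra_simps)
  next
    case False
    then have "h y = 0" using ergodic_01[OF \<xi> y] by (auto simp: h_def)
    then show ?thesis by simp
  qed
  have 3: "h x * (1 - h (?r (?r x))) * (e (?r x) - e x)
     = h x * (?w - 1) * e x - h (?r (?r x)) * h x * (e (?r x) - e x)" if x: "x \<in> sites N" for x
  proof (cases "\<xi> x = 0")
    case True
    then have "\<xi> (?r x) = 1" by (rule ergodic_right[OF \<xi> x])
    then have "e (?r x) = ?w * e x" using er[OF x] by (simp add: mult.commute)
    then show ?thesis by (simp add: algebra_simps)
  next
    case False
    then have "h x = 0" using ergodic_01[OF \<xi> x] by (auto simp: h_def)
    then show ?thesis by simp
  qed
  \<comment> \<open>A hole at \<open>y\<close> adds no phase, so \<open>e (left N y) = e y\<close>.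
    The two jumps by which holes at \<open>y\<close> and two sites to its left would approach each
    other therefore have opposite effects.\<close>
  have 4: "h y * h (?l (?l y)) * (e (?l (?l y)) - e y) + h y * h (?l (?l y)) * (e (?l y) - e (?l (?l y))) = 0"
    if y: "y \<in> sites N" for y
  proof (cases "\<xi> y = 0")
    case True
    then show ?thesis using el[OF y] by (simp add: algebra_simps)
  next
    case False
    then have "h y = 0" using ergodic_01[OF \<xi> y] by (auto simp: h_def)
    then show ?thesis by simp
  qed
  have "(\<Sum>x\<in>sites N. if \<xi> \<in> free N k x then step N k \<xi> e x else 0)
    = (\<Sum>x\<in>sites N. h (?r x) * (1 - h (?l x)) * (e (?l x) - e (?r x)))
      + (\<Sum>x\<in>sites N. h x * (1 - h (?r (?r x))) * (e (?r x) - e x))"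
    unfolding sum.distrib[symmetric] by (intro sum.cong refl 1)
  also have "(\<Sum>x\<in>sites N. h (?r x) * (1 - h (?l x)) * (e (?l x) - e (?r x)))
    = (\<Sum>y\<in>sites N. h y * (1 - h (?l (?l y))) * (e (?l (?l y)) - e y))"
    by (subst sum_left[symmetric]) simp
  also have "\<dots> = (\<Sum>y\<in>sites N. h y * (cnj ?w - 1) * e y) - (\<Sum>y\<in>sites N. h y * h (?l (?l y)) * (e (?l (?l y)) - e y))"
    unfolding sum_subtractf[symmetric] by (intro sum.cong refl 2)
  also have "(\<Sum>x\<in>sites N. h x * (1 - h (?r (?r x))) * (e (?r x) - e x))
    = (\<Sum>x\<in>sites N. h x * (?w - 1) * e x) - (\<Sum>x\<in>sites N. h (?r (?r x)) * h x * (e (?r x) - e x))"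
    unfolding sum_subtractf[symmetric] by (intro sum.cong refl 3)
  also have "(\<Sum>x\<in>sites N. h (?r (?r x)) * h x * (e (?r x) - e x))
    = (\<Sum>y\<in>sites N. h y * h (?l (?l y)) * (e (?l y) - e (?l (?l y))))"
    by (subst sum_left[symmetric], subst sum_left[symmetric]) simp
  finally have "(\<Sum>x\<in>sites N. if \<xi> \<in> free N k x then step N k \<xi> e x else 0)
    = (\<Sum>y\<in>sites N. h y * (cnj ?w - 1) * e y) + (\<Sum>x\<in>sites N. h x * (?w - 1) * e x)
      - (\<Sum>y\<in>sites N. h y * h (?l (?l y)) * (e (?l (?l y)) - e y) + h y * h (?l (?l y)) * (e (?l y) - e (?l (?l y))))"
    by (simp add: sum.distrib)
  also have "\<dots> = (\<Sum>y\<in>sites N. h y * (cnj ?w - 1) * e y) + (\<Sum>x\<in>sites N. h x * (?w - 1) * e x)"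
    using 4 by simp
  also have "\<dots> = ((?w + cnj ?w) - 2) * mode N \<xi> e"
    unfolding mode sum.distrib[symmetric] sum_distrib_left
    by (intro sum.cong refl) (simp add: algebra_simps)
  also have "?w + cnj ?w - 2 = - of_real (2 * gap k)" unfolding root1_add_cnj by simp
  finally show ?thesis .
qed

lemma cmod_add_sq: "(cmod (a + b))\<^sup>2 = (cmod a)\<^sup>2 + 2 * Re (cnj a * b) + (cmod b)\<^sup>2"
  unfolding cmod_power2 by (simp add: power2_eq_square algebra_simps)

definition num_free :: "nat \<Rightarrow> nat \<Rightarrow> config \<Rightarrow> nat" where
  "num_free N k \<xi> = card {x\<in>sites N. \<xi> \<in> free N k x}"

lemma num_free_le: "num_free N k \<xi> \<le> N"
  unfolding num_free_def using card_mono[of "sites N" "{x\<in>sites N. \<xi> \<in> free N k x}"] by auto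

context
  fixes N k :: nat
  assumes N: "4 \<le> N" and k: "0 < k"
begin

lemma wilson_move:
  assumes x: "x \<in> sites N" and \<xi>: "\<xi> \<in> free N k x" and e: "height N k \<xi> e"
  shows "wilson N k (move N \<xi> x) - wilson N k \<xi> = 2 * Re (cnj (mode N \<xi> e) * step N k \<xi> e x) + 2 * gap k"
proof -
  have c: "\<xi> \<in> configs N k" "move N \<xi> x \<in> configs N k"
    using \<xi> move_free[OF N x \<xi>] free_subset ergodic_subset by blast+
  have "wilson N k (move N \<xi> x) = (cmod (mode N \<xi> e + step N k \<xi> e x))\<^sup>2"
    using wilson_eq[OF c(2) k _ mode_move(1)[OF N x \<xi> e]] mode_move(2)[OF N x \<xi> e] N by simp
  moreover have "wilson N k \<xi> = (cmod (mode N \<xi> e))\<^sup>2" using wilson_eq[OF c(1) k _ e] N by simp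
  ultimately show ?thesis by (simp add: cmod_add_sq cmod_step[OF x \<xi> e])
qed

text \<open>At rate 1/2 per free bond, the cross terms add up by \<open>sum_step\<close> to
  \<open>- 2 * gap k\<close> times the squared modulus, and the squared step contributes
  \<open>gap k\<close> for every free bond.\<close>

lemma generator_wilson:
  assumes \<xi>: "\<xi> \<in> ergodic_component N k"
  shows "generator N (wilson N k) \<xi> = - (2 * gap k) * wilson N k \<xi> + gap k * num_free N k \<xi>"
proof -
  have c: "\<xi> \<in> configs N k" using \<xi> ergodic_subset by blast
  obtain e where e: "height N k \<xi> e" using height_canonical[OF c k] by blast
  let ?\<Phi> = "mode N \<xi> e"
  have F: "wilson N k \<xi> = (cmod ?\<Phi>)\<^sup>2" using wilson_eq[OF c k _ e] N by simp
  have "generator N (wilson N k) \<xi> = (\<Sum>x\<in>sites N. Re (cnj ?\<Phi> * (if \<xi> \<in> free N k x then step N k \<xi> e x else 0))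
      + (if \<xi> \<in> free N k x then gap k else 0))"
    unfolding generator_ergodic[OF \<xi>] by (intro sum.cong refl) (simp add: wilson_move[OF _ _ e])
  also have "\<dots> = Re (cnj ?\<Phi> * (\<Sum>x\<in>sites N. if \<xi> \<in> free N k x then step N k \<xi> e x else 0)) + gap k * num_free N k \<xi>"
  proof -
    have "(\<Sum>x\<in>sites N. if \<xi> \<in> free N k x then gap k else 0) = gap k * num_free N k \<xi>"
      unfolding num_free_def by (subst sum.inter_filter[symmetric]) (simp_all add: mult.commute)
    then show ?thesis unfolding sum.distrib sum_distrib_left Re_sum by simp
  qed
  also have "cnj ?\<Phi> * (\<Sum>x\<in>sites N. if \<xi> \<in> free N k x then step N k \<xi> e x else 0)
     = of_real (- (2 * gap k)) * (?\<Phi> * cnj ?\<Phi>)"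
    unfolding sum_step[OF N \<xi> e] by (simp add: mult_ac)
  also have "?\<Phi> * cnj ?\<Phi> = of_real (wilson N k \<xi>)" unfolding F by (rule complex_norm_square[symmetric])
  also have "Re (of_real (- (2 * gap k)) * of_real (wilson N k \<xi>)) = - (2 * gap k) * wilson N k \<xi>" by simp
  finally show ?thesis .
qed

lemma wilson_nonneg: "wilson N k \<xi> \<ge> 0"
  by (simp add: wilson_def)

text \<open>The generator of a square is \<open>2 * F\<close> times the generator of
  \<open>F\<close> plus the quadratic variation. The drift contributes 2 to the coefficient 10, and
  the quadratic variation contributes 8: a squared increment is at most
  \<open>16 * gap k * F + 8 * (gap k)^2\<close>, at rate 1/2 on at most \<open>N\<close>
  bonds.\<close>

lemma generator_wilson_sq:
  assumes \<xi>: "\<xi> \<in> ergodic_component N k"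
  shows "generator N (\<lambda>\<xi>. (wilson N k \<xi>)\<^sup>2) \<xi>
    \<le> - (4 * gap k) * (wilson N k \<xi>)\<^sup>2 + 10 * gap k * N * wilson N k \<xi> + 4 * N * (gap k)\<^sup>2"
proof -
  have c: "\<xi> \<in> configs N k" using \<xi> ergodic_subset by blast
  obtain e where e: "height N k \<xi> e" using height_canonical[OF c k] by blast
  let ?\<Phi> = "mode N \<xi> e" and ?F = "wilson N k"
  have F: "?F \<xi> = (cmod ?\<Phi>)\<^sup>2" using wilson_eq[OF c k _ e] N by simp
  note g0 = gap_bounds(1)[of k]
  have sq: "(?F (move N \<xi> x) - ?F \<xi>)\<^sup>2 \<le> 16 * gap k * ?F \<xi> + 8 * (gap k)\<^sup>2"
    if x: "x \<in> sites N" and f: "\<xi> \<in> free N k x" for x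
  proof -
    define a where "a = Re (cnj ?\<Phi> * step N k \<xi> e x)"
    have "a\<^sup>2 \<le> (cmod (cnj ?\<Phi> * step N k \<xi> e x))\<^sup>2"
      unfolding a_def by (metis abs_Re_le_cmod abs_ge_zero power2_abs power_mono)
    also have "\<dots> = 2 * gap k * ?F \<xi>" by (simp add: norm_mult power_mult_distrib cmod_step[OF x f e] F)
    finally have a: "a\<^sup>2 \<le> 2 * gap k * ?F \<xi>" .
    have "(?F (move N \<xi> x) - ?F \<xi>)\<^sup>2 = (2 * a + 2 * gap k)\<^sup>2"
      by (simp add: wilson_move[OF x f e] a_def)
    also have "\<dots> \<le> 8 * a\<^sup>2 + 8 * (gap k)\<^sup>2"
      using zero_le_power2[of "2 * a - 2 * gap k"] by (simp add: power2_eq_square algebra_simps)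
    finally show ?thesis using a by simp
  qed
  have "generator N (\<lambda>\<xi>. (?F \<xi>)\<^sup>2) \<xi> = (\<Sum>x\<in>sites N. 2 * ?F \<xi> * (if \<xi> \<in> free N k x then 1 / 2 * (?F (move N \<xi> x) - ?F \<xi>) else 0)
      + (if \<xi> \<in> free N k x then 1 / 2 * (?F (move N \<xi> x) - ?F \<xi>)\<^sup>2 else 0))"
    unfolding generator_ergodic[OF \<xi>] by (intro sum.cong refl) (simp add: power2_eq_square algebra_simps)
  also have "\<dots> = 2 * ?F \<xi> * generator N ?F \<xi> + (\<Sum>x\<in>sites N. if \<xi> \<in> free N k x then 1 / 2 * (?F (move N \<xi> x) - ?F \<xi>)\<^sup>2 else 0)"
    unfolding sum.distrib generator_ergodic[OF \<xi>] sum_distrib_left by simp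
  also have "\<dots> \<le> 2 * ?F \<xi> * (- (2 * gap k) * ?F \<xi> + gap k * N) + (\<Sum>x\<in>sites N. 8 * gap k * ?F \<xi> + 4 * (gap k)\<^sup>2)"
  proof (intro add_mono mult_left_mono sum_mono)
    show "generator N ?F \<xi> \<le> - (2 * gap k) * ?F \<xi> + gap k * N"
      unfolding generator_wilson[OF \<xi>] using num_free_le[of N k \<xi>] g0 by (intro add_left_mono mult_left_mono) auto
    fix x assume x: "x \<in> sites N"
    show "(if \<xi> \<in> free N k x then 1 / 2 * (?F (move N \<xi> x) - ?F \<xi>)\<^sup>2 else 0) \<le> 8 * gap k * ?F \<xi> + 4 * (gap k)\<^sup>2"
      using sq[OF x] g0 wilson_nonneg[of \<xi>] by (auto intro!: add_nonneg_nonneg mult_nonneg_nonneg)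
  qed (use wilson_nonneg in simp)
  also have "\<dots> = - (4 * gap k) * (?F \<xi>)\<^sup>2 + 10 * gap k * N * ?F \<xi> + 4 * N * (gap k)\<^sup>2"
    by (simp add: power2_eq_square algebra_simps)
  finally show ?thesis .
qed

text \<open>Under the invariant distribution the generator has mean 0, so the decay term balances
  the noise term, which is at most \<open>gap k * N\<close>.\<close>

lemma sum_wilson: "(\<Sum>\<xi>\<in>ergodic_component N k. wilson N k \<xi>) \<le> N * card (ergodic_component N k) / 2"
  if "gap k > 0"
proof -
  let ?G = "ergodic_component N k"
  have "0 = (\<Sum>\<xi>\<in>?G. generator N (wilson N k) \<xi>)" by (simp add: sum_generator[OF N])
  also have "\<dots> = (\<Sum>\<xi>\<in>?G. - (2 * gap k) * wilson N k \<xi> + gap k * num_free N k \<xi>)"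
    by (intro sum.cong refl generator_wilson)
  also have "\<dots> \<le> (\<Sum>\<xi>\<in>?G. - (2 * gap k) * wilson N k \<xi> + gap k * N)"
    using num_free_le that by (intro sum_mono add_left_mono mult_left_mono) auto
  also have "\<dots> = gap k * (N * card ?G - 2 * (\<Sum>\<xi>\<in>?G. wilson N k \<xi>))"
    by (simp add: sum_subtractf sum_distrib_left[symmetric] algebra_simps)
  finally show ?thesis using that by (simp add: zero_le_mult_iff)
qed

text \<open>The event \<open>B\<close> that the Wilson function is at least \<open>A / 2\<close>
  separates the two distributions: Chebyshev makes it likely at time \<open>t\<close>, Markov
  unlikely in equilibrium. These two errors give \<open>20 + 1 = 21\<close>.\<close>

lemma worst_dist_lower_bound:
  assumes \<xi>: "\<xi> \<in> ergodic_component N k" and gap: "gap k > 0" and t: "t \<ge> 0"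
  defines "A \<equiv> exp (- (2 * gap k) * t) * wilson N k \<xi>"
  assumes A: "A > 0"
  shows "worst_dist N k t \<ge> 1 - 21 * real N / A - 8 * real N / A\<^sup>2"
proof -
  let ?F = "wilson N k" and ?G = "ergodic_component N k" and ?P = "\<lambda>f. semigroup N t f \<xi>"
  note lin = semigroup_add[OF N \<xi>] semigroup_cmult[OF N \<xi>] semigroup_const[OF N \<xi>]
  define m where "m = ?P ?F"
  have mA: "m \<ge> A"
  proof -
    \<comment> \<open>Applying the upper Gronwall bound to the negated function yields a lower
      bound; dropping the noise term is allowed because it is nonnegative.\<close>
    have "?P (\<lambda>\<zeta>. (-1) * ?F \<zeta>) \<le> exp (- (2 * gap k) * t) * ((-1) * ?F \<xi> - 0 / (2 * gap k)) + 0 / (2 * gap k)"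
    proof (rule semigroup_gronwall[OF N \<xi> t])
      fix \<zeta> assume \<zeta>: "\<zeta> \<in> ?G"
      show "generator N (\<lambda>\<zeta>. (-1) * ?F \<zeta>) \<zeta> \<le> - (2 * gap k) * ((-1) * ?F \<zeta>) + 0"
        unfolding generator_cmult generator_wilson[OF \<zeta>] using gap by simp
    qed (use gap in simp)
    then show ?thesis unfolding lin by (simp add: m_def A_def)
  qed
  have m0: "m > 0" using mA A by linarith
  \<comment> \<open>The coefficient 5 solves \<open>10 + 2 * s = 4 * s\<close>: the combination with
    \<open>- s * N * F\<close> then satisfies a drift inequality with rate \<open>4 * gap k\<close>
    and no remaining linear term.\<close>
  have "?P (\<lambda>\<zeta>. (?F \<zeta>)\<^sup>2 + (- 5 * N) * ?F \<zeta>)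
    \<le> exp (- (4 * gap k) * t) * ((?F \<xi>)\<^sup>2 + (- 5 * N) * ?F \<xi> - (4 * N * (gap k)\<^sup>2) / (4 * gap k)) + (4 * N * (gap k)\<^sup>2) / (4 * gap k)"
  proof (rule semigroup_gronwall[OF N \<xi> t])
    fix \<zeta> assume \<zeta>: "\<zeta> \<in> ?G"
    have "gap k * num_free N k \<zeta> \<ge> 0" using gap by simp
    then have "5 * N * (gap k * num_free N k \<zeta>) \<ge> 0" by simp
    then show "generator N (\<lambda>\<zeta>. (?F \<zeta>)\<^sup>2 + (- 5 * N) * ?F \<zeta>) \<zeta>
      \<le> - (4 * gap k) * ((?F \<zeta>)\<^sup>2 + (- 5 * N) * ?F \<zeta>) + 4 * N * (gap k)\<^sup>2"
      unfolding generator_add generator_cmult generator_wilson[OF \<zeta>]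
      using generator_wilson_sq[OF \<zeta>] by (simp add: algebra_simps)
  qed (use gap in simp)
  also have "\<dots> \<le> exp (- (4 * gap k) * t) * (?F \<xi>)\<^sup>2 + N * gap k"
  proof -
    have "(4 * N * (gap k)\<^sup>2) / (4 * gap k) = N * gap k" using gap by (simp add: power2_eq_square)
    moreover have "- 5 * N * ?F \<xi> \<le> 0" "N * gap k \<ge> 0" using wilson_nonneg[of \<xi>] gap by simp_all
    ultimately show ?thesis by (intro add_mono mult_left_mono) auto
  qed
  also have "exp (- (4 * gap k) * t) * (?F \<xi>)\<^sup>2 = A\<^sup>2"
    by (simp add: A_def power_mult_distrib exp_double[symmetric])
  finally have sq: "?P (\<lambda>\<zeta>. (?F \<zeta>)\<^sup>2) \<le> A\<^sup>2 + N * gap k + 5 * N * m"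
    unfolding lin m_def by simp
  define B where "B = {\<eta>\<in>?G. ?F \<eta> \<ge> A / 2}"
  have finB: "finite B" by (simp add: B_def)
  have BC: "B \<subseteq> configs N k" using ergodic_subset by (auto simp: B_def)
  have lawB: "(\<Sum>\<eta>\<in>B. law N t \<xi> \<eta>) \<ge> 1 - 20 * real N / A - 8 * real N / A\<^sup>2"
  proof -
    \<comment> \<open>Chebyshev's inequality in operator form: the polynomial is
      \<open>1 - 4 * (F - m)^2 / m^2\<close>, which lies below the indicator of \<open>B\<close>
      because outside \<open>B\<close> one has \<open>F < A / 2 \<le> m / 2\<close>.\<close>
    have "?P (\<lambda>\<zeta>. (- 4 / m\<^sup>2) * (?F \<zeta>)\<^sup>2 + ((8 / m) * ?F \<zeta> + (- 3))) \<le> ?P (indicator B)"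
    proof (rule semigroup_mono[OF N \<xi> t])
      fix \<zeta> assume \<zeta>: "\<zeta> \<in> ?G"
      have eq: "(- 4 / m\<^sup>2) * (?F \<zeta>)\<^sup>2 + ((8 / m) * ?F \<zeta> + (- 3)) = 1 - 4 * (?F \<zeta> - m)\<^sup>2 / m\<^sup>2"
        using m0 by (simp add: field_simps power2_eq_square)
      show "(- 4 / m\<^sup>2) * (?F \<zeta>)\<^sup>2 + ((8 / m) * ?F \<zeta> + (- 3)) \<le> indicator B \<zeta>"
      proof (cases "\<zeta> \<in> B")
        case False
        then have "m / 2 \<le> m - ?F \<zeta>" using \<zeta> mA by (simp add: B_def)
        then have "(m / 2)\<^sup>2 \<le> (m - ?F \<zeta>)\<^sup>2" using m0 by (intro power_mono) auto
        then have "1 \<le> 4 * (?F \<zeta> - m)\<^sup>2 / m\<^sup>2" using m0 by (simp add: power2_commute power_divide field_simps)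
        then show ?thesis unfolding eq using False by simp
      next
        case True
        then show ?thesis unfolding eq by simp
      qed
    qed
    also have "?P (indicator B) = (\<Sum>\<eta>\<in>B. law N t \<xi> \<eta>)" by (rule semigroup_indicator[OF N \<xi> finB, symmetric])
    finally have "(- 4 / m\<^sup>2) * ?P (\<lambda>\<zeta>. (?F \<zeta>)\<^sup>2) + 5 \<le> (\<Sum>\<eta>\<in>B. law N t \<xi> \<eta>)"
      unfolding lin using m0 by (simp add: m_def)
    moreover have "(4 / m\<^sup>2) * ?P (\<lambda>\<zeta>. (?F \<zeta>)\<^sup>2) \<le> 4 + 20 * real N / A + 8 * real N / A\<^sup>2"
    proof -
      have "?P (\<lambda>\<zeta>. (?F \<zeta>)\<^sup>2) \<le> m\<^sup>2 + 5 * N * m + 2 * N"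
        using sq power_mono[OF mA, of 2] A mult_left_mono[OF gap_bounds(2)[of k], of "real N"] by simp
      then have "(4 / m\<^sup>2) * ?P (\<lambda>\<zeta>. (?F \<zeta>)\<^sup>2) \<le> (4 / m\<^sup>2) * (m\<^sup>2 + 5 * N * m + 2 * N)"
        by (rule mult_left_mono) simp
      also have "\<dots> = 4 + 20 * real N / m + 8 * real N / m\<^sup>2" using m0 by (simp add: field_simps power2_eq_square)
      also have "\<dots> \<le> 4 + 20 * real N / A + 8 * real N / A\<^sup>2"
        using mA A m0 by (intro add_mono divide_left_mono power_mono mult_pos_pos) auto
      finally show ?thesis .
    qed
    ultimately show ?thesis by simp
  qed
  \<comment> \<open>Markov's inequality at level \<open>A / 2\<close>, with the equilibrium mean at
    most \<open>N / 2\<close>.\<close>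
  have nuB: "measure_pmf.prob (equilibrium N k) B \<le> N / A"
  proof -
    have G0: "card ?G > 0" using \<xi> by (auto simp: card_gt_0_iff)
    have "A / 2 * card B = (\<Sum>\<eta>\<in>B. A / 2)" by simp
    also have "\<dots> \<le> (\<Sum>\<eta>\<in>B. ?F \<eta>)" by (rule sum_mono) (simp add: B_def)
    also have "\<dots> \<le> (\<Sum>\<eta>\<in>?G. ?F \<eta>)" by (rule sum_mono2) (auto simp: B_def wilson_nonneg)
    also have "\<dots> \<le> N * card ?G / 2" by (rule sum_wilson[OF gap])
    finally have "card B / card ?G \<le> N / A" using G0 A by (simp add: field_simps)
    moreover have "?G \<inter> B = B" by (auto simp: B_def)
    moreover have "?G \<noteq> {}" using \<xi> by auto
    ultimately show ?thesis by (simp add: equilibrium_def measure_pmf_of_set)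
  qed
  have "1 - 21 * real N / A - 8 * real N / A\<^sup>2 \<le> (\<Sum>\<eta>\<in>B. law N t \<xi> \<eta>) - measure_pmf.prob (equilibrium N k) B"
  proof -
    have "21 * real N / A = 20 * real N / A + N / A" by (simp add: add_divide_distrib[symmetric])
    then show ?thesis using lawB nuB by linarith
  qed
  also have "\<dots> \<le> \<bar>(\<Sum>\<eta>\<in>B. law N t \<xi> \<eta>) - measure_pmf.prob (equilibrium N k) B\<bar>" by simp
  also have "\<dots> \<le> tv_dist N k (law N t \<xi>) (equilibrium N k)"
    unfolding tv_dist_def by (rule Max_ge) (use BC in auto)
  also have "\<dots> \<le> worst_dist N k t"
    unfolding worst_dist_def by (rule Max_ge) (use \<xi> ergodic_subset in auto)
  finally show ?thesis .
qed

end

subsection \<open>The initial configuration and the two bounds\<close>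

definition packed :: "nat \<Rightarrow> nat \<Rightarrow> config" where
  "packed N h = restrict (\<lambda>x. if even x \<and> x < 2 * int h then 0 else 1) (sites N)"

lemma holes_eq: "{x. 0 \<le> x \<and> even x \<and> x < 2 * int h} = (\<lambda>j. 2 * int j) ` {..<h}"
proof (intro equalityI subsetI)
  fix x assume "x \<in> {x. 0 \<le> x \<and> even x \<and> x < 2 * int h}"
  then have "x = 2 * int (nat (x div 2))" "nat (x div 2) < h" by auto
  then show "x \<in> (\<lambda>j. 2 * int j) ` {..<h}" by blast
qed auto

lemma sum_holes_packed:
  fixes g :: "int \<Rightarrow> 'a::comm_monoid_add"
  assumes "2 * h < N"
  shows "(\<Sum>x\<in>sites N. if packed N h x = 0 then g x else 0) = (\<Sum>j<h. g (2 * int j))"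
proof -
  have "(\<Sum>x\<in>sites N. if packed N h x = 0 then g x else 0) = (\<Sum>x\<in>{x\<in>sites N. packed N h x = 0}. g x)"
    by (subst sum.inter_filter[symmetric]) auto
  also have "{x\<in>sites N. packed N h x = 0} = (\<lambda>j. 2 * int j) ` {..<h}"
    unfolding holes_eq[symmetric] using assms by (auto simp: packed_def sites_def split: if_splits)
  also have "(\<Sum>x\<in>(\<lambda>j. 2 * int j) ` {..<h}. g x) = (\<Sum>j<h. g (2 * int j))"
    by (subst sum.reindex) (auto simp: inj_on_def)
  finally show ?thesis .
qed

lemma packed_ergodic:
  assumes h: "2 * h < N"
  shows "packed N h \<in> ergodic_component N (N - h)"
proof -
  have "(\<Sum>x\<in>sites N. packed N h x) + (\<Sum>x\<in>sites N. if packed N h x = 0 then 1 else 0) = (\<Sum>x\<in>sites N. 1)"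
    unfolding sum.distrib[symmetric] by (intro sum.cong refl) (auto simp: packed_def)
  then have "(\<Sum>x\<in>sites N. packed N h x) = N - h" unfolding sum_holes_packed[OF h] by simp
  moreover have "packed N h \<in> sites N \<rightarrow>\<^sub>E {0, 1}" by (auto simp: packed_def)
  moreover have "1 \<le> packed N h x + packed N h (right N x)" if x: "x \<in> sites N" for x
  proof (cases "packed N h x = 0")
    case True
    then have "even x" "x < 2 * int h" using x by (auto simp: packed_def split: if_splits)
    moreover from this have "right N x = x + 1" using x h by (auto simp: right_eq)
    ultimately show ?thesis using right_sites[OF x] by (simp add: packed_def)
  qed simp
  ultimately show ?thesis by (simp add: ergodic_component_def configs_def)
qed

lemma packed_prefix:
  assumes h: "2 * h < N" and "j < h"
  shows "(\<Sum>y\<in>{0..2 * int j}. packed N h y) = j"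
  using assms(2)
proof (induction j)
  case 0
  then show ?case using h by (simp add: packed_def sites_def)
next
  case (Suc j)
  have "{0..2 * int (Suc j)} = insert (2 * int j + 2) (insert (2 * int j + 1) {0..2 * int j})" by auto
  moreover have "packed N h (2 * int j + 2) = 0" "packed N h (2 * int j + 1) = 1"
    using Suc.prems h by (auto simp: packed_def sites_def)
  ultimately show ?case using Suc by simp
qed

lemma gap_eq: "gap k = 2 * (sin (pi / k))\<^sup>2"
  using cos_double_sin[of "pi / k"] by (simp add: gap_def)

lemma gap_pos: "2 \<le> k \<Longrightarrow> 0 < gap k"
  using sin_gt_zero[of "pi / k"] by (simp add: gap_eq field_simps)

lemma gap_le: "gap k \<le> 2 * pi\<^sup>2 / (real k)\<^sup>2"
proof -
  have "\<bar>sin (pi / k)\<bar>\<^sup>2 \<le> \<bar>pi / k\<bar>\<^sup>2" by (intro power_mono abs_sin_x_le_abs_x) simp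
  then show ?thesis by (simp add: gap_eq power_divide)
qed

text \<open>The hole at site \<open>2 * j\<close> is preceded by \<open>j\<close> particles, so
  after contraction the holes occupy consecutive places and the mode is a geometric sum of powers of
  \<open>root1 k\<close>. Dividing by \<open>gap k\<close> gives order \<open>N^2\<close> as long as
  \<open>h / k\<close> stays away from 0 and 1.\<close>

lemma wilson_packed:
  assumes h: "2 * h < N" and k: "k = N - h" "2 \<le> k"
  shows "wilson N k (packed N h) = (1 - cos (2 * pi * h / k)) / gap k"
proof -
  let ?w = "root1 k"
  have "(\<Sum>x\<in>sites N. (1 - of_nat (packed N h x)) * ?w ^ (\<Sum>y\<in>{0..x}. packed N h y))
    = (\<Sum>x\<in>sites N. if packed N h x = 0 then ?w ^ (\<Sum>y\<in>{0..x}. packed N h y) else 0)"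
    by (intro sum.cong refl) (auto simp: packed_def)
  also have "\<dots> = (\<Sum>j<h. ?w ^ j)"
    unfolding sum_holes_packed[OF h] by (intro sum.cong refl) (simp add: packed_prefix[OF h])
  finally have m: "wilson N k (packed N h) = (cmod (\<Sum>j<h. ?w ^ j))\<^sup>2" by (simp add: wilson_def mode_def)
  have g: "gap k > 0" using gap_pos k by simp
  have "(?w - 1) * (\<Sum>j<h. ?w ^ j) = ?w ^ h - 1" by (rule power_diff_1_eq[symmetric])
  then have "(cmod (?w - 1))\<^sup>2 * (cmod (\<Sum>j<h. ?w ^ j))\<^sup>2 = (cmod (?w ^ h - 1))\<^sup>2"
    by (metis norm_mult power_mult_distrib)
  also have "?w ^ h = cis (2 * pi * h / k)" unfolding root1_def Complex.DeMoivre by (simp add: mult.commute)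
  finally have "2 * gap k * (cmod (\<Sum>j<h. ?w ^ j))\<^sup>2 = 2 - 2 * cos (2 * pi * h / k)"
    by (simp only: cmod_root1_minus_1 cmod_cis_minus_1)
  then show ?thesis unfolding m using g by (simp add: field_simps)
qed

section \<open>Bounds for finite systems and the limit\<close>

lemma mixing_time_lower_bound:
  fixes a :: real
  assumes N: "4 \<le> N" and k: "k < N" "N < 2 * k" and c: "c \<le> 1 - cos (2 * pi * (N - k) / k)" "0 < c"
  defines "a \<equiv> c * (real N)\<^sup>2 / (8 * pi\<^sup>2) / sqrt N"
  assumes \<epsilon>: "\<epsilon> < 1 - 21 * real N / a - 8 * real N / a\<^sup>2"
  shows "mixing_time N k \<epsilon> \<ge> ereal ((real N)\<^sup>2 * ln N / (32 * pi\<^sup>2))"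
proof -
  define h where "h = N - k"
  have h: "2 * h < N" "k = N - h" "2 \<le> k" using N k by (auto simp: h_def)
  let ?\<xi> = "packed N h"
  have \<xi>: "?\<xi> \<in> ergodic_component N k" using packed_ergodic[OF h(1)] h(2) by simp
  have g: "gap k > 0" using gap_pos h by simp
  have gN: "gap k \<le> 8 * pi\<^sup>2 / (real N)\<^sup>2"
  proof -
    have "(real N)\<^sup>2 \<le> (2 * real k)\<^sup>2" using k by (intro power_mono) auto
    then have "2 * pi\<^sup>2 / (real k)\<^sup>2 \<le> 8 * pi\<^sup>2 / (real N)\<^sup>2"
      using N k by (simp add: field_simps)
    then show ?thesis using gap_le[of k] by linarith
  qed
  have W: "wilson N k ?\<xi> \<ge> c * (real N)\<^sup>2 / (8 * pi\<^sup>2)"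
  proof -
    have "c * (real N)\<^sup>2 / (8 * pi\<^sup>2) = c / (8 * pi\<^sup>2 / (real N)\<^sup>2)" by simp
    also have "\<dots> \<le> c / gap k" using gN g c N by (intro divide_left_mono mult_pos_pos) auto
    also have "\<dots> \<le> (1 - cos (2 * pi * h / k)) / gap k"
      using c g k by (intro divide_right_mono) (auto simp: h_def of_nat_diff)
    also have "\<dots> = wilson N k ?\<xi>" by (rule wilson_packed[OF h, symmetric])
    finally show ?thesis .
  qed
  have a0: "a > 0" using c N by (simp add: a_def)
  \<comment> \<open>The time limit is chosen so that the exponent \<open>2 * gap k * t\<close> is at
    most \<open>ln N / 2\<close>. The initial value thus loses at most a factor
    \<open>sqrt N\<close>, which is the one built into \<open>a\<close>.\<close>
  have far: "\<epsilon> < worst_dist N k t" if t: "0 \<le> t" "t < (real N)\<^sup>2 * ln N / (32 * pi\<^sup>2)" for t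
  proof -
    let ?A = "exp (- (2 * gap k) * t) * wilson N k ?\<xi>"
    have "2 * gap k * t \<le> 2 * (8 * pi\<^sup>2 / (real N)\<^sup>2) * ((real N)\<^sup>2 * ln N / (32 * pi\<^sup>2))"
      using t gN g by (intro mult_mono) auto
    also have "\<dots> = ln N / 2" using N by simp
    finally have "exp (- (2 * gap k) * t) \<ge> exp (- (ln N / 2))" by simp
    also have "exp (- (ln N / 2)) = 1 / sqrt N" using N
      by (simp add: ln_sqrt[symmetric] exp_minus inverse_eq_divide)
    finally have "(1 / sqrt N) * (c * (real N)\<^sup>2 / (8 * pi\<^sup>2)) \<le> ?A"
      by (rule mult_mono[OF _ W]) (use c in auto)
    then have A: "a \<le> ?A" by (simp add: a_def mult.commute)
    have A0: "?A > 0" using A a0 by linarith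
    have "\<epsilon> < 1 - 21 * real N / a - 8 * real N / a\<^sup>2" by (rule \<epsilon>)
    also have "\<dots> \<le> 1 - 21 * real N / ?A - 8 * real N / ?A\<^sup>2"
    proof -
      have "1 - 21 * n / a - 8 * n / a\<^sup>2 \<le> 1 - 21 * n / b - 8 * n / b\<^sup>2" if "a \<le> b" "0 \<le> n" for b n
        using that a0 by (intro diff_mono divide_left_mono power_mono order_refl mult_pos_pos) auto
      from this[OF A, of "real N"] show ?thesis by simp
    qed
    also have "\<dots> \<le> worst_dist N k t"
      by (rule worst_dist_lower_bound[OF N _ \<xi> g t(1) A0]) (use k in simp)
    finally show ?thesis .
  qed
  show ?thesis
    unfolding mixing_time_def
  proof (rule Inf_greatest)
    fix x assume "x \<in> ereal ` {t. 0 \<le> t \<and> worst_dist N k t \<le> \<epsilon>}"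
    then obtain t where "x = ereal t" "0 \<le> t" "worst_dist N k t \<le> \<epsilon>" by auto
    then show "ereal ((real N)\<^sup>2 * ln N / (32 * pi\<^sup>2)) \<le> x" using far[of t] by force
  qed
qed

text \<open>The denominator in \<open>log_sobolev_ergodic\<close> is at least
  \<open>\<delta>^3 * N^3\<close>, leaving \<open>N^2\<close>. The constant is
  \<open>288 = 72 * 4\<close>, with the 4 from \<open>energy_eq\<close>; normalization by the number
  of configurations cancels.\<close>

lemma log_sobolev_lower_bound:
  assumes N: "4 \<le> N" and k: "k < N" "N < 2 * k"
    and d: "\<delta> * N \<le> 2 * real k - N" "\<delta> * N \<le> real N - k" "0 < \<delta>"
  shows "log_sobolev N k \<ge> ereal (\<delta> ^ 3 / 288 / (real N)\<^sup>2)"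
proof -
  let ?G = "ergodic_component N k"
  have "2 * (N - k) < N" "N - (N - k) = k" using k by linarith+
  then have ne: "?G \<noteq> {}" using packed_ergodic[of "N - k" N] by auto
  then have G0: "real (card ?G) > 0" by (simp add: card_gt_0_iff)
  have "\<delta> ^ 3 / 288 / (real N)\<^sup>2 * Ent (equilibrium N k) (\<lambda>\<xi>. (f \<xi>)\<^sup>2) \<le> dirichlet_form N k f" for f
  proof -
    let ?e = "entr ?G (\<lambda>\<xi>. (f \<xi>)\<^sup>2)"
    have E0: "energy N k f \<ge> 0" unfolding energy_def by (intro sum_nonneg) auto
    have Ent: "Ent (equilibrium N k) (\<lambda>\<xi>. (f \<xi>)\<^sup>2) = ?e / card ?G"
      using ne by (simp add: Ent_def equilibrium_def integral_pmf_of_set entr_def diff_divide_distrib)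
    have Dir: "dirichlet_form N k f = energy N k f / 4 / card ?G"
    proof -
      have "dirichlet_form N k f = - (\<Sum>\<xi>\<in>?G. f \<xi> * generator N f \<xi>) / card ?G"
        using ne by (simp add: dirichlet_form_def equilibrium_def integral_pmf_of_set)
      then show ?thesis by (simp only: energy_eq[OF N])
    qed
    have "real (2 * k - N) = 2 * real k - real N" "real (N - k) = real N - real k" using k by (simp_all add: of_nat_diff)
    then have "(\<delta> * N) ^ 2 * (\<delta> * N) \<le> real (2 * k - N) ^ 2 * real (N - k)"
      using d by (intro mult_mono power_mono) auto
    then have lower: "\<delta> ^ 3 * real N ^ 3 \<le> real (2 * k - N) ^ 2 * real (N - k)"
      by (simp add: power2_eq_square power3_eq_cube mult_ac)
    have "?e \<le> 72 * real N ^ 5 / (real (2 * k - N) ^ 2 * real (N - k)) * energy N k f"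
      by (rule log_sobolev_ergodic[OF N k])
    also have "\<dots> \<le> 72 * real N ^ 5 / (\<delta> ^ 3 * real N ^ 3) * energy N k f"
      using d N k by (intro mult_right_mono[OF divide_left_mono[OF lower]] E0) auto
    also have "\<dots> = 72 * (real N)\<^sup>2 / \<delta> ^ 3 * energy N k f"
      using N d by (simp add: field_simps eval_nat_numeral)
    finally have "\<delta> ^ 3 / 288 / (real N)\<^sup>2 * ?e \<le> \<delta> ^ 3 / 288 / (real N)\<^sup>2 * (72 * (real N)\<^sup>2 / \<delta> ^ 3 * energy N k f)"
      using d by (intro mult_left_mono) auto
    also have "\<dots> = energy N k f / 4" using N d by (simp add: field_simps)
    finally have "\<delta> ^ 3 / 288 / (real N)\<^sup>2 * ?e / card ?G \<le> energy N k f / 4 / card ?G"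
      by (rule divide_right_mono) simp
    then show ?thesis unfolding Ent Dir by simp
  qed
  then show ?thesis unfolding log_sobolev_def by (intro Sup_upper) auto
qed

theorem theorem2p3:
  fixes \<rho> :: real
  assumes "1 / 2 < \<rho>" and "\<rho> < 1"
  shows "(\<exists>C>0. \<forall>(\<epsilon>::real) (k :: nat \<Rightarrow> nat).
            0 < \<epsilon> \<longrightarrow> \<epsilon> < 1 \<longrightarrow> (\<forall>N\<ge>1. real (k N) > real N / 2) \<longrightarrow>
            (\<lambda>N. real (k N) / real N) \<longlonglongrightarrow> \<rho> \<longrightarrow>
            liminf (\<lambda>N. mixing_time N (k N) \<epsilon> / ereal ((real N)\<^sup>2 * ln (real N))) \<ge> ereal C)
       \<and> (\<forall>k :: nat \<Rightarrow> nat.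
            (\<forall>N\<ge>1. real (k N) > real N / 2) \<longrightarrow>
            (\<lambda>N. real (k N) / real N) \<longlonglongrightarrow> \<rho> \<longrightarrow>
            (\<exists>C'>0. \<forall>\<^sub>F N in sequentially. log_sobolev N (k N) \<ge> ereal (C' / (real N)\<^sup>2)))"
proof (intro conjI allI impI, rule exI[of _ "1 / (32 * pi\<^sup>2)"], intro conjI allI impI)
  show "1 / (32 * pi\<^sup>2) > 0" by simp
next
  fix \<epsilon> :: real and k :: "nat \<Rightarrow> nat"
  assume \<epsilon>: "0 < \<epsilon>" "\<epsilon> < 1" and half: "\<forall>N\<ge>1. real (k N) > real N / 2"
    and lim: "(\<lambda>N. real (k N) / real N) \<longlonglongrightarrow> \<rho>"
  \<comment> \<open>Half of the limit of \<open>1 - cos (r N)\<close>, so that \<open>c\<close> is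
    eventually a strict lower bound. The limit is positive because \<open>1 / 2 < \<rho> < 1\<close>
    puts \<open>pi * (1 / \<rho> - 1)\<close> strictly between 0 and \<open>pi\<close>.\<close>
  define c where "c = (1 - cos (2 * pi * (1 / \<rho> - 1))) / 2"
  define r where "r = (\<lambda>N. 2 * pi * (1 / (real (k N) / real N) - 1))"
  define a where "a = (\<lambda>N. c * (real N)\<^sup>2 / (8 * pi\<^sup>2) / sqrt N)"
  have c: "c > 0"
  proof -
    have "0 < pi * (1 / \<rho> - 1)" "pi * (1 / \<rho> - 1) < pi" using assms by (simp_all add: field_simps)
    then have "sin (pi * (1 / \<rho> - 1)) > 0" by (rule sin_gt_zero)
    moreover have "c = (sin (pi * (1 / \<rho> - 1)))\<^sup>2"
      using cos_double_sin[of "pi * (1 / \<rho> - 1)"] by (simp add: c_def mult.assoc)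
    ultimately show ?thesis by simp
  qed
  have "(\<lambda>N. 1 - cos (r N)) \<longlonglongrightarrow> 1 - cos (2 * pi * (1 / \<rho> - 1))"
    unfolding r_def using assms by (intro tendsto_intros lim) auto
  moreover have "c < 1 - cos (2 * pi * (1 / \<rho> - 1))" using c unfolding c_def by simp
  ultimately have e1: "\<forall>\<^sub>F N in sequentially. c < 1 - cos (r N)" by (rule order_tendstoD(1))
  have e2: "\<forall>\<^sub>F N in sequentially. real (k N) / real N < 1" using order_tendstoD(2)[OF lim assms(2)] .
  \<comment> \<open>\<open>a N\<close> grows like \<open>N^(3/2)\<close>, so both error terms vanish
    and every \<open>\<epsilon> < 1\<close> is eventually exceeded.\<close>
  have "(\<lambda>N. 1 - 21 * real N / a N - 8 * real N / (a N)\<^sup>2) \<longlonglongrightarrow> 1"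
    unfolding a_def using c by real_asymp
  then have e3: "\<forall>\<^sub>F N in sequentially. \<epsilon> < 1 - 21 * real N / a N - 8 * real N / (a N)\<^sup>2"
    using \<epsilon>(2) by (rule order_tendstoD(1))
  have "\<forall>\<^sub>F N in sequentially. ereal (1 / (32 * pi\<^sup>2)) \<le> mixing_time N (k N) \<epsilon> / ereal ((real N)\<^sup>2 * ln (real N))"
    using e1 e2 e3 eventually_ge_at_top[of 4]
  proof eventually_elim
    case (elim N)
    have "real N / 2 < real (k N)" using half elim(4) by simp
    then have k: "k N < N" "N < 2 * k N" using elim by auto
    then have "r N = 2 * pi * (real N - real (k N)) / real (k N)" 
      by (simp add: r_def diff_divide_distrib right_diff_distrib)
    then have "mixing_time N (k N) \<epsilon> \<ge> ereal ((real N)\<^sup>2 * ln N / (32 * pi\<^sup>2))"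
      using elim k c by (intro mixing_time_lower_bound[of N "k N" c]) (auto simp: a_def)
    moreover have "(real N)\<^sup>2 * ln N > 0" using elim(4) by simp
    ultimately show ?case by (subst ereal_le_divide_pos) auto
  qed
  then show "ereal (1 / (32 * pi\<^sup>2)) \<le> liminf (\<lambda>N. mixing_time N (k N) \<epsilon> / ereal ((real N)\<^sup>2 * ln (real N)))"
    by (rule Liminf_bounded)
next
  fix k :: "nat \<Rightarrow> nat"
  assume half: "\<forall>N\<ge>1. real (k N) > real N / 2" and lim: "(\<lambda>N. real (k N) / real N) \<longlonglongrightarrow> \<rho>"
  \<comment> \<open>The smaller of half the limits of \<open>(2 * k - N) / N\<close> and
    \<open>(N - k) / N\<close>; the halving leaves room for strict inequalities that hold
    eventually.\<close>
  define \<delta> where "\<delta> = min (\<rho> - 1 / 2) ((1 - \<rho>) / 2)"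
  have \<delta>: "\<delta> > 0" using assms by (simp add: \<delta>_def)
  have \<rho>: "(1 + \<delta>) / 2 < \<rho>" "\<rho> < 1 - \<delta>" using assms by (auto simp: \<delta>_def min_def field_simps)
  have e: "\<forall>\<^sub>F N in sequentially. (1 + \<delta>) / 2 < real (k N) / real N"
    "\<forall>\<^sub>F N in sequentially. real (k N) / real N < 1 - \<delta>"
    by (rule order_tendstoD(1)[OF lim \<rho>(1)], rule order_tendstoD(2)[OF lim \<rho>(2)])
  have "\<forall>\<^sub>F N in sequentially. log_sobolev N (k N) \<ge> ereal (\<delta> ^ 3 / 288 / (real N)\<^sup>2)"
    using e eventually_ge_at_top[of 4]
  proof eventually_elim
    case (elim N)
    then have d: "\<delta> * N \<le> 2 * real (k N) - N" "\<delta> * N \<le> real N - k N" by (auto simp: field_simps)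
    have "\<delta> * N > 0" using \<delta> elim by simp
    then have "k N < N" "N < 2 * k N" using d by linarith+
    then show ?case by (intro log_sobolev_lower_bound elim d \<delta>)
  qed
  then show "\<exists>C'>0. \<forall>\<^sub>F N in sequentially. log_sobolev N (k N) \<ge> ereal (C' / (real N)\<^sup>2)"
    using \<delta> by (intro exI[of _ "\<delta> ^ 3 / 288"]) auto
qed

end
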